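(* Let $\mathbf{f}\in\mathbb{Z}^{54}$ be the hole in $\mathrm{cone}(A_{6\times4\times3})$ presented by Vlach, i.e. the vector of line sums of $6\times4\times3$ tables $z=(z_{ijk})$ given by \[ \Big(\sum_i z_{ijk}\Big)_{j,k}=\begin{pmatrix}1&1&1\\1&1&1\\1&1&1\\1&1&1\end{pmatrix},\quad \Big(\sum_j z_{ijk}\Big)_{i,k}=\begin{pmatrix}1&1&0\\1&1&0\\1&0&1\\1&0&1\\0&1&1\\0&1&1\end{pmatrix},\quad \Big(\sum_k z_{ijk}\Big)_{i,j}=\begin{pmatrix}1&0&0&1\\0&1&1&0\\1&1&0&0\\0&0&1&1\\1&0&1&0\\0&1&0&1\end{pmatrix}, \] and let $\mathbf{z}^*\in\mathbb{R}^{72}_+$ be the unique solution to $A_{6\times4\times3}\mathbf{z}=\mathbf{f}$, $\mathbf{z}\in\mathbb{R}^{72}_+$. Explicitly, $\mathbf{z}^*$ is the table whose $i$-th slice $(z^*_{ijk})_{j,k}$, for $i=1,\ldots,6$, is \[ \tfrac12\begin{pmatrix}1&1&0\\0&0&0\\0&0&0\\1&1&0\end{pmatrix},\ \tfrac12\begin{pmatrix}0&0&0\\1&1&0\\1&1&0\\0&0&0\end{pmatrix},\ \tfrac12\begin{pmatrix}1&0&1\\1&0&1\\0&0&0\\0&0&0\end{pmatrix},\ \tfrac12\begin{pmatrix}0&0&0\\0&0&0\\1&0&1\\1&0&1\end{pmatrix},\ \tfrac12\begin{pmatrix}0&1&1\\0&0&0\\0&1&1\\0&0&0\end{pmatrix},\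 \tfrac12\begin{pmatrix}0&0&0\\0&1&1\\0&0&0\\0&1&1\end{pmatrix}. \] Moreover, let $G$ denote the set of those $24$ columns of $A_{6\times4\times3}$ for which the corresponding entry of $\mathbf{z}^*$ is positive. Then the set of holes in $\mathrm{cone}(A_{6\times4\times3})$ is the set of all points that can be written uniquely as $\sigma(\mathbf{f}+\mathbf{s})$ with $\sigma\in S_6\times S_4\times S_3$ and with $\mathbf{s}\in\mathrm{monoid}(G)$.
   Context: For a $6\times4\times3$ table $z=(z_{ijk})_{1\le i\le6,\,1\le j\le4,\,1\le k\le3}$, the line sums are the $12+18+24=54$ numbers $\sum_i z_{ijk}$ (one for each $(j,k)$), $\sum_j z_{ijk}$ (one for each $(i,k)$) and $\sum_k z_{ijk}$ (one for each $(i,j)$). $A_{6\times4\times3}$ is the $54\times72$ $0/1$-matrix of the linear map sending a table to its vector of line sums; its columns are indexed by the cells $(i,j,k)$. $\mathrm{cone}(A_{6\times4\times3})\subseteq\mathbb{R}^{54}$ is the set of all nonnegative real linear combinations of its columns. For a finite set $G$ of integer vectors, $\mathrm{monoid}(G)$ is the set of all nonnegative integer linear combinations of elements of $G$. A hole of $\mathrm{cone}(A_{6\times4\times3})$ is a lattice point of $\mathrm{cone}(A_{6\times4\times3})$ (i.e. a point of $\mathrm{cone}(A_{6\times4\times3})\cap\mathbb{Z}^{54}$) that cannot be written as a nonnegative integer linear combination of the columns of $A_{6\times4\times3}$. The group $S_6\times S_4\times S_3$ acts on tables by permuting the values of the indices $i$, $j$, $k$ respectively, and correspondingly on vectors of line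 sums by permuting coordinates (a coordinate indexed by $(j,k)$, $(i,k)$ or $(i,j)$ is sent to the coordinate of the same type with permuted indices).
   Formalization: "Written uniquely" is taken to mean that the summands σ(f) and σ(s) are unique, i.e. (σ, s) is unique up to the stabilizer of f; since 24 permutations fix f, the pair (σ, s) itself is never unique. *)

theory Defs
  imports "HOL-Analysis.Analysis"
begin

type_synonym cell = "6 \<times> 4 \<times> 3"

(* The three summands index the (j,k)-, (i,k)- and (i,j)-line sums, respectively. *)
type_synonym line = "(4 \<times> 3) + (6 \<times> 3) + (6 \<times> 4)"

definition line_sums :: "real ^ cell \<Rightarrow> real ^ line" where
  "line_sums z = (\<chi> l. case l of
       Inl (j, k) \<Rightarrow> (\<Sum>i\<in>UNIV. z $ (i, j, k))
     | Inr (Inl (i, k)) \<Rightarrow> (\<Sum>j\<in>UNIV. z $ (i, j, k))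
     | Inr (Inr (i, j)) \<Rightarrow> (\<Sum>k\<in>UNIV. z $ (i, j, k)))"

definition A643 :: "real ^ cell ^ line" where
  "A643 = matrix line_sums"

lemma linear_line_sums: "linear line_sums"
  by (rule linearI)
    (auto simp: line_sums_def vec_eq_iff sum.distrib sum_distrib_left split: sum.splits)

lemma A643_mult: "A643 *v z = line_sums z"
  unfolding A643_def by (simp add: linear_line_sums matrix_vector_mul)

definition cone_of :: "real ^ 'n ^ 'm \<Rightarrow> (real ^ 'm) set" where
  "cone_of A = {\<Sum>c\<in>UNIV. x c *\<^sub>R column c A | x. \<forall>c. 0 \<le> x c}"

(* Only meaningful for finite G. *)
definition monoid_of :: "(real ^ 'm) set \<Rightarrow> (real ^ 'm) set" where
  "monoid_of G = {\<Sum>g\<in>G. real (n g) *\<^sub>R g | n :: real ^ 'm \<Rightarrow> nat. True}"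

definition holes :: "real ^ 'n ^ 'm \<Rightarrow> (real ^ 'm) set" where
  "holes A = {h \<in> cone_of A. (\<forall>l. h $ l \<in> \<int>) \<and> h \<notin> monoid_of (columns A)}"

definition index_perms :: "((6 \<Rightarrow> 6) \<times> (4 \<Rightarrow> 4) \<times> (3 \<Rightarrow> 3)) set" where
  "index_perms = {\<rho>. \<rho> permutes UNIV} \<times> {\<tau>. \<tau> permutes UNIV} \<times> {\<kappa>. \<kappa> permutes UNIV}"

definition perm_line :: "(6 \<Rightarrow> 6) \<times> (4 \<Rightarrow> 4) \<times> (3 \<Rightarrow> 3) \<Rightarrow> line \<Rightarrow> line" where
  "perm_line = (\<lambda>(\<rho>, \<tau>, \<kappa>).
     map_sum (map_prod \<tau> \<kappa>) (map_sum (map_prod \<rho> \<kappa>) (map_prod \<rho> \<tau>)))"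

(* The entry at coordinate l is moved to coordinate perm_line \<sigma> l. *)
definition act :: "(6 \<Rightarrow> 6) \<times> (4 \<Rightarrow> 4) \<times> (3 \<Rightarrow> 3) \<Rightarrow> real ^ line \<Rightarrow> real ^ line" where
  "act \<sigma> v = (\<chi> l. v $ inv (perm_line \<sigma>) l)"

(* "vector" numbers entries from 1; in the index type n, the last index n is the element 0. *)
definition vlach_jk :: "real ^ 3 ^ 4" where
  "vlach_jk = vector
     [vector [1, 1, 1],
      vector [1, 1, 1],
      vector [1, 1, 1],
      vector [1, 1, 1]]"

definition vlach_ik :: "real ^ 3 ^ 6" where
  "vlach_ik = vector
     [vector [1, 1, 0],
      vector [1, 1, 0],
      vector [1, 0, 1],
      vector [1, 0, 1],
      vector [0, 1, 1],
      vector [0, 1, 1]]"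

definition vlach_ij :: "real ^ 4 ^ 6" where
  "vlach_ij = vector
     [vector [1, 0, 0, 1],
      vector [0, 1, 1, 0],
      vector [1, 1, 0, 0],
      vector [0, 0, 1, 1],
      vector [1, 0, 1, 0],
      vector [0, 1, 0, 1]]"

(* The stabilizer of vlach in index_perms has 24 elements, so a representation
   h = act \<sigma> (vlach + s) never determines \<sigma>; what can be unique is the pair of
   summands act \<sigma> vlach and act \<sigma> s, i.e. (\<sigma>, s) up to that stabilizer. *)
definition vlach :: "real ^ line" where
  "vlach = (\<chi> l. case l of
       Inl (j, k) \<Rightarrow> vlach_jk $ j $ k
     | Inr (Inl (i, k)) \<Rightarrow> vlach_ik $ i $ k
     | Inr (Inr (i, j)) \<Rightarrow> vlach_ij $ i $ j)"

definition zstar_slices :: "real ^ 3 ^ 4 ^ 6" where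
  "zstar_slices = vector
     [vector [vector [1, 1, 0], vector [0, 0, 0], vector [0, 0, 0], vector [1, 1, 0]],
      vector [vector [0, 0, 0], vector [1, 1, 0], vector [1, 1, 0], vector [0, 0, 0]],
      vector [vector [1, 0, 1], vector [1, 0, 1], vector [0, 0, 0], vector [0, 0, 0]],
      vector [vector [0, 0, 0], vector [0, 0, 0], vector [1, 0, 1], vector [1, 0, 1]],
      vector [vector [0, 1, 1], vector [0, 0, 0], vector [0, 1, 1], vector [0, 0, 0]],
      vector [vector [0, 0, 0], vector [0, 1, 1], vector [0, 0, 0], vector [0, 1, 1]]]"

definition zstar :: "real ^ cell" where
  "zstar = (\<chi> c. case c of (i, j, k) \<Rightarrow> (1 / 2) * zstar_slices $ i $ j $ k)"

definition G643 :: "(real ^ line) set" where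
  "G643 = {column c A643 | c. zstar $ c > 0}"

end

theory Submission
  imports Defs
begin

text \<open>
  Suppose first that a hole \<open>h\<close> has a nonnegative real solution with an entry at least 1. Subtracting the column of
  that cell leaves a smaller hole, which by induction is a permuted \<^term>\<open>vlach + s\<close>; adding to \<^const>\<open>vlach\<close> a
  column outside \<^const>\<open>G643\<close> would produce an element of the monoid of all columns, so the column belongs to
  \<^const>\<open>G643\<close>. Otherwise every solution has all entries below 1. A solution of minimal support then carries no
  nonzero table with zero line sums, and a cube move (adding and subtracting \<open>\<epsilon>\<close> at the corners of a
  \<open>2 \<times> 2 \<times> 2\<close> subtable) never lifts an entry to 1. Each slice, seen as a subgraph of \<open>K\<^bsub>4,3\<^esub>\<close>, has a
  cycle space with an integer basis; the bases of all slices together are linearly independent in dimension 6, although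
  some combination with no integer coefficient is integral. A search over the slice supports, guided by the line sums and by
  the cube moves, shows that only the support of \<^const>\<open>zstar\<close> is possible up to permutation. The
  converse and the uniqueness hold because the zero line sums of \<^const>\<open>vlach\<close> confine all solutions of
  \<^term>\<open>vlach + s\<close> to that support, on which the line sums determine a table.
\<close>

text \<open>The dimension 6 is (4 - 1)(3 - 1): a 4 x 3 table with zero row and column sums is
  determined by six of its entries, so all slices share one six-dimensional space, and a table with
  zero line sums is a linear relation between its slices there. Every nonzero slice of a fractional
  solution contains a cycle. Independence therefore bounds the number of nonzero slices, and the sum
  of their dimensions, by six, which makes the search finite. Independence alone is far from enough.
  If elimination over the integers keeps unit pivots, nonintegral coefficients cannot combine to an
  integral vector; where this test is inconclusive, inequalities between entries obtained from cube
  moves are used. The surviving support has a simple shape. Each of its six slices is a 4-cycle, one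
  for each pair of rows; the three splittings of four rows into two pairs are matched with the three
  pairs of columns. The lines, with at most two cells each, link all these cells, and following the
  signs returns an entry to its own negative. This rules out a nonzero relation and forces the value
  1/2.\<close>

section \<open>Linear independence and integrality for lists of integer vectors\<close>

text \<open>Coefficients are paired with list positions and not with vectors, so a vector occurring
  twice has two coefficients. Independence of a list thus excludes repetitions.\<close>

definition comb :: "(real \<times> int list) list \<Rightarrow> nat \<Rightarrow> real" where
  "comb ls n = (\<Sum>(c, v)\<leftarrow>ls. c * of_int (v ! n))"

lemma comb_simps [simp]:
  "comb [] n = 0" "comb ((c, v) # ls) n = c * of_int (v ! n) + comb ls n"
  "comb (ls @ ls') n = comb ls n + comb ls' n"
  by (simp_all add: comb_def)

definition null :: "(real \<times> int list) list \<Rightarrow> bool" where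
  "null ls \<longleftrightarrow> list_all (\<lambda>x. fst x = 0) ls"

definition nonint :: "(real \<times> int list) list \<Rightarrow> bool" where
  "nonint ls \<longleftrightarrow> list_all (\<lambda>x. fst x \<notin> \<int>) ls"

lemma null_simps [simp]:
  "null []" "null ((c, v) # ls) \<longleftrightarrow> c = 0 \<and> null ls" "null (ls @ ls') \<longleftrightarrow> null ls \<and> null ls'"
  by (simp_all add: null_def)

lemma nonint_simps [simp]:
  "nonint []" "nonint ((c, v) # ls) \<longleftrightarrow> c \<notin> \<int> \<and> nonint ls" "nonint (ls @ ls') \<longleftrightarrow> nonint ls \<and> nonint ls'"
  by (simp_all add: nonint_def)

definition indep :: "nat \<Rightarrow> int list list \<Rightarrow> bool" where
  "indep m vs \<longleftrightarrow> (\<forall>ls. map snd ls = vs \<longrightarrow> (\<forall>n<m. comb ls n = 0) \<longrightarrow> null ls)"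

text \<open>Asking every coefficient, and not merely one, to be nonintegral allows any vector to be
  eliminated: whichever vector is left at the end still has a nonintegral coefficient.\<close>

definition fractional :: "nat \<Rightarrow> int list list \<Rightarrow> bool" where
  "fractional m vs \<longleftrightarrow> (\<exists>ls. map snd ls = vs \<and> nonint ls \<and> (\<forall>n<m. comb ls n \<in> \<int>))"

lemma comb_eq_0: "null ls \<Longrightarrow> comb ls n = 0"
  by (induction ls) auto

lemma indepD: "indep m vs \<Longrightarrow> map snd ls = vs \<Longrightarrow> (\<And>n. n < m \<Longrightarrow> comb ls n = 0) \<Longrightarrow> null ls"
  unfolding indep_def by blast

lemma null_map_0 [simp]: "null (map (\<lambda>v. (0, v)) vs)"
  by (induction vs) auto

lemma indep_prefix:
  assumes "indep m (us @ vs)" shows "indep m us"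
  unfolding indep_def
proof (intro allI impI)
  fix ls assume ls: "map snd ls = us" "\<forall>n<m. comb ls n = 0"
  have "map snd (ls @ map (\<lambda>v. (0, v)) vs) = us @ vs" using ls(1) by (simp add: comp_def)
  from indepD[OF assms this] ls show "null ls" by (simp add: comb_eq_0)
qed

fun lincomb :: "int \<Rightarrow> int \<Rightarrow> int list \<Rightarrow> int list \<Rightarrow> int list" where
  "lincomb g f (x # xs) (y # ys) = (g * x - f * y) # lincomb g f xs ys"
| "lincomb g f _ _ = []"

lemma length_lincomb [simp]: "length (lincomb g f v w) = min (length v) (length w)"
  by (induction g f v w rule: lincomb.induct) auto

lemma nth_lincomb [simp]:
  "n < length v \<Longrightarrow> n < length w \<Longrightarrow> lincomb g f v w ! n = g * v ! n - f * w ! n"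
  by (induction g f v w arbitrary: n rule: lincomb.induct) (auto simp: nth_Cons split: nat.splits)

fun red :: "nat \<times> int list \<Rightarrow> int list \<Rightarrow> int list" where
  "red (p, w) v = (let f = v ! p in if f = 0 then v else lincomb (w ! p) f v w)"

definition red_full :: "nat \<Rightarrow> int list \<Rightarrow> int list \<Rightarrow> int list" where
  "red_full p w v = lincomb (w ! p) (v ! p) v w"

text \<open>Meant for a pivot entry 1 or -1: the factor \<open>w ! p * v ! p\<close> then clears
  coordinate \<open>p\<close> while \<open>v\<close> keeps coefficient 1, so the integer span
  suffers no loss of index.\<close>

definition red_unit :: "nat \<Rightarrow> int list \<Rightarrow> int list \<Rightarrow> int list" where
  "red_unit p w v = lincomb 1 (w ! p * v ! p) v w"

lemma map_snd_append:
  assumes "map snd ls = us @ vs"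
  obtains l1 l2 where "ls = l1 @ l2" "map snd l1 = us" "map snd l2 = vs"
proof
  show "ls = take (length us) ls @ drop (length us) ls" by simp
  show "map snd (take (length us) ls) = us" "map snd (drop (length us) ls) = vs"
    by (simp_all add: take_map[symmetric] drop_map[symmetric] assms)
qed

lemma map_snd_Cons:
  assumes "map snd ls = w # vs"
  obtains c l where "ls = (c, w) # l" "map snd l = vs"
  using assms by (cases ls) force+

text \<open>Undoes an elimination. The multiples of the pivot vector \<open>w\<close> subtracted
  from the individual vectors are collected in the single coefficient \<open>c\<close>, and since no
  factor \<open>s v\<close> vanishes, nullity of the lifted combination passes to the given
  one.\<close>

lemma elim_lift:
  assumes L: "\<And>v. v \<in> set vs \<Longrightarrow> length (f v) = L"
    and f: "\<And>v. v \<in> set vs \<Longrightarrow> s v \<noteq> 0 \<and> (\<forall>n<L. f v ! n = s v * v ! n - t v * w ! n)"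
    and ls: "map snd ls = map f vs"
  shows "\<exists>ls' c. map snd ls' = vs \<and> (\<forall>n<L. comb ls' n + c * of_int (w ! n) = comb ls n) \<and>
     (null ls' \<longrightarrow> null ls)"
  using assms
proof (induction vs arbitrary: ls)
    case Nil
    then have e: "ls = []" by simp
    show ?case by (rule exI[of _ "[]"], rule exI[of _ 0]) (simp add: e)
  next
    case (Cons v vs)
    from Cons.prems(3) obtain a ls1 where ls: "ls = (a, f v) # ls1" "map snd ls1 = map f vs"
      by (cases ls) auto
    have "\<exists>l c. map snd l = vs \<and> (\<forall>n<L. comb l n + c * of_int (w ! n) = comb ls1 n) \<and>
      (null l \<longrightarrow> null ls1)"
      by (rule Cons.IH) (use Cons.prems(1,2) ls(2) in simp_all)
    then obtain l c where IH: "map snd l = vs"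
      "\<forall>n<L. comb l n + c * of_int (w ! n) = comb ls1 n"
      "null l \<longrightarrow> null ls1" by blast
    have fv: "s v \<noteq> 0" "\<forall>n<L. f v ! n = s v * v ! n - t v * w ! n" using Cons.prems(2) by auto
    show ?case
    proof (intro exI[of _ "(a * s v, v) # l"] exI[of _ "c - a * t v"] conjI allI impI)
      show "map snd ((a * s v, v) # l) = v # vs" using IH(1) by simp
      fix n assume n: "n < L"
      have "f v ! n = s v * v ! n - t v * w ! n" using fv(2) n by simp
      then have 1: "real_of_int (f v ! n) = of_int (s v) * of_int (v ! n) - of_int (t v) * of_int (w ! n)"
        by simp
      have 2: "comb ls1 n = comb l n + c * of_int (w ! n)" using IH(2) n by simp
      have ring: "a * S * X + C + (c - a * T) * W = a * (S * X - T * W) + (C + c * W)" for S X C T W :: real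
        by (simp add: algebra_simps)
      show "comb ((a * s v, v) # l) n + (c - a * t v) * of_int (w ! n) = comb ls n"
        by (simp only: ls(1) comb_simps 1 2) (rule ring)
    next
      assume "null ((a * s v, v) # l)"
      then show "null ls" using IH(3) fv(1) by (simp add: ls(1))
    qed
qed

lemma indep_red:
  assumes ind: "indep m (us @ w # vs)" and p: "p < m" "w ! p \<noteq> 0"
    and len: "length w = m" "\<And>v. v \<in> set vs \<Longrightarrow> length v = m"
  shows "indep m (us @ w # map (red (p, w)) vs)"
  unfolding indep_def
proof (intro allI impI)
  fix ls assume ls: "map snd ls = us @ w # map (red (p, w)) vs" and z: "\<forall>n<m. comb ls n = 0"
  obtain l1 l' where l': "ls = l1 @ l'" "map snd l1 = us" "map snd l' = w # map (red (p, w)) vs"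
    using ls by (rule map_snd_append)
  obtain c l2 where "l' = (c, w) # l2" "map snd l2 = map (red (p, w)) vs"
    using l'(3) by (rule map_snd_Cons)
  then have l: "ls = l1 @ (c, w) # l2" "map snd l1 = us" "map snd l2 = map (red (p, w)) vs"
    using l' by auto
  have "\<exists>l2' d. map snd l2' = vs \<and> (\<forall>n<m. comb l2' n + d * of_int (w ! n) = comb l2 n) \<and>
     (null l2' \<longrightarrow> null l2)"
    by (rule elim_lift[where s = "\<lambda>v. if v ! p = 0 then 1 else w ! p" and t = "\<lambda>v. v ! p", OF _ _ l(3)])
       (simp_all add: Let_def len p)
  then obtain l2' d where l2: "map snd l2' = vs" "\<And>n. n < m \<Longrightarrow> comb l2' n + d * of_int (w ! n) = comb l2 n"
     "null l2' \<Longrightarrow> null l2" by blast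
  let ?ls = "l1 @ (c + d, w) # l2'"
  have 1: "map snd ?ls = us @ w # vs" using l(2) l2(1) by simp
  have 2: "comb ?ls n = 0" if "n < m" for n
    using z[rule_format, OF that] l2(2)[OF that] unfolding l(1) by (simp add: algebra_simps)
  have all0: "null ?ls"
    by (rule indepD[OF ind 1 2])
  then have l2z: "null l2" by (intro l2(3)) simp
  \<comment> \<open>The pivot coordinate isolates the correction \<open>d\<close>: both combinations
    vanish there, but \<open>w ! p\<close> does not.\<close>
  have "comb l2' p = 0" by (rule comb_eq_0) (use all0 in simp)
  moreover have "comb l2 p = 0" using l2z by (rule comb_eq_0)
  ultimately have "d = 0" using l2(2)[OF p(1)] p(2) by simp
  then show "null ls" using all0 l2z by (simp add: l(1))
qed

text \<open>Induction on the number of coordinates: a vector that is nonzero in the last coordinate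
  is spent to clear that coordinate in the others, which leaves one vector and one coordinate fewer.
  The vectors keep their length \<open>L\<close>; only the range of inspected coordinates
  shrinks.\<close>

lemma indep_le:
  assumes "indep m vs" "\<And>v. v \<in> set vs \<Longrightarrow> length v = L" "m \<le> L"
  shows "length vs \<le> m"
  using assms
proof (induction m arbitrary: vs)
  case 0
  show ?case
  proof (rule ccontr)
    assume "\<not> length vs \<le> 0"
    then obtain w ws where "vs = w # ws" by (cases vs) auto
    with indepD[OF 0(1), of "map (\<lambda>v. (1, v)) vs"] show False by (simp add: comp_def)
  qed
next
  case (Suc m)
  show ?case
  proof (cases "\<exists>w\<in>set vs. w ! m \<noteq> 0")
    case False
    have z: "comb ls m = 0" if "map snd ls = vs" for ls
    proof -
      have "\<forall>v\<in>snd ` set ls. v ! m = 0" using False that by (metis list.set_map)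
      then show ?thesis by (induction ls) auto
    qed
    have "indep m vs" unfolding indep_def
    proof (intro allI impI)
      fix ls assume ls: "map snd ls = vs" "\<forall>n<m. comb ls n = 0"
      have "comb ls n = 0" if "n < Suc m" for n using that ls z by (cases "n = m") auto
      then show "null ls" using indepD[OF Suc.prems(1) ls(1)] by blast
    qed
    from Suc.IH[OF this Suc.prems(2)] Suc.prems(3) show ?thesis by simp
  next
    case True
    then obtain w xs ys where w: "w ! m \<noteq> 0" "vs = xs @ w # ys" by (meson split_list)
    let ?f = "red_full m w"
    have len: "length w = L" "\<And>v. v \<in> set (xs @ ys) \<Longrightarrow> length v = L" using Suc.prems(2) w by auto
    have "indep m (map ?f (xs @ ys))" unfolding indep_def
    proof (intro allI impI)
      fix ls assume ls: "map snd ls = map ?f (xs @ ys)" "\<forall>n<m. comb ls n = 0"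
      have "\<exists>l d. map snd l = xs @ ys \<and> (\<forall>n<L. comb l n + d * of_int (w ! n) = comb ls n) \<and>
        (null l \<longrightarrow> null ls)"
        by (rule elim_lift[where s = "\<lambda>v. w ! m" and t = "\<lambda>v. v ! m", OF _ _ ls(1)])
           (simp_all add: red_full_def len[unfolded set_append] w(1))
      then obtain l d where l: "map snd l = xs @ ys" "\<And>n. n < L \<Longrightarrow> comb l n + d * of_int (w ! n) = comb ls n"
        "null l \<Longrightarrow> null ls" by blast
      have "comb ls m = 0"
      proof -
        have "\<forall>v\<in>snd ` set ls. v ! m = 0"
        proof -
          have "snd ` set ls = ?f ` set (xs @ ys)" using ls(1) by (metis list.set_map)
          then show ?thesis using len Suc.prems(3) by (auto simp: red_full_def)
        qed
        then show ?thesis by (induction ls) auto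
      qed
      then have 0: "comb ls n = 0" if "n < Suc m" for n using that ls(2) by (cases "n = m") auto
      from l(1) obtain a b where ab: "l = a @ b" "map snd a = xs" "map snd b = ys"
        by (rule map_snd_append)
      have 1: "map snd (a @ (d, w) # b) = vs" using ab w by simp
      have 2: "comb (a @ (d, w) # b) n = 0" if "n < Suc m" for n
        using l(2)[of n] 0[OF that] that Suc.prems(3) ab by (simp add: algebra_simps)
      have "null (a @ (d, w) # b)"
        by (rule indepD[OF Suc.prems(1) 1 2])
      then show "null ls" by (intro l(3)) (simp add: ab)
    qed
    then have "length (map ?f (xs @ ys)) \<le> m"
      by (rule Suc.IH) (use Suc.prems(3) in \<open>auto simp: red_full_def len(1) len(2)[unfolded set_append]\<close>)
    then show ?thesis using w by simp
  qed
qed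

text \<open>For an integral vector \<open>X\<close>, the numbers
  \<open>w' ! p * X n - X p * w' ! n\<close> are integral, and this map annihilates all multiples of
  \<open>w'\<close>. Hence \<open>w\<close> disappears whatever its coefficient, while the other
  coefficients stay as they are. Working with \<open>w'\<close> in place of its multiple
  \<open>w\<close> avoids multiplying the remaining vectors by \<open>g\<close>.\<close>

lemma fractional_step:
  assumes fr: "fractional m (w # vs)" and p: "p < m" and w: "\<And>n. n < m \<Longrightarrow> w ! n = g * w' ! n" "w' ! p \<noteq> 0"
    and len: "length w' = m" "\<And>v. v \<in> set vs \<Longrightarrow> length v = m"
  shows "fractional m (map (red_full p w') vs)"
proof -
  from fr obtain ls where ls: "map snd ls = w # vs" "nonint ls" "\<forall>n<m. comb ls n \<in> \<int>"
    unfolding fractional_def by metis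
  obtain t l where l: "ls = (t, w) # l" "map snd l = vs" using ls(1) by (rule map_snd_Cons)
  let ?l = "map (\<lambda>(c, v). (c, red_full p w' v)) l"
  have r1: "map snd ?l = map (red_full p w') vs"
    unfolding l(2)[symmetric] by (simp add: comp_def case_prod_beta)
  have r2: "nonint ?l" using ls(2) l(1) by (simp add: case_prod_beta nonint_def list.pred_map comp_def)
  have r3: "comb ?l n \<in> \<int>" if n: "n < m" for n
  proof -
    have c: "comb ?l n = of_int (w' ! p) * comb l n - comb l p * of_int (w' ! n)"
    proof -
      have "\<forall>v\<in>snd ` set l. length v = m" using len(2) l(2) by (metis list.set_map)
      then show ?thesis
      proof (induction l)
        case (Cons a l)
        obtain b v where a: "a = (b, v)" by fastforce
        have e: "red_full p w' v ! n = w' ! p * v ! n - v ! p * w' ! n"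
          using Cons.prems n p len(1) by (simp add: red_full_def a)
        show ?case using Cons by (simp add: a e algebra_simps)
      qed simp
    qed
    define X where "X = (\<lambda>n. comb ls n)"
    have d: "comb l n = X n - t * of_int (g * w' ! n)" "comb l p = X p - t * of_int (g * w' ! p)"
      using l(1) w(1)[OF n] w(1)[OF p] by (auto simp: X_def)
    have "comb ?l n = of_int (w' ! p) * X n - X p * of_int (w' ! n)"
      unfolding c d by (simp add: algebra_simps)
    moreover have "X n \<in> \<int>" "X p \<in> \<int>" using ls(3) n p by (auto simp: X_def)
    ultimately show ?thesis by simp
  qed
  show ?thesis unfolding fractional_def
    by (rule exI[of _ ?l]) (use r1 r2 r3 in simp)
qed

lemma fractional_rotate1: "fractional m vs \<Longrightarrow> fractional m (rotate1 vs)"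
  unfolding fractional_def
proof (elim exE conjE)
  fix ls assume ls: "map snd ls = vs" "nonint ls" "\<forall>n<m. comb ls n \<in> \<int>"
  have 1: "comb (rotate1 ls) n = comb ls n" for n by (cases ls) auto
  have 2: "map snd (rotate1 ls) = rotate1 vs" by (simp only: rotate1_map[symmetric] ls(1))
  show "\<exists>ls. map snd ls = rotate1 vs \<and> nonint ls \<and> (\<forall>n<m. comb ls n \<in> \<int>)"
    by (rule exI[of _ "rotate1 ls"]) (use ls 1 2 in \<open>simp add: nonint_def list_all_iff\<close>)
qed

lemma not_fractional_single:
  assumes "n < m" "v ! n = 1 \<or> v ! n = -1" shows "\<not> fractional m [v]"
proof
  assume "fractional m [v]"
  then obtain ls where ls: "map snd ls = [v]" "nonint ls" "comb ls n \<in> \<int>"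
    using assms(1) unfolding fractional_def by metis
  obtain c l where "ls = (c, v) # l" "map snd l = []" using ls(1) by (rule map_snd_Cons)
  then have c: "c \<notin> \<int>" "c * of_int (v ! n) \<in> \<int>" using ls by simp_all
  from assms(2) have "c \<in> \<int>"
    by (rule disjE) (use c(2) in \<open>simp_all add: minus_in_Ints_iff\<close>)
  with c show False by simp
qed

section \<open>Supports of rows and slices, and integer bases of cycle spaces\<close>

datatype col = K0 | K1 | K2
datatype row = R0 | R1 | R2 | R3
text \<open>\<open>Mi0\<close>, \<open>Mi1\<close>, \<open>Mi2\<close> are the supports missing
  exactly one column. Supports of a single cell are absent, because an entry strictly between 0 and
  1 cannot stand alone in a row with integral sum.\<close>

datatype rsupp = Em | Mi0 | Mi1 | Mi2 | Fu
datatype slice = Sl rsupp rsupp rsupp rsupp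

lemma UNIV_col: "UNIV = {K0, K1, K2}" using col.exhaust by auto
lemma UNIV_row: "UNIV = {R0, R1, R2, R3}" using row.exhaust by auto

instance col :: finite by standard (simp add: UNIV_col)
instance row :: finite by standard (simp add: UNIV_row)

lemma sum_col: "(\<Sum>k\<in>UNIV. f k) = f K0 + f K1 + (f K2 :: 'a :: comm_monoid_add)"
  by (simp add: UNIV_col add.assoc)
lemma sum_row: "(\<Sum>r\<in>UNIV. f r) = f R0 + f R1 + f R2 + (f R3 :: 'a :: comm_monoid_add)"
  by (simp add: UNIV_row add.assoc)
lemma all_col: "(\<forall>k. P k) \<longleftrightarrow> P K0 \<and> P K1 \<and> P K2"
  by (metis col.exhaust)
lemma all_row: "(\<forall>r. P r) \<longleftrightarrow> P R0 \<and> P R1 \<and> P R2 \<and> P R3"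
  by (metis row.exhaust)

fun has :: "col \<Rightarrow> rsupp \<Rightarrow> bool" where
  "has K0 Em = False" | "has K0 Mi0 = False" | "has K0 Mi1 = True" | "has K0 Mi2 = True" | "has K0 Fu = True"
| "has K1 Em = False" | "has K1 Mi0 = True" | "has K1 Mi1 = False" | "has K1 Mi2 = True" | "has K1 Fu = True"
| "has K2 Em = False" | "has K2 Mi0 = True" | "has K2 Mi1 = True" | "has K2 Mi2 = False" | "has K2 Fu = True"

fun rowof :: "row \<Rightarrow> slice \<Rightarrow> rsupp" where
  "rowof R0 (Sl a b c d) = a" | "rowof R1 (Sl a b c d) = b"
| "rowof R2 (Sl a b c d) = c" | "rowof R3 (Sl a b c d) = d"

text \<open>Coordinates 0 and 1 record the contribution to the sums of columns \<open>K0\<close> and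
  \<open>K1\<close>, the other six the entries of rows \<open>R0\<close>, \<open>R1\<close>,
  \<open>R2\<close> in these columns. Column \<open>K2\<close> is determined by zero row sums, and
  row \<open>R3\<close> by zero column sums once these hold, so \<open>R3\<close> shows up only in
  the first two coordinates.\<close>

fun vec8 :: "row \<Rightarrow> 'a \<Rightarrow> 'a \<Rightarrow> 'a :: zero list" where
  "vec8 R0 x y = [x, y, x, y, 0, 0, 0, 0]"
| "vec8 R1 x y = [x, y, 0, 0, x, y, 0, 0]"
| "vec8 R2 x y = [x, y, 0, 0, 0, 0, x, y]"
| "vec8 R3 x y = [x, y, 0, 0, 0, 0, 0, 0]"

text \<open>A basis of the zero-sum rows on the given support, chosen so that the coefficients of a
  row are some of its own entries. This is how nonintegral entries become nonintegral
  coefficients.\<close>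

fun pv :: "row \<Rightarrow> rsupp \<Rightarrow> int list list" where
  "pv r Em = []"
| "pv r Mi0 = [vec8 r 0 1]"
| "pv r Mi1 = [vec8 r 1 0]"
| "pv r Mi2 = [vec8 r 1 (-1)]"
| "pv r Fu = [vec8 r 1 0, vec8 r 0 1]"

fun pvs :: "slice \<Rightarrow> int list list" where
  "pvs (Sl a b c d) = pv R0 a @ pv R1 b @ pv R2 c @ pv R3 d"

fun pick :: "nat \<Rightarrow> int list list \<Rightarrow> int list list \<Rightarrow> int list list" where
  "pick p acc [] = acc"
| "pick p acc (v # vs) = (if v ! p = 1 then map (red_unit p v) (acc @ vs)
     else if v ! p = - 1 then map (red_unit p v) (acc @ vs) else pick p (acc @ [v]) vs)"

text \<open>The vectors of \<open>pvs\<close> have zero row sums already. Clearing the sums of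
  \<open>K0\<close> and \<open>K1\<close> leaves the cycle space, as the sum of \<open>K2\<close>
  follows. \<open>pick_local\<close> confirms that unit pivots suffice for this, so that the two
  dropped coordinates are indeed zero.\<close>

definition basis :: "slice \<Rightarrow> int list list" where
  "basis h = map (drop 2) (pick (Suc 0) [] (pick 0 [] (pvs h)))"

lemma vec8_nth: "n < 8 \<Longrightarrow> comb [(c, vec8 r x y)] n = vec8 r (c * of_int x) (c * of_int y) ! n"
  by (cases r) (auto simp: less_Suc_eq eval_nat_numeral)

lemma vec8_add: "n < 8 \<Longrightarrow> vec8 r (x + x') (y + y' :: real) ! n = vec8 r x y ! n + vec8 r x' y' ! n"
  by (cases r) (auto simp: less_Suc_eq eval_nat_numeral)

lemma vec8_Ints: "n < 8 \<Longrightarrow> x \<in> \<int> \<Longrightarrow> y \<in> \<int> \<Longrightarrow> vec8 r x (y :: real) ! n \<in> \<int>"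
  by (cases r) (auto simp: less_Suc_eq eval_nat_numeral)

lemma length_vec8 [simp]: "length (vec8 r x y) = 8" by (cases r) auto

lemma length_pvs: "v \<in> set (pvs h) \<Longrightarrow> length v = 8"
proof -
  have "v \<in> set (pv r s) \<Longrightarrow> length v = 8" for r s by (cases s) auto
  then show "v \<in> set (pvs h) \<Longrightarrow> length v = 8" by (cases h) auto
qed

lemma row_move:
  assumes "map snd ls = pv r s"
  shows "\<exists>u :: col \<Rightarrow> real. (\<forall>k. \<not> has k s \<longrightarrow> u k = 0) \<and> u K0 + u K1 + u K2 = 0 \<and>
    (\<forall>n<8. comb ls n = vec8 r (u K0) (u K1) ! n) \<and> (u K0 = 0 \<and> u K1 = 0 \<and> u K2 = 0 \<longrightarrow> null ls)"
proof (cases s)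
  case Em
  then have "ls = []" using assms by simp
  then show ?thesis using Em by (intro exI[of _ "\<lambda>_. 0"]) (cases r; auto simp: less_Suc_eq eval_nat_numeral)
next
  case Mi0
  then obtain c where "ls = [(c, vec8 r 0 1)]" using assms by (auto elim!: map_snd_Cons)
  then show ?thesis using Mi0
    by (intro exI[of _ "\<lambda>k. case k of K0 \<Rightarrow> 0 | K1 \<Rightarrow> c | K2 \<Rightarrow> - c"])
       (auto simp: all_col vec8_nth simp del: comb_simps(2))
next
  case Mi1
  then obtain c where "ls = [(c, vec8 r 1 0)]" using assms by (auto elim!: map_snd_Cons)
  then show ?thesis using Mi1
    by (intro exI[of _ "\<lambda>k. case k of K0 \<Rightarrow> c | K1 \<Rightarrow> 0 | K2 \<Rightarrow> - c"])
       (auto simp: all_col vec8_nth simp del: comb_simps(2))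
next
  case Mi2
  then obtain c where "ls = [(c, vec8 r 1 (-1))]" using assms by (auto elim!: map_snd_Cons)
  then show ?thesis using Mi2
    by (intro exI[of _ "\<lambda>k. case k of K0 \<Rightarrow> c | K1 \<Rightarrow> - c | K2 \<Rightarrow> 0"])
       (auto simp: all_col vec8_nth simp del: comb_simps(2))
next
  case Fu
  then obtain c d where ls: "ls = [(c, vec8 r 1 0), (d, vec8 r 0 1)]"
    using assms by (auto elim!: map_snd_Cons)
  have "comb ls n = vec8 r c d ! n" if "n < 8" for n
    using vec8_nth[OF that, of c r 1 0] vec8_nth[OF that, of d r 0 1] vec8_add[OF that, of r c 0 0 d]
    by (simp add: ls)
  then show ?thesis using Fu
    by (intro exI[of _ "\<lambda>k. case k of K0 \<Rightarrow> c | K1 \<Rightarrow> d | K2 \<Rightarrow> - c - d"]) (auto simp: ls all_col)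
qed

text \<open>A row with integral sum need not be a zero-sum row, but it becomes congruent to one
  modulo the integers. The coefficients are its own entries; only for \<open>Mi2\<close> do the two
  sides differ, by the row sum.\<close>

lemma row_frac:
  fixes x :: "col \<Rightarrow> real"
  assumes x: "\<And>k. has k s \<Longrightarrow> x k \<notin> \<int>" "\<And>k. \<not> has k s \<Longrightarrow> x k = 0" and sum: "x K0 + x K1 + x K2 \<in> \<int>"
  shows "\<exists>ls. map snd ls = pv r s \<and> nonint ls \<and> (\<forall>n<8. comb ls n - vec8 r (x K0) (x K1) ! n \<in> \<int>)"
proof (cases s)
  case Em
  then have "x K0 = 0" "x K1 = 0" using x(2) by auto
  then show ?thesis using Em by (intro exI[of _ "[]"]) (cases r; auto simp: less_Suc_eq eval_nat_numeral)
next
  case Mi0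
  then have "x K0 = 0" "x K1 \<notin> \<int>" using x by auto
  then show ?thesis using Mi0
    by (intro exI[of _ "[(x K1, vec8 r 0 1)]"]) (auto simp: vec8_nth simp del: comb_simps(2))
next
  case Mi1
  then have "x K1 = 0" "x K0 \<notin> \<int>" using x by auto
  then show ?thesis using Mi1
    by (intro exI[of _ "[(x K0, vec8 r 1 0)]"]) (auto simp: vec8_nth simp del: comb_simps(2))
next
  case Mi2
  then have 1: "x K2 = 0" "x K0 \<notin> \<int>" using x by auto
  have "comb [(x K0, vec8 r 1 (-1))] n - vec8 r (x K0) (x K1) ! n \<in> \<int>" if n: "n < 8" for n
  proof -
    have "vec8 r (x K0) (x K1) ! n = vec8 r (x K0) (- x K0) ! n + vec8 r 0 (x K0 + x K1) ! n"
      using vec8_add[OF n, of r "x K0" 0 "- x K0" "x K0 + x K1"] by simp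
    moreover have "vec8 r 0 (x K0 + x K1) ! n \<in> \<int>" using vec8_Ints[OF n] sum 1(1) by simp
    ultimately show ?thesis using vec8_nth[OF n, of "x K0" r 1 "-1"] by simp
  qed
  then show ?thesis using Mi2 1
    by (intro exI[of _ "[(x K0, vec8 r 1 (-1))]"]) (auto simp del: comb_simps(2))
next
  case Fu
  have "comb [(x K0, vec8 r 1 0), (x K1, vec8 r 0 1)] n = vec8 r (x K0) (x K1) ! n" if "n < 8" for n
    using vec8_nth[OF that, of "x K0" r 1 0] vec8_nth[OF that, of "x K1" r 0 1]
      vec8_add[OF that, of r "x K0" 0 0 "x K1"] by simp
  then show ?thesis using Fu x(1)
    by (intro exI[of _ "[(x K0, vec8 r 1 0), (x K1, vec8 r 0 1)]"]) (auto simp del: comb_simps(2))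
qed

definition tot8 :: "(row \<Rightarrow> col \<Rightarrow> real) \<Rightarrow> nat \<Rightarrow> real" where
  "tot8 U n = vec8 R0 (U R0 K0) (U R0 K1) ! n + vec8 R1 (U R1 K0) (U R1 K1) ! n +
     vec8 R2 (U R2 K0) (U R2 K1) ! n + vec8 R3 (U R3 K0) (U R3 K1) ! n"

definition glob :: "(row \<Rightarrow> col \<Rightarrow> real) \<Rightarrow> nat \<Rightarrow> real" where
  "glob U n = [U R0 K0, U R0 K1, U R1 K0, U R1 K1, U R2 K0, U R2 K1] ! n"

lemma tot8_simps:
  "tot8 U 0 = (\<Sum>r\<in>UNIV. U r K0)" "tot8 U (Suc 0) = (\<Sum>r\<in>UNIV. U r K1)"
  "n < 6 \<Longrightarrow> tot8 U (n + 2) = glob U n"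
  by (auto simp: tot8_def glob_def sum_row less_Suc_eq eval_nat_numeral)

lemma slice_move:
  assumes "map snd ls = pvs h"
  shows "\<exists>U. (\<forall>r k. \<not> has k (rowof r h) \<longrightarrow> U r k = 0) \<and> (\<forall>r. (\<Sum>k\<in>UNIV. U r k) = 0) \<and>
    (\<forall>n<8. comb ls n = tot8 U n) \<and> ((\<forall>r k. U r k = 0) \<longrightarrow> null ls)"
proof -
  obtain a b c d where h: "h = Sl a b c d" by (cases h)
  from assms obtain l0 l where 0: "ls = l0 @ l" "map snd l0 = pv R0 a" "map snd l = pv R1 b @ pv R2 c @ pv R3 d"
    unfolding h pvs.simps by (rule map_snd_append)
  from 0(3) obtain l1 m where 1: "l = l1 @ m" "map snd l1 = pv R1 b" "map snd m = pv R2 c @ pv R3 d"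
    by (rule map_snd_append)
  from 1(3) obtain l2 l3 where 2: "m = l2 @ l3" "map snd l2 = pv R2 c" "map snd l3 = pv R3 d"
    by (rule map_snd_append)
  from row_move[OF 0(2)] obtain u0 where u0: "\<forall>k. \<not> has k a \<longrightarrow> u0 k = 0" "u0 K0 + u0 K1 + u0 K2 = 0"
    "\<forall>n<8. comb l0 n = vec8 R0 (u0 K0) (u0 K1) ! n" "u0 K0 = 0 \<and> u0 K1 = 0 \<and> u0 K2 = 0 \<longrightarrow> null l0"
    by (elim exE conjE)
  from row_move[OF 1(2)] obtain u1 where u1: "\<forall>k. \<not> has k b \<longrightarrow> u1 k = 0" "u1 K0 + u1 K1 + u1 K2 = 0"
    "\<forall>n<8. comb l1 n = vec8 R1 (u1 K0) (u1 K1) ! n" "u1 K0 = 0 \<and> u1 K1 = 0 \<and> u1 K2 = 0 \<longrightarrow> null l1"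
    by (elim exE conjE)
  from row_move[OF 2(2)] obtain u2 where u2: "\<forall>k. \<not> has k c \<longrightarrow> u2 k = 0" "u2 K0 + u2 K1 + u2 K2 = 0"
    "\<forall>n<8. comb l2 n = vec8 R2 (u2 K0) (u2 K1) ! n" "u2 K0 = 0 \<and> u2 K1 = 0 \<and> u2 K2 = 0 \<longrightarrow> null l2"
    by (elim exE conjE)
  from row_move[OF 2(3)] obtain u3 where u3: "\<forall>k. \<not> has k d \<longrightarrow> u3 k = 0" "u3 K0 + u3 K1 + u3 K2 = 0"
    "\<forall>n<8. comb l3 n = vec8 R3 (u3 K0) (u3 K1) ! n" "u3 K0 = 0 \<and> u3 K1 = 0 \<and> u3 K2 = 0 \<longrightarrow> null l3"
    by (elim exE conjE)
  define U where "U = (\<lambda>r. case r of R0 \<Rightarrow> u0 | R1 \<Rightarrow> u1 | R2 \<Rightarrow> u2 | R3 \<Rightarrow> u3)"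
  have U: "U R0 = u0" "U R1 = u1" "U R2 = u2" "U R3 = u3" by (simp_all add: U_def)
  have "(\<forall>r k. \<not> has k (rowof r h) \<longrightarrow> U r k = 0)"
    using u0(1) u1(1) u2(1) u3(1) unfolding all_row h by (simp add: U)
  moreover have "\<forall>r. (\<Sum>k\<in>UNIV. U r k) = 0"
    using u0(2) u1(2) u2(2) u3(2) unfolding all_row by (simp add: U sum_col)
  moreover have "\<forall>n<8. comb ls n = tot8 U n"
    using u0(3) u1(3) u2(3) u3(3) by (simp add: tot8_def U 0(1) 1(1) 2(1) add.assoc del: vec8.simps)
  moreover have "(\<forall>r k. U r k = 0) \<longrightarrow> null ls"
    using u0(4) u1(4) u2(4) u3(4) unfolding all_row all_col by (simp add: U 0(1) 1(1) 2(1))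
  ultimately show ?thesis by (intro exI[of _ U] conjI)
qed

lemma slice_frac:
  assumes X: "\<And>r k. has k (rowof r h) \<Longrightarrow> X r k \<notin> \<int>" "\<And>r k. \<not> has k (rowof r h) \<Longrightarrow> X r k = 0"
    and sum: "\<And>r. (\<Sum>k\<in>UNIV. X r k) \<in> \<int>"
  shows "\<exists>ls. map snd ls = pvs h \<and> nonint ls \<and> (\<forall>n<8. comb ls n - tot8 X n \<in> \<int>)"
proof -
  have *: "\<exists>ls. map snd ls = pv r (rowof r h) \<and> nonint ls \<and> (\<forall>n<8. comb ls n - vec8 r (X r K0) (X r K1) ! n \<in> \<int>)" for r
    by (rule row_frac) (use X sum[of r] in \<open>simp_all add: sum_col\<close>)
  obtain a b c d where h: "h = Sl a b c d" by (cases h)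
  from *[of R0] obtain l0 where 0: "map snd l0 = pv R0 a" "nonint l0" "\<forall>n<8. comb l0 n - vec8 R0 (X R0 K0) (X R0 K1) ! n \<in> \<int>"
    unfolding h rowof.simps by (elim exE conjE)
  from *[of R1] obtain l1 where 1: "map snd l1 = pv R1 b" "nonint l1" "\<forall>n<8. comb l1 n - vec8 R1 (X R1 K0) (X R1 K1) ! n \<in> \<int>"
    unfolding h rowof.simps by (elim exE conjE)
  from *[of R2] obtain l2 where 2: "map snd l2 = pv R2 c" "nonint l2" "\<forall>n<8. comb l2 n - vec8 R2 (X R2 K0) (X R2 K1) ! n \<in> \<int>"
    unfolding h rowof.simps by (elim exE conjE)
  from *[of R3] obtain l3 where 3: "map snd l3 = pv R3 d" "nonint l3" "\<forall>n<8. comb l3 n - vec8 R3 (X R3 K0) (X R3 K1) ! n \<in> \<int>"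
    unfolding h rowof.simps by (elim exE conjE)
  have "comb (l0 @ l1 @ l2 @ l3) n - tot8 X n \<in> \<int>" if "n < 8" for n
  proof -
    have "comb (l0 @ l1 @ l2 @ l3) n - tot8 X n =
      (comb l0 n - vec8 R0 (X R0 K0) (X R0 K1) ! n) + (comb l1 n - vec8 R1 (X R1 K0) (X R1 K1) ! n) +
      (comb l2 n - vec8 R2 (X R2 K0) (X R2 K1) ! n) + (comb l3 n - vec8 R3 (X R3 K0) (X R3 K1) ! n)"
      by (simp add: tot8_def del: vec8.simps)
    also have "\<dots> \<in> \<int>"
      by (intro Ints_add 0(3)[rule_format] 1(3)[rule_format] 2(3)[rule_format] 3(3)[rule_format] that)
    finally show ?thesis .
  qed
  then show ?thesis by (intro exI[of _ "l0 @ l1 @ l2 @ l3"]) (simp add: h 0 1 2 3)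
qed

lemma pick_cases:
  "pick p acc vs = acc @ vs \<or> (\<exists>xs w ys. acc @ vs = xs @ w # ys \<and> (w ! p = 1 \<or> w ! p = - 1) \<and>
     pick p acc vs = map (red_unit p w) (xs @ ys))"
proof (induction vs arbitrary: acc)
  case (Cons v vs)
  show ?case
  proof (cases "v ! p = 1 \<or> v ! p = - 1")
    case True
    then have "pick p acc (v # vs) = map (red_unit p v) (acc @ vs)" by auto
    with True show ?thesis by blast
  next
    case False
    then show ?thesis using Cons.IH[of "acc @ [v]"] by simp
  qed
qed simp

lemma length_red_unit [simp]: "length (red_unit p w v) = min (length v) (length w)"
  by (simp add: red_unit_def)

lemma pick_length:
  assumes "\<And>v. v \<in> set vs \<Longrightarrow> length v = L"
  shows "v \<in> set (pick p [] vs) \<Longrightarrow> length v = L"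
  using pick_cases[of p "[]" vs] assms by auto

lemma pick_move:
  assumes L: "\<And>v. v \<in> set vs \<Longrightarrow> length v = L" and p: "p < L" and ls: "map snd ls = pick p [] vs"
  shows "\<exists>ls'. map snd ls' = vs \<and> (\<forall>n<L. comb ls' n = comb ls n) \<and> (null ls' \<longrightarrow> null ls)"
proof (cases "pick p [] vs = vs")
  case True
  then show ?thesis using ls by auto
next
  case False
  then obtain xs w ys where w: "vs = xs @ w # ys" "pick p [] vs = map (red_unit p w) (xs @ ys)"
    using pick_cases[of p "[]" vs] by auto
  have len: "length w = L" "\<And>v. v \<in> set (xs @ ys) \<Longrightarrow> length v = L" using L w(1) by auto
  have "\<exists>l c. map snd l = xs @ ys \<and> (\<forall>n<L. comb l n + c * of_int (w ! n) = comb ls n) \<and> (null l \<longrightarrow> null ls)"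
    by (rule elim_lift[where f = "red_unit p w" and s = "\<lambda>_. 1" and t = "\<lambda>v. w ! p * v ! p"])
       (use ls w(2) p in \<open>simp_all add: len[unfolded set_append] red_unit_def\<close>)
  then obtain l c where l: "map snd l = xs @ ys" "\<forall>n<L. comb l n + c * of_int (w ! n) = comb ls n" "null l \<longrightarrow> null ls"
    by blast
  obtain l1 l2 where l12: "l = l1 @ l2" "map snd l1 = xs" "map snd l2 = ys" using l(1) by (rule map_snd_append)
  show ?thesis
    by (rule exI[of _ "l1 @ (c, w) # l2"]) (use l l12 w(1) in \<open>auto simp: algebra_simps\<close>)
qed

text \<open>The reduced vectors keep their coefficients. Removing the pivot vector changes the
  combination by a multiple of \<open>w\<close> whose factor is, up to sign, the value of the
  combination at \<open>p\<close>, and this is integral because \<open>T p\<close> is.\<close>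

lemma pick_frac:
  assumes L: "\<And>v. v \<in> set vs \<Longrightarrow> length v = L" and p: "p < L" and T: "T p \<in> \<int>"
    and ls: "map snd ls = vs" "nonint ls" "\<forall>n<L. comb ls n - T n \<in> \<int>"
  shows "\<exists>ls'. map snd ls' = pick p [] vs \<and> nonint ls' \<and> (\<forall>n<L. comb ls' n - T n \<in> \<int>)"
proof (cases "pick p [] vs = vs")
  case True
  then show ?thesis using ls by auto
next
  case False
  then obtain xs w ys where w: "vs = xs @ w # ys" "w ! p = 1 \<or> w ! p = - 1" "pick p [] vs = map (red_unit p w) (xs @ ys)"
    using pick_cases[of p "[]" vs] by auto
  have len: "length w = L" "\<And>v. v \<in> set (xs @ ys) \<Longrightarrow> length v = L" using L w(1) by auto
  obtain l1 l' where 1: "ls = l1 @ l'" "map snd l1 = xs" "map snd l' = w # ys"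
    using ls(1) unfolding w(1) by (rule map_snd_append)
  obtain t l2 where 2: "l' = (t, w) # l2" "map snd l2 = ys" using 1(3) by (rule map_snd_Cons)
  let ?l = "l1 @ l2" and ?r = "map (\<lambda>(c, v). (c, red_unit p w v)) (l1 @ l2)"
  have r1: "map snd ?r = map (red_unit p w) (xs @ ys)"
    unfolding 1(2)[symmetric] 2(2)[symmetric] by (simp add: comp_def case_prod_beta)
  have r2: "nonint ?r" using ls(2) 1(1) 2(1) by (simp add: case_prod_beta nonint_def list.pred_map comp_def)
  have r3: "comb ?r n - T n \<in> \<int>" if n: "n < L" for n
  proof -
    have "\<forall>v\<in>snd ` set l. length v = L \<Longrightarrow> comb (map (\<lambda>(c, v). (c, red_unit p w v)) l) n =
         comb l n - of_int (w ! p * w ! n) * comb l p" for l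
    proof (induction l)
      case (Cons a l)
      obtain b v where a: "a = (b, v)" by fastforce
      have e: "red_unit p w v ! n = v ! n - w ! p * v ! p * w ! n"
        using Cons.prems n len(1) by (simp add: red_unit_def a)
      show ?case using Cons by (simp add: a e algebra_simps)
    qed simp
    moreover have "\<forall>v\<in>snd ` set ?l. length v = L" using len(2) 1(2) 2(2) by (metis list.set_map map_append)
    ultimately have c: "comb ?r n = comb ?l n - of_int (w ! p * w ! n) * comb ?l p" by blast
    define X where "X = (\<lambda>n. comb ls n - T n)"
    have d: "comb ?l n = X n + T n - t * of_int (w ! n)" "comb ?l p = X p + T p - t * of_int (w ! p)"
      using 1(1) 2(1) by (auto simp: X_def)
    have q: "real_of_int (w ! p) * of_int (w ! p) = 1" using w(2) by auto
    have "comb ?r n - T n = X n - t * of_int (w ! n) - of_int (w ! p * w ! n) * (X p + T p) +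
        t * of_int (w ! n) * (of_int (w ! p) * of_int (w ! p))"
      unfolding c d by (simp add: algebra_simps)
    also have "\<dots> = X n - of_int (w ! p * w ! n) * (X p + T p)" unfolding q by simp
    also have "\<dots> \<in> \<int>" using ls(3) n p T by (auto simp: X_def simp del: of_int_mult)
    finally show ?thesis .
  qed
  show ?thesis unfolding w(3) by (rule exI[of _ ?r]) (use r1 r2 r3 in simp)
qed

section \<open>Tables with entries below 1 and integral line sums\<close>

lemma ex_col: "(\<exists>k. P k) \<longleftrightarrow> P K0 \<or> P K1 \<or> P K2"
  by (metis col.exhaust)

text \<open>Singletons fall to \<open>Em\<close> by default. In a \<open>good\<close> table they do
  not occur, which makes \<open>has_supp\<close> an exact description of the support.\<close>

fun support :: "bool \<Rightarrow> bool \<Rightarrow> bool \<Rightarrow> rsupp" where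
  "support False True True = Mi0" | "support True False True = Mi1" | "support True True False = Mi2"
| "support True True True = Fu" | "support _ _ _ = Em"

definition supp :: "(row \<Rightarrow> col \<Rightarrow> real) \<Rightarrow> slice" where
  "supp X = Sl (support (X R0 K0 \<noteq> 0) (X R0 K1 \<noteq> 0) (X R0 K2 \<noteq> 0)) (support (X R1 K0 \<noteq> 0) (X R1 K1 \<noteq> 0) (X R1 K2 \<noteq> 0))
    (support (X R2 K0 \<noteq> 0) (X R2 K1 \<noteq> 0) (X R2 K2 \<noteq> 0)) (support (X R3 K0 \<noteq> 0) (X R3 K1 \<noteq> 0) (X R3 K2 \<noteq> 0))"

text \<open>Collects what the search uses about a solution, for any finite set of slices. The clause
  on \<open>U\<close> stems from minimality of the support; the last clause says that the solution
  obtained by a cube move again has entries below 1 at the four raised cells.\<close>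

definition good :: "('i :: finite \<Rightarrow> row \<Rightarrow> col \<Rightarrow> real) \<Rightarrow> bool" where
  "good Z \<longleftrightarrow> (\<forall>i r k. 0 \<le> Z i r k \<and> Z i r k < 1) \<and>
    (\<forall>i r. (\<Sum>k\<in>UNIV. Z i r k) \<in> \<int>) \<and> (\<forall>i k. (\<Sum>r\<in>UNIV. Z i r k) \<in> \<int>) \<and> (\<forall>r k. (\<Sum>i\<in>UNIV. Z i r k) \<in> \<int>) \<and>
    (\<forall>U. (\<forall>i r k. Z i r k = 0 \<longrightarrow> U i r k = 0) \<longrightarrow> (\<forall>i r. (\<Sum>k\<in>UNIV. U i r k) = 0) \<longrightarrow>
       (\<forall>i k. (\<Sum>r\<in>UNIV. U i r k) = 0) \<longrightarrow> (\<forall>r k. (\<Sum>i\<in>UNIV. U i r k) = 0) \<longrightarrow> (\<forall>i r k. U i r k = (0 :: real))) \<and>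
    (\<forall>i j a b x y \<epsilon>. i \<noteq> j \<longrightarrow> a \<noteq> b \<longrightarrow> x \<noteq> y \<longrightarrow> 0 < \<epsilon> \<longrightarrow> \<epsilon> \<le> Z i a y \<longrightarrow> \<epsilon> \<le> Z i b x \<longrightarrow>
       \<epsilon> \<le> Z j a x \<longrightarrow> \<epsilon> \<le> Z j b y \<longrightarrow>
       Z i a x + \<epsilon> < 1 \<and> Z i b y + \<epsilon> < 1 \<and> Z j a y + \<epsilon> < 1 \<and> Z j b x + \<epsilon> < 1)"

lemma goodD:
  assumes "good Z"
  shows "0 \<le> Z i r k" "Z i r k < 1" "(\<Sum>k\<in>UNIV. Z i r k) \<in> \<int>" "(\<Sum>r\<in>UNIV. Z i r k) \<in> \<int>" "(\<Sum>i\<in>UNIV. Z i r k) \<in> \<int>"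
proof -
  note g = assms[unfolded good_def]
  show "0 \<le> Z i r k" "Z i r k < 1" using conjunct1[OF g] by blast+
  show "(\<Sum>k\<in>UNIV. Z i r k) \<in> \<int>" using conjunct1[OF conjunct2[OF g]] by blast
  show "(\<Sum>r\<in>UNIV. Z i r k) \<in> \<int>" using conjunct1[OF conjunct2[OF conjunct2[OF g]]] by blast
  show "(\<Sum>i\<in>UNIV. Z i r k) \<in> \<int>" using conjunct1[OF conjunct2[OF conjunct2[OF conjunct2[OF g]]]] by blast
qed

lemma good_kernel:
  assumes "good Z" "\<And>i r k. Z i r k = 0 \<Longrightarrow> U i r k = 0" "\<And>i r. (\<Sum>k\<in>UNIV. U i r k) = 0"
    "\<And>i k. (\<Sum>r\<in>UNIV. U i r k) = 0" "\<And>r k. (\<Sum>i\<in>UNIV. U i r k) = 0"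
  shows "U i r k = (0 :: real)"
  using assms unfolding good_def by blast

lemma good_cube:
  assumes "good Z" "i \<noteq> j" "a \<noteq> b" "x \<noteq> y" "0 < \<epsilon>" "\<epsilon> \<le> Z i a y" "\<epsilon> \<le> Z i b x" "\<epsilon> \<le> Z j a x" "\<epsilon> \<le> Z j b y"
  shows "Z i a x + \<epsilon> < 1 \<and> Z i b y + \<epsilon> < 1 \<and> Z j a y + \<epsilon> < 1 \<and> Z j b x + \<epsilon> < 1"
  using assms unfolding good_def by blast

lemma not_Ints: "0 < x \<Longrightarrow> x < 1 \<Longrightarrow> (x :: real) \<notin> \<int>"
  by (auto elim!: Ints_cases)

lemma line_two:
  fixes f :: "'a \<Rightarrow> real"
  assumes "finite A" "(\<Sum>x\<in>A. f x) \<in> \<int>" "\<And>x. x \<in> A \<Longrightarrow> 0 \<le> f x" "c \<in> A" "d \<in> A" "c \<noteq> d" "0 < f c" "f c + f d < 1"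
  shows "\<exists>e\<in>A. e \<noteq> c \<and> e \<noteq> d \<and> 0 < f e"
proof (rule ccontr)
  assume "\<not> ?thesis"
  then have z: "\<And>x. x \<in> A - {c, d} \<Longrightarrow> f x = 0" using assms(3) by force
  have "(\<Sum>x\<in>A. f x) = (\<Sum>x\<in>{c, d}. f x)"
    by (rule sum.mono_neutral_right) (use assms z in auto)
  also have "\<dots> = f c + f d" using assms(6) by simp
  finally show False using assms(2,7,8) assms(3)[OF assms(5)] not_Ints[of "f c + f d"] by simp
qed

lemma line_one:
  fixes f :: "'a \<Rightarrow> real"
  assumes "finite A" "(\<Sum>x\<in>A. f x) \<in> \<int>" "\<And>x. x \<in> A \<Longrightarrow> 0 \<le> f x" "c \<in> A" "0 < f c" "f c < 1"
  shows "\<exists>e\<in>A. e \<noteq> c \<and> 0 < f e"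
proof (rule ccontr)
  assume "\<not> ?thesis"
  then have z: "\<And>x. x \<in> A - {c} \<Longrightarrow> f x = 0" using assms(3) by force
  have "(\<Sum>x\<in>A. f x) = (\<Sum>x\<in>{c}. f x)"
    by (rule sum.mono_neutral_right) (use assms z in auto)
  then show False using assms(2,5,6) not_Ints[of "f c"] by simp
qed

lemma has_support: "(x0 \<and> (x1 \<or> x2)) \<or> (x1 \<and> x2) \<or> (\<not> x0 \<and> \<not> x1 \<and> \<not> x2) \<Longrightarrow>
  has K0 (support x0 x1 x2) = x0 \<and> has K1 (support x0 x1 x2) = x1 \<and> has K2 (support x0 x1 x2) = x2"
  by (cases x0; cases x1; cases x2) auto

lemma has_supp:
  assumes "good Z"
  shows "has k (rowof r (supp (Z i))) \<longleftrightarrow> Z i r k > 0"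
proof -
  have *: "\<exists>e. e \<noteq> k \<and> 0 < Z i r e" if "0 < Z i r k" for r k
    using line_one[of UNIV "Z i r" k] goodD[OF assms] that by auto
  have 0: "Z i r k \<noteq> 0 \<longleftrightarrow> 0 < Z i r k" for r k using goodD(1)[OF assms, of i r k] by linarith
  have row: "(0 < Z i r K0 \<and> (0 < Z i r K1 \<or> 0 < Z i r K2)) \<or> (0 < Z i r K1 \<and> 0 < Z i r K2) \<or>
     (\<not> 0 < Z i r K0 \<and> \<not> 0 < Z i r K1 \<and> \<not> 0 < Z i r K2)" for r
    using *[of r K0] *[of r K1] *[of r K2] unfolding ex_col by auto
  show ?thesis
    using has_support[OF row[of r]] by (cases r; cases k) (simp_all add: supp_def 0)
qed

lemma good_frac: "good Z \<Longrightarrow> has k (rowof r (supp (Z i))) \<Longrightarrow> Z i r k \<notin> \<int>"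
  using not_Ints[of "Z i r k"] goodD(2)[of Z i r k] has_supp[of Z k r i] by simp

lemma good_zero: "good Z \<Longrightarrow> \<not> has k (rowof r (supp (Z i))) \<Longrightarrow> Z i r k = 0"
  using goodD(1)[of Z i r k] has_supp[of Z k r i] by linarith

text \<open>A cell of least value among the four cells a cube move decreases cannot bound its three lines alone.\<close>
lemma min_escapes:
  assumes g: "good Z" and ne: "i \<noteq> j" "a \<noteq> b" "x \<noteq> y"
    and pos: "0 < Z i a y" "0 < Z i b x" "0 < Z j a x" "0 < Z j b y"
    and min: "Z i a y \<le> Z i b x" "Z i a y \<le> Z j a x" "Z i a y \<le> Z j b y"
  shows "\<exists>w. w \<noteq> x \<and> w \<noteq> y \<and> 0 < Z i a w" "\<exists>c. c \<noteq> a \<and> c \<noteq> b \<and> 0 < Z i c y" "\<exists>l. l \<noteq> i \<and> l \<noteq> j \<and> 0 < Z l a y"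
proof -
  from good_cube[OF g ne pos(1) order_refl min]
  have 1: "Z i a x + Z i a y < 1" "Z i b y + Z i a y < 1" "Z j a y + Z i a y < 1" by auto
  show "\<exists>w. w \<noteq> x \<and> w \<noteq> y \<and> 0 < Z i a w"
    using line_two[of UNIV "Z i a" y x] goodD[OF g] pos 1 ne by (auto simp: add.commute)
  show "\<exists>c. c \<noteq> a \<and> c \<noteq> b \<and> 0 < Z i c y"
    using line_two[of UNIV "\<lambda>c. Z i c y" a b] goodD[OF g] pos 1 ne by (auto simp: add.commute)
  show "\<exists>l. l \<noteq> i \<and> l \<noteq> j \<and> 0 < Z l a y"
    using line_two[of UNIV "\<lambda>l. Z l a y" i j] goodD[OF g] pos 1 ne by (auto simp: add.commute)
qed

section \<open>Relations between slices in the common six-dimensional space\<close>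

definition rsupps :: "rsupp list" where
  "rsupps = [Em, Mi0, Mi1, Mi2, Fu]"

definition slices_all :: "slice list" where
  "slices_all = concat (map (\<lambda>a. concat (map (\<lambda>b. concat (map (\<lambda>c. map (\<lambda>d. Sl a b c d) rsupps) rsupps)) rsupps)) rsupps)"

lemma set_rsupps: "set rsupps = UNIV"
  unfolding rsupps_def using rsupp.exhaust by auto

lemma slices_all: "h \<in> set slices_all"
  by (cases h) (simp add: slices_all_def set_rsupps image_iff)

lemma pick_local: "\<forall>v\<in>set (pick (Suc 0) [] (pick 0 [] (pvs h))). v ! 0 = 0 \<and> v ! Suc 0 = 0"
proof -
  have "list_all (\<lambda>h. list_all (\<lambda>v. v ! 0 = 0 \<and> v ! Suc 0 = 0) (pick (Suc 0) [] (pick 0 [] (pvs h)))) slices_all"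
    by code_simp
  then show ?thesis using slices_all[of h] by (simp add: list_all_iff)
qed

lemma length_pick2: "v \<in> set (pick (Suc 0) [] (pick 0 [] (pvs h))) \<Longrightarrow> length v = 8"
  using pick_length length_pvs by metis

lemma length_basis: "v \<in> set (basis h) \<Longrightarrow> length v = 6"
  using length_pick2 by (auto simp: basis_def)

lemma comb_drop:
  assumes "map snd ls = map (drop 2) vs" "\<And>v. v \<in> set vs \<Longrightarrow> 2 \<le> length v"
  shows "\<exists>ls'. map snd ls' = vs \<and> (\<forall>n. comb ls' (n + 2) = comb ls n) \<and> (null ls' \<longrightarrow> null ls)"
  using assms
proof (induction vs arbitrary: ls)
  case Nil then show ?case by simp
next
  case (Cons v vs)
  from Cons.prems(1) have "map snd ls = drop 2 v # map (drop 2) vs" by simp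
  then obtain c l where l: "ls = (c, drop 2 v) # l" "map snd l = map (drop 2) vs" by (rule map_snd_Cons)
  have "2 \<le> length v" using Cons.prems(2) by simp
  then have "drop 2 v ! n = v ! (n + 2)" for n by (simp add: add.commute)
  moreover obtain l' where "map snd l' = vs" "\<forall>n. comb l' (n + 2) = comb l n" "null l' \<longrightarrow> null l"
    using Cons.IH[OF l(2)] Cons.prems(2) by auto
  ultimately show ?case by (intro exI[of _ "(c, v) # l'"]) (simp add: l(1))
qed

lemma basis_move:
  assumes "map snd ls = basis h"
  shows "\<exists>U. (\<forall>r k. \<not> has k (rowof r h) \<longrightarrow> U r k = 0) \<and> (\<forall>r. (\<Sum>k\<in>UNIV. U r k) = 0) \<and>
    (\<forall>k. (\<Sum>r\<in>UNIV. U r k) = 0) \<and> (\<forall>n<6. comb ls n = glob U n) \<and> ((\<forall>r k. U r k = 0) \<longrightarrow> null ls)"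
proof -
  let ?v1 = "pick 0 [] (pvs h)" let ?v2 = "pick (Suc 0) [] ?v1"
  have "2 \<le> length v" if "v \<in> set ?v2" for v using length_pick2[OF that] by simp
  from comb_drop[OF assms[unfolded basis_def] this] obtain l2 where
    l2: "map snd l2 = ?v2" "\<forall>n. comb l2 (n + 2) = comb ls n" "null l2 \<longrightarrow> null ls" by blast
  have len: "length v = 8" if "v \<in> set ?v1" for v using pick_length[OF length_pvs that] by simp
  from pick_move[OF len _ l2(1)] obtain l1 where
    l1: "map snd l1 = ?v1" "\<forall>n<8. comb l1 n = comb l2 n" "null l1 \<longrightarrow> null l2" by auto
  from pick_move[OF length_pvs[of _ h] _ l1(1)] obtain l0 where
    l0: "map snd l0 = pvs h" "\<forall>n<8. comb l0 n = comb l1 n" "null l0 \<longrightarrow> null l1" by auto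
  from slice_move[OF l0(1)] obtain U where U: "\<forall>r k. \<not> has k (rowof r h) \<longrightarrow> U r k = 0"
    "\<forall>r. (\<Sum>k\<in>UNIV. U r k) = 0" "\<forall>n<8. comb l0 n = tot8 U n" "(\<forall>r k. U r k = 0) \<longrightarrow> null l0" by (elim exE conjE)
  have eq: "tot8 U n = comb l2 n" if "n < 8" for n using U(3) l0(2) l1(2) that by simp
  have z: "comb l2 0 = 0 \<and> comb l2 (Suc 0) = 0"
  proof -
    have "\<forall>v\<in>snd ` set l2. v ! 0 = 0 \<and> v ! Suc 0 = 0" using pick_local[of h] l2(1) by (metis list.set_map)
    then show ?thesis by (induction l2) auto
  qed
  have c01: "(\<Sum>r\<in>UNIV. U r K0) = 0" "(\<Sum>r\<in>UNIV. U r K1) = 0"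
    using z eq[of 0] eq[of "Suc 0"] by (simp_all add: tot8_simps)
  have "(\<Sum>k\<in>UNIV. \<Sum>r\<in>UNIV. U r k) = 0" by (subst sum.swap) (simp add: U(2))
  then have "\<forall>k. (\<Sum>r\<in>UNIV. U r k) = 0" unfolding all_col using c01 by (simp add: sum_col)
  moreover have "\<forall>n<6. comb ls n = glob U n"
  proof (intro allI impI)
    fix n :: nat assume n: "n < 6"
    have "comb ls n = comb l2 (n + 2)" using l2(2) by simp
    also have "\<dots> = tot8 U (n + 2)" using eq[of "n + 2"] n by simp
    finally show "comb ls n = glob U n" by (simp only: tot8_simps(3)[OF n])
  qed
  moreover have "(\<forall>r k. U r k = 0) \<longrightarrow> null ls" using U(4) l0(3) l1(3) l2(3) by simp
  ultimately show ?thesis using U(1,2) by (intro exI[of _ U] conjI)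
qed

lemma basis_frac:
  assumes X: "\<And>r k. has k (rowof r h) \<Longrightarrow> X r k \<notin> \<int>" "\<And>r k. \<not> has k (rowof r h) \<Longrightarrow> X r k = 0"
    and sum: "\<And>r. (\<Sum>k\<in>UNIV. X r k) \<in> \<int>" "\<And>k. (\<Sum>r\<in>UNIV. X r k) \<in> \<int>"
  shows "\<exists>ls. map snd ls = basis h \<and> nonint ls \<and> (\<forall>n<6. comb ls n - glob X n \<in> \<int>)"
proof -
  let ?v1 = "pick 0 [] (pvs h)" let ?v2 = "pick (Suc 0) [] ?v1"
  have "\<exists>ls. map snd ls = pvs h \<and> nonint ls \<and> (\<forall>n<8. comb ls n - tot8 X n \<in> \<int>)"
    by (rule slice_frac) (use X sum(1) in auto)
  then obtain l0 where l0: "map snd l0 = pvs h" "nonint l0" "\<forall>n<8. comb l0 n - tot8 X n \<in> \<int>"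
    by (elim exE conjE)
  have T: "tot8 X 0 \<in> \<int>" "tot8 X (Suc 0) \<in> \<int>" using sum(2) by (simp_all add: tot8_simps)
  from pick_frac[OF length_pvs[of _ h] _ T(1) l0] obtain l1 where l1: "map snd l1 = ?v1" "nonint l1" "\<forall>n<8. comb l1 n - tot8 X n \<in> \<int>"
    by auto
  have len: "length v = 8" if "v \<in> set ?v1" for v using pick_length[OF length_pvs that] by simp
  from pick_frac[OF len _ T(2) l1] obtain l2 where l2: "map snd l2 = ?v2" "nonint l2" "\<forall>n<8. comb l2 n - tot8 X n \<in> \<int>"
    by auto
  let ?l = "map (\<lambda>(c, v). (c, drop 2 v)) l2"
  have 1: "map snd ?l = basis h" unfolding basis_def l2(1)[symmetric] by (simp add: comp_def case_prod_beta)
  have 2: "nonint ?l" using l2(2) by (simp add: case_prod_beta nonint_def list.pred_map comp_def)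
  have 3: "comb ?l n = comb l2 (n + 2)" for n
  proof -
    have "\<forall>v\<in>snd ` set l2. length v = 8" using length_pick2[of _ h] l2(1) by (metis list.set_map)
    then show ?thesis
    proof (induction l2)
      case (Cons a l)
      obtain b v where a: "a = (b, v)" by fastforce
      have "drop 2 v ! n = v ! (n + 2)" using Cons.prems by (simp add: a add.commute)
      then show ?case using Cons by (simp add: a)
    qed simp
  qed
  have "comb ?l n - glob X n \<in> \<int>" if n: "n < 6" for n
    using l2(3)[rule_format, of "n + 2"] n unfolding 3 tot8_simps(3)[OF n, symmetric] by simp
  with 1 2 show ?thesis by (intro exI[of _ ?l] conjI allI impI)
qed

lemma glob_0 [simp]: "n < 6 \<Longrightarrow> glob (\<lambda>r k. 0) n = 0"
  by (auto simp: glob_def less_Suc_eq eval_nat_numeral)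

lemma glob_sum: "n < 6 \<Longrightarrow> (\<Sum>i\<in>A. glob (U i) n) = glob (\<lambda>r k. \<Sum>i\<in>A. U i r k) n"
  by (auto simp: glob_def less_Suc_eq eval_nat_numeral)

lemma bases_move:
  fixes H :: "'i :: finite \<Rightarrow> slice"
  assumes "distinct is" "map snd ls = concat (map (\<lambda>i. basis (H i)) is)"
  shows "\<exists>U. (\<forall>i r k. i \<notin> set is \<or> \<not> has k (rowof r (H i)) \<longrightarrow> U i r k = 0) \<and>
    (\<forall>i r. (\<Sum>k\<in>UNIV. U i r k) = 0) \<and> (\<forall>i k. (\<Sum>r\<in>UNIV. U i r k) = 0) \<and>
    (\<forall>n<6. (\<Sum>i\<in>UNIV. glob (U i) n) = comb ls n) \<and> ((\<forall>i r k. U i r k = 0) \<longrightarrow> null ls)"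
  using assms
proof (induction "is" arbitrary: ls)
  case Nil
  then show ?case by (intro exI[of _ "\<lambda>i r k. 0"]) simp
next
  case (Cons j js)
  from Cons.prems(2) have "map snd ls = basis (H j) @ concat (map (\<lambda>i. basis (H i)) js)" by simp
  then obtain l1 l2 where l: "ls = l1 @ l2" "map snd l1 = basis (H j)" "map snd l2 = concat (map (\<lambda>i. basis (H i)) js)"
    by (rule map_snd_append)
  have dj: "distinct js" "j \<notin> set js" using Cons.prems(1) by auto
  from basis_move[OF l(2)] obtain V where V: "\<forall>r k. \<not> has k (rowof r (H j)) \<longrightarrow> V r k = 0"
    "\<forall>r. (\<Sum>k\<in>UNIV. V r k) = 0" "\<forall>k. (\<Sum>r\<in>UNIV. V r k) = 0" "\<forall>n<6. comb l1 n = glob V n" "(\<forall>r k. V r k = 0) \<longrightarrow> null l1"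
    by (elim exE conjE)
  from Cons.IH[OF dj(1) l(3)] obtain U where U: "\<forall>i r k. i \<notin> set js \<or> \<not> has k (rowof r (H i)) \<longrightarrow> U i r k = 0"
    "\<forall>i r. (\<Sum>k\<in>UNIV. U i r k) = 0" "\<forall>i k. (\<Sum>r\<in>UNIV. U i r k) = 0"
    "\<forall>n<6. (\<Sum>i\<in>UNIV. glob (U i) n) = comb l2 n" "(\<forall>i r k. U i r k = 0) \<longrightarrow> null l2"
    by (elim exE conjE)
  let ?U = "U(j := V)"
  have Uj: "U j = (\<lambda>r k. 0)" using U(1) dj(2) by (intro ext) auto
  have "(\<Sum>i\<in>UNIV. glob (?U i) n) = comb ls n" if n: "n < 6" for n
  proof -
    have "(\<Sum>i\<in>UNIV. glob (?U i) n) = glob V n + (\<Sum>i\<in>UNIV - {j}. glob (U i) n)"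
      by (subst sum.remove[of _ j]) auto
    also have "(\<Sum>i\<in>UNIV - {j}. glob (U i) n) = (\<Sum>i\<in>UNIV. glob (U i) n)"
      by (subst (2) sum.remove[of _ j]) (use n in \<open>auto simp: Uj\<close>)
    finally show ?thesis using V(4) U(4) n by (simp add: l(1))
  qed
  moreover have "\<forall>i r k. i \<notin> set (j # js) \<or> \<not> has k (rowof r (H i)) \<longrightarrow> ?U i r k = 0"
    using V(1) U(1) by simp
  moreover have "\<forall>i r. (\<Sum>k\<in>UNIV. ?U i r k) = 0" "\<forall>i k. (\<Sum>r\<in>UNIV. ?U i r k) = 0"
    using V(2,3) U(2,3) by simp_all
  moreover have "(\<forall>i r k. ?U i r k = 0) \<longrightarrow> null ls"
  proof
    assume z: "\<forall>i r k. ?U i r k = 0"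
    have "V r k = 0" for r k using z[rule_format, of j r k] by simp
    moreover have "U i r k = 0" for i r k using z[rule_format, of i r k] Uj by (cases "i = j") simp_all
    ultimately show "null ls" using V(5) U(5) by (simp add: l(1))
  qed
  ultimately show ?case by (intro exI[of _ ?U] conjI) blast+
qed

text \<open>A relation between the bases is a family of cycle-space tables whose sum over the slices
  vanishes at the six free cells. Zero row and column sums extend this to all twelve cells, so the
  family is a table with zero line sums inside the support of \<open>Z\<close>, hence zero by
  \<open>good_kernel\<close>.\<close>

lemma good_indep:
  assumes g: "good Z" and d: "distinct is"
  shows "indep 6 (concat (map (\<lambda>i. basis (supp (Z i))) is))"
  unfolding indep_def
proof (intro allI impI)
  fix ls assume ls: "map snd ls = concat (map (\<lambda>i. basis (supp (Z i))) is)" and z: "\<forall>n<6. comb ls n = 0"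
  from bases_move[OF d ls] obtain U where U: "\<forall>i r k. i \<notin> set is \<or> \<not> has k (rowof r (supp (Z i))) \<longrightarrow> U i r k = 0"
    "\<forall>i r. (\<Sum>k\<in>UNIV. U i r k) = 0" "\<forall>i k. (\<Sum>r\<in>UNIV. U i r k) = 0"
    "\<forall>n<6. (\<Sum>i\<in>UNIV. glob (U i) n) = comb ls n" "(\<forall>i r k. U i r k = 0) \<longrightarrow> null ls"
    by (elim exE conjE)
  let ?S = "\<lambda>r k. \<Sum>i\<in>UNIV. U i r k"
  have gl: "glob ?S n = 0" if "n < 6" for n using U(4) z that glob_sum[OF that, of U UNIV] by simp
  have s6: "?S R0 K0 = 0" "?S R0 K1 = 0" "?S R1 K0 = 0" "?S R1 K1 = 0" "?S R2 K0 = 0" "?S R2 K1 = 0"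
    using gl[of 0] gl[of 1] gl[of 2] gl[of 3] gl[of 4] gl[of 5] by (simp_all add: glob_def eval_nat_numeral)
  have rows: "?S r K0 + ?S r K1 + ?S r K2 = 0" for r
  proof -
    have "(\<Sum>k\<in>UNIV. ?S r k) = (\<Sum>i\<in>UNIV. \<Sum>k\<in>UNIV. U i r k)" by (rule sum.swap)
    then show ?thesis using U(2) by (simp add: sum_col)
  qed
  have cols: "?S R0 k + ?S R1 k + ?S R2 k + ?S R3 k = 0" for k
  proof -
    have "(\<Sum>r\<in>UNIV. ?S r k) = (\<Sum>i\<in>UNIV. \<Sum>r\<in>UNIV. U i r k)" by (rule sum.swap)
    then show ?thesis using U(3) by (simp add: sum_row)
  qed
  have s0: "?S R3 K0 = 0" "?S R3 K1 = 0" using cols[of K0] cols[of K1] s6 by linarith+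
  have S: "?S r k = 0" for r k
    using rows[of r] s6 s0 by (cases r; cases k) simp_all
  have "U i r k = 0" for i r k
  proof (rule good_kernel[OF g])
    fix i r k assume "Z i r k = 0"
    then show "U i r k = 0" using U(1) has_supp[OF g, of k r i] by simp
  qed (use U(2,3) S in simp_all)
  then show "null ls" using U(5) by simp
qed

text \<open>The coefficients come from the entries of \<open>Z\<close>. Modulo the integers each
  slice is the resulting combination of its basis, and the slices add up to an integral
  table.\<close>

lemma good_fractional:
  assumes g: "good Z" and d: "distinct is" and out: "\<And>i r k. i \<notin> set is \<Longrightarrow> Z i r k = 0"
  shows "fractional 6 (concat (map (\<lambda>i. basis (supp (Z i))) is))"
proof -
  have "\<exists>ls. map snd ls = concat (map (\<lambda>i. basis (supp (Z i))) js) \<and> nonint ls \<and>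
      (\<forall>n<6. comb ls n - (\<Sum>i\<in>set js. glob (Z i) n) \<in> \<int>)" if "distinct js" for js
    using that
  proof (induction js)
    case (Cons j js)
    then obtain l2 where l2: "map snd l2 = concat (map (\<lambda>i. basis (supp (Z i))) js)" "nonint l2"
      "\<forall>n<6. comb l2 n - (\<Sum>i\<in>set js. glob (Z i) n) \<in> \<int>" by auto
    have "\<exists>ls. map snd ls = basis (supp (Z j)) \<and> nonint ls \<and> (\<forall>n<6. comb ls n - glob (Z j) n \<in> \<int>)"
      by (rule basis_frac) (use good_frac[OF g] good_zero[OF g] goodD[OF g] in auto)
    then obtain l1 where l1: "map snd l1 = basis (supp (Z j))" "nonint l1" "\<forall>n<6. comb l1 n - glob (Z j) n \<in> \<int>"
      by (elim exE conjE)
    have "comb (l1 @ l2) n - (\<Sum>i\<in>set (j # js). glob (Z i) n) \<in> \<int>" if n: "n < 6" for n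
    proof -
      have "comb (l1 @ l2) n - (\<Sum>i\<in>set (j # js). glob (Z i) n) =
        (comb l1 n - glob (Z j) n) + (comb l2 n - (\<Sum>i\<in>set js. glob (Z i) n))"
        using Cons.prems by simp
      also have "\<dots> \<in> \<int>" by (intro Ints_add l1(3)[rule_format] l2(3)[rule_format] n)
      finally show ?thesis .
    qed
    then show ?case using l1 l2 by (intro exI[of _ "l1 @ l2"]) simp
  qed (intro exI[of _ "[]"], simp)
  from this[OF d] obtain ls where ls: "map snd ls = concat (map (\<lambda>i. basis (supp (Z i))) is)" "nonint ls"
      "\<forall>n<6. comb ls n - (\<Sum>i\<in>set is. glob (Z i) n) \<in> \<int>" by (elim exE conjE)
  have "comb ls n \<in> \<int>" if n: "n < 6" for n
  proof -
    have "(\<Sum>i\<in>set is. glob (Z i) n) = (\<Sum>i\<in>UNIV. glob (Z i) n)"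
    proof (rule sum.mono_neutral_left)
      have "Z i = (\<lambda>r k. 0)" if "i \<notin> set is" for i using out[OF that] by (intro ext)
      then show "\<forall>i\<in>UNIV - set is. glob (Z i) n = 0" using n by simp
    qed auto
    also have "\<dots> = glob (\<lambda>r k. \<Sum>i\<in>UNIV. Z i r k) n" by (rule glob_sum[OF n])
    also have "\<dots> \<in> \<int>" using goodD(5)[OF g] n by (auto simp: glob_def less_Suc_eq eval_nat_numeral)
    finally have "(\<Sum>i\<in>set is. glob (Z i) n) \<in> \<int>" .
    from Ints_add[OF ls(3)[rule_format, OF n] this] show ?thesis by simp
  qed
  with ls(1,2) show ?thesis unfolding fractional_def by (intro exI[of _ ls] conjI allI impI)
qed

section \<open>The search: cube constraints, elimination tests and branching\<close>

datatype cube = Cube row row row row col col col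

text \<open>The move of \<open>Cube a b c d x y w\<close> raises cells \<open>(a, x)\<close>,
  \<open>(b, y)\<close> and lowers \<open>(a, y)\<close>, \<open>(b, x)\<close> in one slice, and
  does the opposite in another; \<open>c\<close>, \<open>d\<close>, \<open>w\<close> are the
  remaining rows and column. Exchanging both the rows and the columns gives the same move, so each
  pair of rows is listed in one order only.\<close>

definition cubes :: "cube list" where
  "cubes = concat (map (\<lambda>(a, b, c, d). map (\<lambda>(x, y, w). Cube a b c d x y w)
     [(K0, K1, K2), (K1, K0, K2), (K0, K2, K1), (K2, K0, K1), (K1, K2, K0), (K2, K1, K0)])
     [(R0, R1, R2, R3), (R0, R2, R1, R3), (R0, R3, R1, R2), (R1, R2, R0, R3), (R1, R3, R0, R2), (R2, R3, R0, R1)])"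

text \<open>If cell \<open>(a, y)\<close> is least among the four lowered cells,
  \<open>min_escapes\<close> demands a further nonzero cell on each of its three lines. Tested here
  are the two lines inside the slice; the line across the slices is left to
  \<open>anyline\<close>.\<close>

definition esc :: "row \<Rightarrow> row \<Rightarrow> row \<Rightarrow> col \<Rightarrow> col \<Rightarrow> slice \<Rightarrow> bool" where
  "esc a c d y w h = (if has w (rowof a h) then (if has y (rowof c h) then True else has y (rowof d h)) else False)"

fun live :: "cube \<Rightarrow> slice \<Rightarrow> bool" where
  "live (Cube a b c d x y w) h = (if has y (rowof a h) then if has x (rowof b h) then
     (if esc a c d y w h then False else if esc b c d x w h then False else True) else False else False)"

text \<open>For these cubes neither lowered cell of \<open>h\<close> can be the least. Any other
  slice that permits the move must then contain a lowered cell able to be least, which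
  \<open>chk1\<close> tests. The constraint involves only two slices and so prunes candidates before
  a set is complete.\<close>

definition cons :: "slice \<Rightarrow> cube list" where "cons h = filter (\<lambda>q. live q h) cubes"

fun chk1 :: "cube \<Rightarrow> slice \<Rightarrow> bool" where
  "chk1 (Cube a b c d x y w) h = (if has x (rowof a h) then if has y (rowof b h) then
     (if esc a c d x w h then True else esc b c d y w h) else True else True)"

fun chk :: "cube list \<Rightarrow> slice \<Rightarrow> bool" where
  "chk [] h = True"
| "chk (q # qs) h = (if chk1 q h then chk qs h else False)"

text \<open>The number of chosen slices meeting a cell, cut off at two: only the value one triggers
  a branching.\<close>

datatype status = N0 | N1 | N2
datatype triple = T status status status
datatype counts = C4 triple triple triple triple

fun inc :: "status \<Rightarrow> status" where "inc N0 = N1" | "inc N1 = N2" | "inc N2 = N2"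

fun upr :: "rsupp \<Rightarrow> triple \<Rightarrow> triple" where
  "upr Em t = t" | "upr Mi0 (T x y z) = T x (inc y) (inc z)" | "upr Mi1 (T x y z) = T (inc x) y (inc z)"
| "upr Mi2 (T x y z) = T (inc x) (inc y) z" | "upr Fu (T x y z) = T (inc x) (inc y) (inc z)"

fun upd :: "slice \<Rightarrow> counts \<Rightarrow> counts" where
  "upd (Sl a b c d) (C4 p q r s) = C4 (upr a p) (upr b q) (upr c r) (upr d s)"

fun once :: "status \<Rightarrow> bool" where "once N1 = True" | "once N0 = False" | "once N2 = False"

fun once_row :: "row \<Rightarrow> triple \<Rightarrow> (row \<times> col) option \<Rightarrow> (row \<times> col) option" where
  "once_row r (T x y z) e = (if once x then Some (r, K0) else if once y then Some (r, K1) else if once z then Some (r, K2) else e)"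

text \<open>A cell met by exactly one chosen slice calls for another slice through it, since the sum
  over the first index is integral. Branching there keeps the number of candidates small.\<close>

fun first_once :: "counts \<Rightarrow> (row \<times> col) option" where
  "first_once (C4 p q r s) = once_row R0 p (once_row R1 q (once_row R2 r (once_row R3 s None)))"

fun reds :: "(nat \<times> int list) list \<Rightarrow> int list \<Rightarrow> int list" where
  "reds [] v = v"
| "reds (e # E) v = reds E (red e v)"

fun unit_index :: "nat \<Rightarrow> int list \<Rightarrow> nat option" where
  "unit_index n [] = None"
| "unit_index n (x # xs) = (if x = 1 then Some n else if x = - 1 then Some n else unit_index (Suc n) xs)"

fun nonzero_index :: "nat \<Rightarrow> int list \<Rightarrow> nat option" where
  "nonzero_index n [] = None"
| "nonzero_index n (x # xs) = (if x = 0 then nonzero_index (Suc n) xs else Some n)"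

text \<open>Unit pivots come first because multiplication by another pivot may destroy the unit
  entries on which \<open>rgood\<close> relies.\<close>

definition piv :: "int list \<Rightarrow> nat option" where
  "piv v = (case unit_index 0 v of Some p \<Rightarrow> Some p | None \<Rightarrow> nonzero_index 0 v)"

fun adds :: "(nat \<times> int list) list \<Rightarrow> int list list \<Rightarrow> (nat \<times> int list) list option" where
  "adds E [] = Some E"
| "adds E (b # bs) = (let v = reds E b in case piv v of None \<Rightarrow> None | Some p \<Rightarrow> adds (E @ [(p, v)]) bs)"

fun quo :: "int \<Rightarrow> int \<Rightarrow> int list \<Rightarrow> int option" where
  "quo d x [] = None"
| "quo d x (q # qs) = (if d * q = x then Some q else quo d x qs)"

fun ocons :: "int option \<Rightarrow> int list option \<Rightarrow> int list option" where
  "ocons (Some q) (Some v) = Some (q # v)" | "ocons None y = None" | "ocons (Some q) None = None"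

text \<open>Quotients are looked up among -4, ..., 4. A quotient outside this range merely forgoes a
  division, which is harmless: \<open>prim v\<close> only has to be a vector of which
  \<open>v\<close> is an integer multiple.\<close>

fun divl :: "int \<Rightarrow> int list \<Rightarrow> int list option" where
  "divl d [] = Some []"
| "divl d (x # xs) = ocons (quo d x [0, 1, -1, 2, -2, 3, -3, 4, -4]) (divl d xs)"

fun orelse :: "int list option \<Rightarrow> int list \<Rightarrow> int list" where
  "orelse None v = v" | "orelse (Some w) v = w"

definition prim :: "int list \<Rightarrow> int list" where
  "prim v = orelse (divl 4 v) (orelse (divl 3 v) (orelse (divl 2 v) v))"

text \<open>A certificate against \<open>fractional\<close>: elimination down to one vector with an
  entry 1 or -1, which would make its coefficient integral. The empty list must fail, as it is
  \<open>fractional\<close> vacuously. Success depends on the order of the vectors, hence the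
  rotations in \<open>rotg\<close>.\<close>

fun rgood :: "int list list \<Rightarrow> bool" where
  "rgood [] = False"
| "rgood [v] = (case unit_index 0 v of None \<Rightarrow> False | Some p \<Rightarrow> True)"
| "rgood (v # u # vs) = (let w = prim v in case piv w of None \<Rightarrow> False | Some p \<Rightarrow> rgood (map (red_full p w) (u # vs)))"

fun rotg :: "nat \<Rightarrow> int list list \<Rightarrow> bool" where
  "rotg 0 vs = False"
| "rotg (Suc n) vs = (if rgood vs then True else rotg n (rotate1 vs))"

fun anyline :: "row \<Rightarrow> col \<Rightarrow> slice list \<Rightarrow> bool" where
  "anyline a k [] = False"
| "anyline a k (h # hs) = (if has k (rowof a h) then True else anyline a k hs)"

definition esc_line :: "row \<Rightarrow> row \<Rightarrow> row \<Rightarrow> col \<Rightarrow> col \<Rightarrow> slice \<Rightarrow> slice list \<Rightarrow> bool" where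
  "esc_line a c d y w h os = (if esc a c d y w h then anyline a y os else False)"

fun feas :: "cube \<Rightarrow> slice \<Rightarrow> slice \<Rightarrow> bool" where
  "feas (Cube a b c d x y w) h h' = (if has y (rowof a h) then if has x (rowof b h) then
     if has x (rowof a h') then has y (rowof b h') else False else False else False)"

fun stuck :: "cube \<Rightarrow> slice \<Rightarrow> slice \<Rightarrow> slice list \<Rightarrow> bool" where
  "stuck (Cube a b c d x y w) h h' os = (if feas (Cube a b c d x y w) h h' then
     (if esc_line a c d y w h os then False else if esc_line b c d x w h os then False else
      if esc_line a c d x w h' os then False else if esc_line b c d y w h' os then False else True) else False)"

fun exl :: "('a \<Rightarrow> bool) \<Rightarrow> 'a list \<Rightarrow> bool" where
  "exl P [] = False"
| "exl P (x # xs) = (if P x then True else exl P xs)"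

fun picks :: "'a list \<Rightarrow> 'a list \<Rightarrow> ('a \<times> 'a list) list" where
  "picks bs [] = []"
| "picks bs (x # xs) = (x, bs @ xs) # picks (bs @ [x]) xs"

text \<open>In contrast to \<open>chk\<close>, this is applied to a complete set of slices, so a
  cell can also be excluded as least because no third slice meets it.\<close>

definition kill2 :: "slice list \<Rightarrow> bool" where
  "kill2 S = exl (\<lambda>(h, os). exl (\<lambda>(h', os'). exl (\<lambda>q. stuck q h h' os') cubes) (picks [] os)) (picks [] S)"

text \<open>If exactly one of the four lowered cells can be least and it lies in \<open>h\<close>,
  then it is strictly smaller than the other lowered cell of \<open>h\<close>. The pairs list the
  smaller cell first.\<close>

fun less_cells :: "cube \<Rightarrow> slice \<Rightarrow> slice \<Rightarrow> slice list \<Rightarrow> ((row \<times> col) \<times> (row \<times> col)) list" where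
  "less_cells (Cube a b c d x y w) h h' os = (if feas (Cube a b c d x y w) h h' then
     (if esc_line a c d x w h' os then [] else if esc_line b c d y w h' os then [] else
      if esc_line a c d y w h os then (if esc_line b c d x w h os then [] else [((a, y), (b, x))]) else
      if esc_line b c d x w h os then [((b, x), (a, y))] else []) else [])"

text \<open>Row \<open>r\<close> consists of the cells in columns \<open>k\<close>,
  \<open>k'\<close>, and column \<open>k'\<close> of the cells in rows \<open>r\<close>,
  \<open>r'\<close>. Both lines have sum 1, so the two compared cells are complementary to the same
  cell \<open>(r, k')\<close>.\<close>

fun same_value :: "slice \<Rightarrow> row \<times> col \<Rightarrow> row \<times> col \<Rightarrow> bool" where
  "same_value h (r, k) (r', k') = (if r \<noteq> r' then if k \<noteq> k' then if has k (rowof r h) then if has k' (rowof r h) then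
     if rowof r h \<noteq> Fu then list_all (\<lambda>q. has k' (rowof q h) = (q = r \<or> q = r')) [R0, R1, R2, R3]
     else False else False else False else False else False)"

text \<open>Looks for a cycle of inequalities inside one slice:
  \<open>c < c' = e < e' = c\<close>.\<close>

definition kill3 :: "slice list \<Rightarrow> bool" where
  "kill3 S = exl (\<lambda>(h, os). let I = concat (map (\<lambda>(h', os'). concat (map (\<lambda>q. less_cells q h h' os') cubes)) (picks [] os)) in
     exl (\<lambda>(c, c'). exl (\<lambda>(e, e'). if same_value h c e' then same_value h e c' else False) I) I) (picks [] S)"

text \<open>In the Vlach support each missing column goes with one splitting of the four rows into
  two pairs. Once the splitting for \<open>Mi2\<close> is fixed to be \<open>R0\<close>,
  \<open>R1\<close> against \<open>R2\<close>, \<open>R3\<close>, two ways remain to distribute the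
  others: \<open>V1\<close> and \<open>V2\<close>.\<close>

definition V1 :: "slice list" where
  "V1 = [Sl Mi2 Mi2 Em Em, Sl Mi1 Em Mi1 Em, Sl Mi0 Em Em Mi0, Sl Em Mi1 Em Mi1, Sl Em Mi0 Mi0 Em, Sl Em Em Mi2 Mi2]"
definition V2 :: "slice list" where
  "V2 = [Sl Mi2 Mi2 Em Em, Sl Mi1 Em Em Mi1, Sl Mi0 Em Mi0 Em, Sl Em Mi1 Mi1 Em, Sl Em Mi0 Em Mi0, Sl Em Em Mi2 Mi2]"

fun isin :: "slice \<Rightarrow> slice list \<Rightarrow> bool" where
  "isin x [] = False" | "isin x (y # ys) = (if x = y then True else isin x ys)"
fun sub :: "slice list \<Rightarrow> slice list \<Rightarrow> bool" where
  "sub [] S = True" | "sub (x # xs) S = (if isin x S then sub xs S else False)"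

text \<open>Copies of \<open>basis\<close> and \<open>cons\<close> (likewise \<open>dimT\<close> and
  \<open>normT\<close>) that stay folded while the search is evaluated by rewriting, so that their
  values are looked up instead of recomputed.\<close>

definition basisT :: "slice \<Rightarrow> int list list" where "basisT = basis"
definition consT :: "slice \<Rightarrow> cube list" where "consT = cons"

fun cat :: "slice list \<Rightarrow> int list list" where
  "cat [] = []" | "cat (h # S) = basisT h @ cat S"

text \<open>Success means that these slices, as a complete set, are contradictory or contain the
  Vlach support. The cheap tests precede the second, longer round of rotations.\<close>

definition leaf :: "slice list \<Rightarrow> bool" where
  "leaf S = (if rotg (Suc 0) (cat S) then True else if kill2 S then True else if sub V1 S then True
     else if sub V2 S then True else if kill3 S then True else rotg (Suc (Suc (Suc (Suc (Suc (Suc 0)))))) (cat S))"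

fun size_of :: "'a list \<Rightarrow> nat" where "size_of [] = 0" | "size_of (x # xs) = Suc (size_of xs)"
definition dimT :: "slice \<Rightarrow> nat" where "dimT h = size_of (basis h)"

fun le :: "nat \<Rightarrow> nat \<Rightarrow> bool" where
  "le 0 n = True" | "le (Suc m) 0 = False" | "le (Suc m) (Suc n) = le m n"
fun sb :: "nat \<Rightarrow> nat \<Rightarrow> nat" where
  "sb n 0 = n" | "sb 0 (Suc m) = 0" | "sb (Suc n) (Suc m) = sb n m"
fun consif :: "bool \<Rightarrow> slice \<Rightarrow> slice list \<Rightarrow> slice list" where
  "consif True h L = h # L" | "consif False h L = L"
definition adm :: "slice \<Rightarrow> nat \<Rightarrow> slice \<Rightarrow> bool" where
  "adm q cap h = (if le (dimT h) cap then chk (consT q) h else False)"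
fun filt :: "slice \<Rightarrow> nat \<Rightarrow> slice list \<Rightarrow> slice list" where
  "filt q cap [] = []" | "filt q cap (h # L) = consif (adm q cap h) h (filt q cap L)"
fun fl :: "slice \<Rightarrow> nat \<Rightarrow> slice list \<Rightarrow> slice list" where
  "fl q 0 L = []" | "fl q (Suc c) L = filt q (Suc c) L"
fun inC :: "row \<Rightarrow> col \<Rightarrow> slice list \<Rightarrow> slice list" where
  "inC a k [] = []" | "inC a k (h # L) = consif (has k (rowof a h)) h (inC a k L)"
fun outC :: "row \<Rightarrow> col \<Rightarrow> slice list \<Rightarrow> slice list" where
  "outC a k [] = []" | "outC a k (h # L) = consif (\<not> has k (rowof a h)) h (outC a k L)"

text \<open>Here \<open>f\<close> bounds the depth, \<open>cap\<close> is the dimension still free,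
  \<open>E\<close> the eliminated bases of the chosen slices \<open>S\<close>, and \<open>L\<close>
  the remaining candidates. When no cell is met exactly once, \<open>S\<close> may be complete, so
  \<open>leaf S\<close> is required before going on to larger sets. In \<open>loop\<close>, the list
  \<open>C\<close> holds the candidates among which an active slice must lie and \<open>R\<close>
  the others; a candidate once tried is discarded in later branches. Exhausted depth gives
  \<open>False\<close>, so it can never certify anything.\<close>

function (sequential)
  dfs :: "nat \<Rightarrow> nat \<Rightarrow> counts \<Rightarrow> (nat \<times> int list) list \<Rightarrow> slice list \<Rightarrow> slice list \<Rightarrow> bool" and
  dsp :: "(row \<times> col) option \<Rightarrow> nat \<Rightarrow> nat \<Rightarrow> counts \<Rightarrow> (nat \<times> int list) list \<Rightarrow> slice list \<Rightarrow> slice list \<Rightarrow> bool" and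
  loop :: "nat \<Rightarrow> nat \<Rightarrow> counts \<Rightarrow> (nat \<times> int list) list \<Rightarrow> slice list \<Rightarrow> slice list \<Rightarrow> slice list \<Rightarrow> bool" and
  step :: "(nat \<times> int list) list option \<Rightarrow> nat \<Rightarrow> nat \<Rightarrow> counts \<Rightarrow> slice list \<Rightarrow> slice \<Rightarrow> slice list \<Rightarrow> slice list \<Rightarrow> bool"
where
  "dfs 0 cap cn E S L = False"
| "dfs (Suc f) cap cn E S L = dsp (first_once cn) f cap cn E S L"
| "dsp (Some (a, k)) f cap cn E S L = loop f cap cn E S (inC a k L) (outC a k L)"
| "dsp None f cap cn E S L = (if leaf S then loop f cap cn E S L [] else False)"
| "loop f cap cn E S [] R = True"
| "loop f cap cn E S (h # C) R = (if step (adds E (basisT h)) f cap cn S h C R then loop f cap cn E S C R else False)"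
| "step None f cap cn S h C R = True"
| "step (Some E) f cap cn S h C R = dfs f (sb cap (dimT h)) (upd h cn) E (h # S) (fl h (sb cap (dimT h)) (C @ R))"
  by pat_completeness auto
termination by size_change

definition empty_counts :: counts where
  "empty_counts = C4 (T N0 N0 N0) (T N0 N0 N0) (T N0 N0 N0) (T N0 N0 N0)"
fun the_ech :: "(nat \<times> int list) list option \<Rightarrow> (nat \<times> int list) list" where
  "the_ech (Some E) = E" | "the_ech None = []"
definition six :: nat where "six = Suc (Suc (Suc (Suc (Suc (Suc 0)))))"
definition runroot :: "slice \<Rightarrow> slice list \<Rightarrow> bool" where
  "runroot r tb = dfs (Suc six) (sb six (dimT r)) (upd r empty_counts) (the_ech (adds [] (basisT r))) [r] (fl r (sb six (dimT r)) tb)"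

section \<open>Soundness of the individual tests\<close>

lemma le_le: "le m n \<longleftrightarrow> m \<le> n" by (induction m n rule: le.induct) auto
lemma sb_minus: "sb m n = m - n" by (induction m n rule: sb.induct) auto
lemma size_of_length [simp]: "size_of xs = length xs" by (induction xs) auto
lemma set_filt: "set (filt q cap L) = {h \<in> set L. adm q cap h}"
proof (induction L)
  case (Cons h L) then show ?case by (cases "adm q cap h") auto
qed simp
lemma set_inC: "set (inC a k L) = {h \<in> set L. has k (rowof a h)}"
proof (induction L)
  case (Cons h L) then show ?case by (cases "has k (rowof a h)") auto
qed simp
lemma set_outC: "set (outC a k L) = {h \<in> set L. \<not> has k (rowof a h)}"
proof (induction L)
  case (Cons h L) then show ?case by (cases "has k (rowof a h)") auto
qed simp
lemma exl_iff: "exl P xs \<longleftrightarrow> (\<exists>x\<in>set xs. P x)" by (induction xs) auto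
lemma chk_iff: "chk qs h \<longleftrightarrow> (\<forall>q\<in>set qs. chk1 q h)" by (induction qs) auto
lemma isin_iff: "isin x xs \<longleftrightarrow> x \<in> set xs" by (induction xs) auto
lemma sub_iff: "sub xs S \<longleftrightarrow> set xs \<subseteq> set S" by (induction xs) (auto simp: isin_iff)
lemma anyline_iff: "anyline a k hs \<longleftrightarrow> (\<exists>h\<in>set hs. has k (rowof a h))" by (induction hs) auto
lemma cat_concat: "cat S = concat (map basis S)" by (induction S) (auto simp: basisT_def)

lemma picks_split: "(x, os) \<in> set (picks bs xs) \<Longrightarrow> \<exists>ys zs. xs = ys @ x # zs \<and> os = bs @ ys @ zs"
proof (induction bs xs rule: picks.induct)
  case (2 bs y xs)
  show ?case
  proof (cases "(x, os) = (y, bs @ xs)")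
    case True
    have "y # xs = [] @ x # xs \<and> os = bs @ [] @ xs" using True by simp
    then show ?thesis by blast
  next
    case False
    then obtain ys zs where "xs = ys @ x # zs" "os = (bs @ [y]) @ ys @ zs" using 2 by auto
    then have "y # xs = (y # ys) @ x # zs \<and> os = bs @ (y # ys) @ zs" by simp
    then show ?thesis by blast
  qed
qed simp

lemma cubes_distinct:
  assumes "Cube a b c d x y w \<in> set cubes"
  shows "a \<noteq> b" "x \<noteq> y" "w \<noteq> x" "w \<noteq> y" "r = a \<or> r = b \<or> r = c \<or> r = d" "k = x \<or> k = y \<or> k = w"
  using assms by (cases r; cases k; force simp: cubes_def)+

lemma esc_min:
  assumes g: "good Z" and ne: "i \<noteq> j" "a \<noteq> b" "x \<noteq> y" and w: "w \<noteq> x" "w \<noteq> y"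
    and cov: "\<And>r. r = a \<or> r = b \<or> r = c \<or> r = d" "\<And>k. k = x \<or> k = y \<or> k = w"
    and pos: "0 < Z i a y" "0 < Z i b x" "0 < Z j a x" "0 < Z j b y"
    and min: "Z i a y \<le> Z i b x" "Z i a y \<le> Z j a x" "Z i a y \<le> Z j b y"
  shows "esc a c d y w (supp (Z i)) \<and> (\<exists>l. l \<noteq> i \<and> l \<noteq> j \<and> 0 < Z l a y)"
proof -
  note m = min_escapes[OF g ne pos min]
  from m(1) obtain w' where "w' \<noteq> x" "w' \<noteq> y" "0 < Z i a w'" by blast
  with cov(2)[of w'] have "0 < Z i a w" by auto
  moreover from m(2) obtain c' where "c' \<noteq> a" "c' \<noteq> b" "0 < Z i c' y" by blast
  with cov(1)[of c'] have "0 < Z i c y \<or> 0 < Z i d y" by auto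
  ultimately show ?thesis using m(3) by (auto simp: esc_def has_supp[OF g])
qed

text \<open>One case yields the other three by symmetry of the move: exchange both rows and columns,
  or exchange the slices together with either the columns or the rows.\<close>

lemma cube_esc:
  assumes g: "good Z" and ij: "i \<noteq> j" and q: "Cube a b c d x y w \<in> set cubes"
    and pos: "0 < Z i a y" "0 < Z i b x" "0 < Z j a x" "0 < Z j b y"
  shows "Z i a y \<le> Z i b x \<Longrightarrow> Z i a y \<le> Z j a x \<Longrightarrow> Z i a y \<le> Z j b y \<Longrightarrow>
      esc a c d y w (supp (Z i)) \<and> (\<exists>l. l \<noteq> i \<and> l \<noteq> j \<and> 0 < Z l a y)"
    and "Z i b x \<le> Z i a y \<Longrightarrow> Z i b x \<le> Z j a x \<Longrightarrow> Z i b x \<le> Z j b y \<Longrightarrow>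
      esc b c d x w (supp (Z i)) \<and> (\<exists>l. l \<noteq> i \<and> l \<noteq> j \<and> 0 < Z l b x)"
    and "Z j a x \<le> Z i a y \<Longrightarrow> Z j a x \<le> Z i b x \<Longrightarrow> Z j a x \<le> Z j b y \<Longrightarrow>
      esc a c d x w (supp (Z j)) \<and> (\<exists>l. l \<noteq> i \<and> l \<noteq> j \<and> 0 < Z l a x)"
    and "Z j b y \<le> Z i a y \<Longrightarrow> Z j b y \<le> Z i b x \<Longrightarrow> Z j b y \<le> Z j a x \<Longrightarrow>
      esc b c d y w (supp (Z j)) \<and> (\<exists>l. l \<noteq> i \<and> l \<noteq> j \<and> 0 < Z l b y)"
proof -
  note D = cubes_distinct[OF q]
  have rc: "r = a \<or> r = b \<or> r = c \<or> r = d" "r = b \<or> r = a \<or> r = c \<or> r = d" for r using D(5)[of r] by auto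
  have cc: "k = x \<or> k = y \<or> k = w" "k = y \<or> k = x \<or> k = w" for k using D(6)[of k] by auto
  show "Z i a y \<le> Z i b x \<Longrightarrow> Z i a y \<le> Z j a x \<Longrightarrow> Z i a y \<le> Z j b y \<Longrightarrow>
      esc a c d y w (supp (Z i)) \<and> (\<exists>l. l \<noteq> i \<and> l \<noteq> j \<and> 0 < Z l a y)"
    by (rule esc_min[OF g ij D(1,2,3,4) rc(1) cc(1) pos])
  show "Z i b x \<le> Z i a y \<Longrightarrow> Z i b x \<le> Z j a x \<Longrightarrow> Z i b x \<le> Z j b y \<Longrightarrow>
      esc b c d x w (supp (Z i)) \<and> (\<exists>l. l \<noteq> i \<and> l \<noteq> j \<and> 0 < Z l b x)"
    by (rule esc_min[OF g ij D(1)[symmetric] D(2)[symmetric] D(4,3) rc(2) cc(2) pos(2,1,4,3)])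
  have ji: "j \<noteq> i" using ij by simp
  show "Z j a x \<le> Z i a y \<Longrightarrow> Z j a x \<le> Z i b x \<Longrightarrow> Z j a x \<le> Z j b y \<Longrightarrow>
      esc a c d x w (supp (Z j)) \<and> (\<exists>l. l \<noteq> i \<and> l \<noteq> j \<and> 0 < Z l a x)"
    using esc_min[OF g ji D(1) D(2)[symmetric] D(4,3) rc(1) cc(2) pos(3,4,1,2)] by blast
  show "Z j b y \<le> Z i a y \<Longrightarrow> Z j b y \<le> Z i b x \<Longrightarrow> Z j b y \<le> Z j a x \<Longrightarrow>
      esc b c d y w (supp (Z j)) \<and> (\<exists>l. l \<noteq> i \<and> l \<noteq> j \<and> 0 < Z l b y)"
    using esc_min[OF g ji D(1)[symmetric] D(2) D(3,4) rc(2) cc(1) pos(4,3,2,1)] by blast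
qed

lemma four_min:
  fixes p q r s :: real
  shows "(p \<le> q \<and> p \<le> r \<and> p \<le> s) \<or> (q \<le> p \<and> q \<le> r \<and> q \<le> s) \<or> (r \<le> p \<and> r \<le> q \<and> r \<le> s) \<or> (s \<le> p \<and> s \<le> q \<and> s \<le> r)"
  by linarith

lemma chk_sound:
  assumes g: "good Z" and ij: "i \<noteq> j"
  shows "chk (cons (supp (Z i))) (supp (Z j))"
  unfolding chk_iff
proof
  fix q assume q: "q \<in> set (cons (supp (Z i)))"
  obtain a b c d x y w where Q: "q = Cube a b c d x y w" by (cases q)
  have qc: "Cube a b c d x y w \<in> set cubes" and lv: "live (Cube a b c d x y w) (supp (Z i))"
    using q by (simp_all add: Q cons_def del: live.simps)
  show "chk1 q (supp (Z j))"
  proof (cases "0 < Z j a x \<and> 0 < Z j b y")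
    case True
    have p: "0 < Z i a y" "0 < Z i b x" and e: "\<not> esc a c d y w (supp (Z i))" "\<not> esc b c d x w (supp (Z i))"
      using lv by (auto simp: has_supp[OF g] split: if_splits)
    from cube_esc[OF g ij qc p True[THEN conjunct1] True[THEN conjunct2]] e
      four_min[of "Z i a y" "Z i b x" "Z j a x" "Z j b y"]
    have "esc a c d x w (supp (Z j)) \<or> esc b c d y w (supp (Z j))" by blast
    then show ?thesis by (auto simp: Q)
  next
    case False then show ?thesis by (auto simp: Q has_supp[OF g])
  qed
qed

lemma anyline_others:
  assumes g: "good Z" and l: "l \<notin> {i, j}" "0 < Z l a y" and N: "\<forall>i r k. 0 < Z i r k \<longrightarrow> i \<in> set is"
    and eq: "set is = {i, j} \<union> set os"
  shows "anyline a y (map (\<lambda>i. supp (Z i)) os)"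
proof -
  have "l \<in> set os" using N[rule_format, OF l(2)] eq l(1) by auto
  then show ?thesis using l(2) by (auto simp: anyline_iff has_supp[OF g])
qed

lemma picks_map:
  assumes "(h, os) \<in> set (picks [] (map f xs))" "distinct xs"
  obtains i js where "h = f i" "os = map f js" "set xs = insert i (set js)" "i \<notin> set js" "distinct js"
proof -
  from picks_split[OF assms(1)] obtain ys zs where s: "map f xs = ys @ h # zs" "os = ys @ zs" by auto
  then obtain xs1 i xs2 where "xs = xs1 @ i # xs2" "ys = map f xs1" "h = f i" "zs = map f xs2"
    by (auto simp: map_eq_append_conv map_eq_Cons_conv)
  then show thesis using s assms(2) by (intro that[of i "xs1 @ xs2"]) auto
qed

lemma feas_pos:
  assumes "good Z" "feas (Cube a b c d x y w) (supp (Z i)) (supp (Z j))"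
  shows "0 < Z i a y" "0 < Z i b x" "0 < Z j a x" "0 < Z j b y"
  using assms by (auto simp: has_supp split: if_splits)

lemma esc_lineI:
  assumes g: "good Z" and N: "\<forall>i r k. 0 < Z i r k \<longrightarrow> i \<in> set is" and eq: "set is = {i, j} \<union> set os"
    and "esc a c d y w h \<and> (\<exists>l. l \<noteq> i \<and> l \<noteq> j \<and> 0 < Z l a y)"
  shows "esc_line a c d y w h (map (\<lambda>i. supp (Z i)) os)"
proof -
  from assms(4) obtain l where "l \<notin> {i, j}" "0 < Z l a y" "esc a c d y w h" by auto
  then show ?thesis using anyline_others[OF g _ _ N eq, of l a y] by (simp add: esc_line_def)
qed

lemma kill2_sound:
  assumes g: "good Z" and d: "distinct is" and N: "\<forall>i r k. 0 < Z i r k \<longrightarrow> i \<in> set is"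
  shows "\<not> kill2 (map (\<lambda>i. supp (Z i)) is)"
proof
  let ?H = "\<lambda>i. supp (Z i)"
  assume "kill2 (map ?H is)"
  then obtain h os h' os' q where p: "(h, os) \<in> set (picks [] (map ?H is))" "(h', os') \<in> set (picks [] os)"
    "q \<in> set cubes" "stuck q h h' os'" by (auto simp: kill2_def exl_iff)
  obtain i js where i: "h = ?H i" "os = map ?H js" "set is = insert i (set js)" "i \<notin> set js" "distinct js"
    using picks_map[OF p(1) d] .
  obtain j ls where j: "h' = ?H j" "os' = map ?H ls" "set js = insert j (set ls)" "j \<notin> set ls" "distinct ls"
    using picks_map[OF p(2)[unfolded i(2)] i(5)] .
  have ij: "i \<noteq> j" and eq: "set is = {i, j} \<union> set ls" using i(3,4) j(3) by auto
  obtain a b c d x y w where Q: "q = Cube a b c d x y w" by (cases q)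
  have st: "feas (Cube a b c d x y w) (?H i) (?H j)"
    "\<not> esc_line a c d y w (?H i) (map ?H ls)" "\<not> esc_line b c d x w (?H i) (map ?H ls)"
    "\<not> esc_line a c d x w (?H j) (map ?H ls)" "\<not> esc_line b c d y w (?H j) (map ?H ls)"
    using p(4) unfolding Q i(1) j(1,2) stuck.simps by (auto split: if_splits)
  note pos = feas_pos[OF g st(1)]
  note E = cube_esc[OF g ij p(3)[unfolded Q] pos]
  note L = esc_lineI[OF g N eq]
  from four_min[of "Z i a y" "Z i b x" "Z j a x" "Z j b y"] show False
    using L[OF E(1)] L[OF E(2)] L[OF E(3)] L[OF E(4)] st(2-5) by blast
qed

lemma pair_sum:
  fixes f :: "'a \<Rightarrow> real"
  assumes "finite A" "(\<Sum>x\<in>A. f x) \<in> \<int>" "c \<in> A" "d \<in> A" "c \<noteq> d" "0 < f c" "0 < f d" "f c < 1" "f d < 1"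
    "\<And>x. x \<in> A \<Longrightarrow> x \<noteq> c \<Longrightarrow> x \<noteq> d \<Longrightarrow> f x = 0"
  shows "f c + f d = 1"
proof -
  have "(\<Sum>x\<in>A. f x) = (\<Sum>x\<in>{c, d}. f x)"
    by (rule sum.mono_neutral_right) (use assms in auto)
  then have "f c + f d \<in> \<int>" using assms(2,5) by simp
  then obtain n where n: "f c + f d = of_int n" by (auto elim: Ints_cases)
  then have "0 < real_of_int n" "real_of_int n < 2" using assms by linarith+
  then have "n = 1" by linarith
  with n show ?thesis by simp
qed

lemma same_value_sound:
  assumes g: "good Z" and s: "same_value (supp (Z i)) (r, k) (r', k')"
  shows "Z i r k = Z i r' k'"
proof -
  have s': "r \<noteq> r'" "k \<noteq> k'" "0 < Z i r k" "0 < Z i r k'" "rowof r (supp (Z i)) \<noteq> Fu"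
    "list_all (\<lambda>q. has k' (rowof q (supp (Z i))) = (q = r \<or> q = r')) [R0, R1, R2, R3]"
    using s by (auto simp: has_supp[OF g] split: if_splits)
  have col: "0 < Z i q k' \<longleftrightarrow> q = r \<or> q = r'" for q
    using s'(6) by (cases q) (auto simp: has_supp[OF g])
  have row: "Z i r m = 0" if "m \<noteq> k" "m \<noteq> k'" for m
  proof (rule good_zero[OF g])
    have "has k (rowof r (supp (Z i)))" "has k' (rowof r (supp (Z i)))" using s' by (simp_all add: has_supp[OF g])
    then show "\<not> has m (rowof r (supp (Z i)))"
      using s'(2,5) that by (cases "rowof r (supp (Z i))"; cases k; cases k'; cases m) simp_all
  qed
  have "Z i r k + Z i r k' = 1"
    by (rule pair_sum[of UNIV "Z i r"]) (use s' row goodD[OF g] in auto)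
  moreover have "Z i r k' + Z i r' k' = 1"
  proof (rule pair_sum[of UNIV "\<lambda>q. Z i q k'"])
    show "Z i q k' = 0" if "q \<noteq> r" "q \<noteq> r'" for q using col[of q] that goodD(1)[OF g, of i q k'] by simp
    show "0 < Z i r' k'" using col[of r'] by simp
  qed (use s' goodD[OF g] in auto)
  ultimately show ?thesis by linarith
qed

lemma less_cells_sound:
  assumes g: "good Z" and N: "\<forall>i r k. 0 < Z i r k \<longrightarrow> i \<in> set is" and eq: "set is = {i, j} \<union> set os" and ij: "i \<noteq> j"
    and q: "q \<in> set cubes" and m: "((r, k), (r', k')) \<in> set (less_cells q (supp (Z i)) (supp (Z j)) (map (\<lambda>i. supp (Z i)) os))"
  shows "Z i r k < Z i r' k'"
proof -
  let ?H = "\<lambda>i. supp (Z i)"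
  obtain a b c d x y w where Q: "q = Cube a b c d x y w" by (cases q)
  have f: "feas (Cube a b c d x y w) (?H i) (?H j)" and n: "\<not> esc_line a c d x w (?H j) (map ?H os)"
    "\<not> esc_line b c d y w (?H j) (map ?H os)"
    and c: "(r, k) = (a, y) \<and> (r', k') = (b, x) \<and> \<not> esc_line b c d x w (?H i) (map ?H os) \<or>
      (r, k) = (b, x) \<and> (r', k') = (a, y) \<and> \<not> esc_line a c d y w (?H i) (map ?H os)"
    using m unfolding Q less_cells.simps by (auto split: if_splits)
  note pos = feas_pos[OF g f]
  note E = cube_esc[OF g ij q[unfolded Q] pos]
  note L = esc_lineI[OF g N eq]
  from c show ?thesis
  proof (elim disjE conjE)
    assume "(r, k) = (a, y)" "(r', k') = (b, x)" and e: "\<not> esc_line b c d x w (?H i) (map ?H os)"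
    moreover have "Z i a y < Z i b x"
      using four_min[of "Z i a y" "Z i b x" "Z j a x" "Z j b y"] L[OF E(2)] L[OF E(3)] L[OF E(4)] e n by fastforce
    ultimately show ?thesis by simp
  next
    assume "(r, k) = (b, x)" "(r', k') = (a, y)" and e: "\<not> esc_line a c d y w (?H i) (map ?H os)"
    moreover have "Z i b x < Z i a y"
      using four_min[of "Z i a y" "Z i b x" "Z j a x" "Z j b y"] L[OF E(1)] L[OF E(3)] L[OF E(4)] e n by fastforce
    ultimately show ?thesis by simp
  qed
qed

lemma kill3_sound:
  assumes g: "good Z" and d: "distinct is" and N: "\<forall>i r k. 0 < Z i r k \<longrightarrow> i \<in> set is"
  shows "\<not> kill3 (map (\<lambda>i. supp (Z i)) is)"
proof
  let ?H = "\<lambda>i. supp (Z i)"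
  assume k: "kill3 (map ?H is)"
  obtain h os where p: "(h, os) \<in> set (picks [] (map ?H is))" and
    k2: "let I = concat (map (\<lambda>(h', os'). concat (map (\<lambda>q. less_cells q h h' os') cubes)) (picks [] os)) in
     exl (\<lambda>(c, c'). exl (\<lambda>(e, e'). if same_value h c e' then same_value h e c' else False) I) I"
    using k unfolding kill3_def exl_iff by blast
  obtain i js where i: "h = ?H i" "os = map ?H js" "set is = insert i (set js)" "i \<notin> set js" "distinct js"
    using picks_map[OF p d] .
  define I where "I = concat (map (\<lambda>(h', os'). concat (map (\<lambda>q. less_cells q h h' os') cubes)) (picks [] os))"
  have I: "Z i r k < Z i r' k'" if m: "((r, k), (r', k')) \<in> set I" for r k r' k'
  proof -
    from m obtain h' os' q where h': "(h', os') \<in> set (picks [] os)" "q \<in> set cubes"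
      "((r, k), (r', k')) \<in> set (less_cells q h h' os')" unfolding I_def by auto
    obtain j ls where j: "h' = ?H j" "os' = map ?H ls" "set js = insert j (set ls)" "j \<notin> set ls" "distinct ls"
      using picks_map[OF h'(1)[unfolded i(2)] i(5)] .
    have ij: "i \<noteq> j" and eq: "set is = {i, j} \<union> set ls" using i(3,4) j(3) by auto
    show ?thesis by (rule less_cells_sound[OF g N eq ij h'(2) h'(3)[unfolded i(1) j(1,2)]])
  qed
  from k2 obtain c c' e e' where ce: "(c, c') \<in> set I" "(e, e') \<in> set I" "same_value h c e'" "same_value h e c'"
    unfolding I_def[symmetric] Let_def exl_iff by (auto split: if_splits)
  obtain c1 c2 c3 c4 e1 e2 e3 e4 where eqs: "c = (c1, c2)" "c' = (c3, c4)" "e = (e1, e2)" "e' = (e3, e4)"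
    by (cases c; cases c'; cases e; cases e') auto
  show False
    using I[OF ce(1)[unfolded eqs]] I[OF ce(2)[unfolded eqs]] same_value_sound[OF g ce(3)[unfolded eqs i(1)]]
      same_value_sound[OF g ce(4)[unfolded eqs i(1)]] by linarith
qed

lemma unit_index_Some: "unit_index n xs = Some p \<Longrightarrow> n \<le> p \<and> p - n < length xs \<and> (xs ! (p - n) = 1 \<or> xs ! (p - n) = - 1)"
proof (induction n xs rule: unit_index.induct)
  case (2 n x xs)
  show ?case
  proof (cases "x = 1 \<or> x = - 1")
    case True then show ?thesis using 2(2) by auto
  next
    case False
    then have p: "Suc n \<le> p \<and> p - Suc n < length xs \<and> (xs ! (p - Suc n) = 1 \<or> xs ! (p - Suc n) = - 1)"
      using 2 by auto
    then obtain m where "p = Suc n + m" using le_Suc_ex by blast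
    with p show ?thesis by simp
  qed
qed simp

lemma nonzero_index_Some: "nonzero_index n xs = Some p \<Longrightarrow> n \<le> p \<and> p - n < length xs \<and> xs ! (p - n) \<noteq> 0"
proof (induction n xs rule: nonzero_index.induct)
  case (2 n x xs)
  show ?case
  proof (cases "x = 0")
    case False then show ?thesis using 2(2) by auto
  next
    case True
    then have p: "Suc n \<le> p \<and> p - Suc n < length xs \<and> xs ! (p - Suc n) \<noteq> 0" using 2 by auto
    then obtain m where "p = Suc n + m" using le_Suc_ex by blast
    with p show ?thesis by simp
  qed
qed simp

lemma nonzero_index_None: "nonzero_index n xs = None \<Longrightarrow> x \<in> set xs \<Longrightarrow> x = 0"
  by (induction n xs rule: nonzero_index.induct) (auto split: if_splits)

lemma piv_Some: "piv v = Some p \<Longrightarrow> p < length v \<and> v ! p \<noteq> 0"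
  using unit_index_Some[of 0 v] nonzero_index_Some[of 0 v] by (fastforce simp: piv_def split: option.splits)

lemma piv_None: "piv v = None \<Longrightarrow> x \<in> set v \<Longrightarrow> x = 0"
  using nonzero_index_None[of 0 v] by (auto simp: piv_def split: option.splits)

lemma quo_Some: "quo d x qs = Some q \<Longrightarrow> d * q = x"
  by (induction d x qs rule: quo.induct) (auto split: if_splits)

lemma divl_Some: "divl d v = Some w \<Longrightarrow> length w = length v \<and> (\<forall>n<length v. v ! n = d * w ! n)"
proof (induction d v arbitrary: w rule: divl.induct)
  case (2 d x xs)
  obtain q u where qu: "quo d x [0, 1, -1, 2, -2, 3, -3, 4, -4] = Some q" "divl d xs = Some u" "w = q # u"
    using 2(2) unfolding divl.simps by (auto elim: ocons.elims)
  have "d * q = x" by (rule quo_Some[OF qu(1)])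
  with 2(1)[OF qu(2)] show ?case by (auto simp: qu(3) nth_Cons split: nat.splits)
qed simp

lemma prim_mult: "\<exists>g. length (prim v) = length v \<and> (\<forall>n<length v. v ! n = g * prim v ! n)"
proof (cases "divl 4 v")
  case (Some w) then show ?thesis using divl_Some[OF Some] by (auto simp: prim_def)
next
  case 4: None
  show ?thesis
  proof (cases "divl 3 v")
    case (Some w) then show ?thesis using divl_Some[OF Some] by (auto simp: prim_def 4)
  next
    case 3: None
    show ?thesis
    proof (cases "divl 2 v")
      case (Some w) then show ?thesis using divl_Some[OF Some] by (auto simp: prim_def 3 4)
    next
      case None then show ?thesis by (intro exI[of _ 1]) (simp add: prim_def 3 4)
    qed
  qed
qed

lemma rgood_sound:
  assumes "fractional 6 vs" "\<And>v. v \<in> set vs \<Longrightarrow> length v = 6"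
  shows "\<not> rgood vs"
  using assms
proof (induction vs rule: rgood.induct)
  case (2 v)
  show ?case
  proof
    assume "rgood [v]"
    then obtain p where "unit_index 0 v = Some p" by (auto split: option.splits)
    then have "p < 6" "v ! p = 1 \<or> v ! p = - 1" using unit_index_Some[of 0 v p] 2(2) by auto
    from not_fractional_single[OF this] 2(1) show False by simp
  qed
next
  case (3 v u vs)
  show ?case
  proof (cases "piv (prim v)")
    case None then show ?thesis by (simp add: Let_def)
  next
    case (Some p)
    obtain g where g: "length (prim v) = length v" "\<forall>n<length v. v ! n = g * prim v ! n" using prim_mult by blast
    have len: "length v = 6" "\<And>x. x \<in> set (u # vs) \<Longrightarrow> length x = 6" using 3(3) by auto
    have f: "fractional 6 (map (red_full p (prim v)) (u # vs))"
      by (rule fractional_step[OF 3(2), where g = g]) (use g len piv_Some[OF Some] in auto)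
    have l: "length x = 6" if "x \<in> set (map (red_full p (prim v)) (u # vs))" for x
      using that len g(1) by (auto simp: red_full_def)
    have "\<not> rgood (map (red_full p (prim v)) (u # vs))" by (rule 3(1)[OF refl Some f l])
    then show ?thesis using Some by (simp add: Let_def)
  qed
qed simp

lemma rotg_sound:
  assumes "fractional 6 vs" "\<And>v. v \<in> set vs \<Longrightarrow> length v = 6"
  shows "\<not> rotg n vs"
  using assms by (induction n vs rule: rotg.induct) (simp_all add: rgood_sound fractional_rotate1)

lemma indep_last:
  assumes "indep m (us @ [v])" shows "\<exists>n<m. v ! n \<noteq> 0"
proof (rule ccontr)
  assume z: "\<not> ?thesis"
  have "null (map (\<lambda>v. (0, v)) us @ [(1, v)])"
    by (rule indepD[OF assms]) (use z in \<open>simp_all add: comp_def comb_eq_0\<close>)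
  then show False by simp
qed

text \<open>Expresses directly what the search needs of \<open>E\<close>: whatever is independent
  together with \<open>B\<close> remains independent after reduction. An independent vector
  therefore never reduces to zero, and \<open>adds\<close> succeeds on it.\<close>

definition estate :: "(nat \<times> int list) list \<Rightarrow> int list list \<Rightarrow> bool" where
  "estate E B \<longleftrightarrow> (\<forall>e\<in>set E. length (snd e) = 6) \<and>
    (\<forall>ws. (\<forall>w\<in>set ws. length w = 6) \<longrightarrow> indep 6 (B @ ws) \<longrightarrow> indep 6 (map snd E @ map (reds E) ws))"

lemma length_red: "length (snd e) = 6 \<Longrightarrow> length v = 6 \<Longrightarrow> length (red e v) = 6"
  by (cases e) (simp add: Let_def)

lemma length_reds: "\<forall>e\<in>set E. length (snd e) = 6 \<Longrightarrow> length v = 6 \<Longrightarrow> length (reds E v) = 6"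
  by (induction E v rule: reds.induct) (simp_all add: length_red)

lemma reds_snoc: "reds (E @ [e]) v = red e (reds E v)"
  by (induction E v rule: reds.induct) simp_all

lemma adds_sound:
  assumes "estate E B" "\<forall>b\<in>set bs. length b = 6" "indep 6 (B @ bs)"
  shows "\<exists>E'. adds E bs = Some E' \<and> estate E' (B @ bs)"
  using assms
proof (induction bs arbitrary: E B)
  case (Cons b bs)
  let ?v = "reds E b"
  have E: "\<forall>e\<in>set E. length (snd e) = 6"
    "\<And>ws. \<forall>w\<in>set ws. length w = 6 \<Longrightarrow> indep 6 (B @ ws) \<Longrightarrow> indep 6 (map snd E @ map (reds E) ws)"
    using Cons.prems(1) unfolding estate_def by blast+
  have lv: "length ?v = 6" using length_reds[OF E(1)] Cons.prems(2) by simp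
  have "indep 6 (B @ [b])" using indep_prefix[of 6 "B @ [b]" bs] Cons.prems(3) by simp
  then have "indep 6 (map snd E @ [?v])" using E(2)[of "[b]"] Cons.prems(2) by simp
  then obtain n where "n < 6" "?v ! n \<noteq> 0" using indep_last by blast
  then have "piv ?v \<noteq> None" using piv_None[of ?v "?v ! n"] lv by auto
  then obtain p where p: "piv ?v = Some p" by blast
  have "estate (E @ [(p, ?v)]) (B @ [b])" unfolding estate_def
  proof (intro conjI allI impI)
    show "\<forall>e\<in>set (E @ [(p, ?v)]). length (snd e) = 6" using E(1) lv by simp
    fix ws :: "int list list" assume ws: "\<forall>w\<in>set ws. length w = 6" "indep 6 ((B @ [b]) @ ws)"
    have 1: "indep 6 (map snd E @ ?v # map (reds E) ws)"
      using E(2)[of "b # ws"] ws Cons.prems(2) by simp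
    have "indep 6 (map snd E @ ?v # map (red (p, ?v)) (map (reds E) ws))"
      by (rule indep_red[OF 1]) (use piv_Some[OF p] lv ws(1) length_reds[OF E(1)] in auto)
    moreover have e: "reds (E @ [(p, ?v)]) = red (p, ?v) \<circ> reds E"
      by (rule ext) (simp add: reds_snoc del: red.simps)
    ultimately show "indep 6 (map snd (E @ [(p, ?v)]) @ map (reds (E @ [(p, ?v)])) ws)"
      unfolding e by (simp del: red.simps)
  qed
  from Cons.IH[OF this] Cons.prems(2,3) p show ?case by (simp add: Let_def)
qed simp

section \<open>Soundness of the search\<close>

fun trip :: "col \<Rightarrow> triple \<Rightarrow> status" where
  "trip K0 (T x y z) = x" | "trip K1 (T x y z) = y" | "trip K2 (T x y z) = z"
fun count_row :: "row \<Rightarrow> counts \<Rightarrow> triple" where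
  "count_row R0 (C4 p q r s) = p" | "count_row R1 (C4 p q r s) = q"
| "count_row R2 (C4 p q r s) = r" | "count_row R3 (C4 p q r s) = s"

definition status_of :: "nat \<Rightarrow> status" where
  "status_of n = (if n = 0 then N0 else if n = 1 then N1 else N2)"

definition counts_ok :: "counts \<Rightarrow> slice list \<Rightarrow> bool" where
  "counts_ok cn S \<longleftrightarrow> (\<forall>r k. trip k (count_row r cn) = status_of (length (filter (\<lambda>h. has k (rowof r h)) S)))"

lemma counts_ok_upd:
  assumes "counts_ok cn S" shows "counts_ok (upd h cn) (h # S)"
proof -
  have "trip k (upr s t) = (if has k s then inc (trip k t) else trip k t)" for k s t
    by (cases t; cases s; cases k) simp_all
  moreover have "count_row r (upd h cn) = upr (rowof r h) (count_row r cn)" for r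
    by (cases r; cases h; cases cn) simp_all
  moreover have "inc (status_of n) = status_of (Suc n)" for n by (simp add: status_of_def)
  ultimately show ?thesis using assms by (simp add: counts_ok_def)
qed

lemma first_once_Some: "first_once cn = Some (r, k) \<Longrightarrow> trip k (count_row r cn) = N1"
proof -
  have once: "once s \<Longrightarrow> s = N1" for s by (cases s) simp_all
  show "first_once cn = Some (r, k) \<Longrightarrow> trip k (count_row r cn) = N1"
    by (cases cn rule: counts.exhaust, rename_tac a b c d; case_tac a; case_tac b; case_tac c; case_tac d)
       (auto split: if_splits dest: once)
qed

lemma status_N1: "status_of n = N1 \<longleftrightarrow> n = 1" by (simp add: status_of_def)

context
  fixes Z :: "'i :: finite \<Rightarrow> row \<Rightarrow> col \<Rightarrow> real"
  assumes g: "good Z"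
begin

abbreviation "H \<equiv> \<lambda>i. supp (Z i)"
definition "active = {i. \<exists>r k. 0 < Z i r k}"
definition "found \<longleftrightarrow> set V1 \<subseteq> H ` active \<or> set V2 \<subseteq> H ` active"
abbreviation "bases is \<equiv> concat (map (\<lambda>i. basis (H i)) is)"

lemma length_bases: "b \<in> set (bases is) \<Longrightarrow> length b = 6"
  using length_basis by auto

text \<open>With an empty basis, \<open>basis_frac\<close> would make the six free entries integral
  and hence zero, as they lie below 1. Integral row sums and then integral column sums carry this
  over to the remaining entries. Consequently every chosen slice consumes dimension.\<close>

lemma basis_nonempty:
  assumes "i \<in> active" shows "basis (H i) \<noteq> []"
proof
  assume e: "basis (H i) = []"
  have "\<exists>ls. map snd ls = basis (H i) \<and> nonint ls \<and> (\<forall>n<6. comb ls n - glob (Z i) n \<in> \<int>)"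
    by (rule basis_frac) (use good_frac[OF g] good_zero[OF g] goodD[OF g] in auto)
  then have n: "\<forall>n<6. glob (Z i) n \<in> \<int>" using e by auto
  have int0: "Z i r k = 0" if "Z i r k \<in> \<int>" for r k
    using that not_Ints[of "Z i r k"] goodD(1,2)[OF g, of i r k] by fastforce
  have z: "Z i R0 K0 = 0" "Z i R0 K1 = 0" "Z i R1 K0 = 0" "Z i R1 K1 = 0" "Z i R2 K0 = 0" "Z i R2 K1 = 0"
    using n[rule_format, of 0] n[rule_format, of 1] n[rule_format, of 2] n[rule_format, of 3] n[rule_format, of 4] n[rule_format, of 5]
    by (auto intro!: int0 simp: glob_def eval_nat_numeral)
  have z2: "Z i R0 K2 = 0" "Z i R1 K2 = 0" "Z i R2 K2 = 0"
    using goodD(3)[OF g, of i R0] goodD(3)[OF g, of i R1] goodD(3)[OF g, of i R2] z by (auto intro!: int0 simp: sum_col)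
  have z3: "Z i R3 K0 = 0" "Z i R3 K1 = 0" "Z i R3 K2 = 0"
    using goodD(4)[OF g, of i K0] goodD(4)[OF g, of i K1] goodD(4)[OF g, of i K2] z z2 by (auto intro!: int0 simp: sum_row)
  obtain r k where "0 < Z i r k" using assms by (auto simp: active_def)
  then show False using z z2 z3 by (cases r; cases k) simp_all
qed

text \<open>Equal supports would put the same basis vector into the independent list twice. This
  justifies removing a chosen support from the candidates.\<close>

lemma H_inj: "i \<in> active \<Longrightarrow> j \<in> active \<Longrightarrow> H i = H j \<Longrightarrow> i = j"
proof (rule ccontr)
  assume i: "i \<in> active" and e: "H i = H j" and ne: "i \<noteq> j"
  obtain b bs where b: "basis (H i) = b # bs" using basis_nonempty[OF i] by (cases "basis (H i)") auto
  have "indep 6 (bases [i, j])" by (rule good_indep[OF g]) (use ne in simp)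
  then have 1: "indep 6 (b # bs @ b # bs)" using b e by simp
  have "null ((1, b) # map (\<lambda>v. (0, v)) bs @ (-1, b) # map (\<lambda>v. (0, v)) bs)"
    by (rule indepD[OF 1]) (simp_all add: comp_def comb_eq_0)
  then show False by simp
qed

lemma bases_le: "distinct is \<Longrightarrow> length (bases is) \<le> 6"
  by (rule indep_le[OF good_indep[OF g] length_bases]) auto

text \<open>The reversal reconciles two orders: chosen slices are put in front of \<open>is\<close>,
  their reduced vectors at the end of \<open>E\<close>. The subtraction from 6 never truncates, by
  \<open>bases_le\<close>.\<close>

definition "istate cap cn E is \<longleftrightarrow> distinct is \<and> set is \<subseteq> active \<and> counts_ok cn (map H is) \<and>
  estate E (bases (rev is)) \<and> cap = 6 - length (bases (rev is))"

lemma leaf_sound: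
  assumes "leaf (map H is)" "distinct is" "active = set is"
  shows found
proof -
  have N: "\<forall>i r k. 0 < Z i r k \<longrightarrow> i \<in> set is" using assms(3) by (auto simp: active_def)
  have out: "Z i r k = 0" if "i \<notin> set is" for i r k
  proof -
    have "\<not> 0 < Z i r k" using that N by blast
    then show ?thesis using goodD(1)[OF g, of i r k] by linarith
  qed
  have f: "fractional 6 (cat (map H is))"
    unfolding cat_concat map_map comp_def by (rule good_fractional[OF g assms(2) out])
  have l: "length v = 6" if "v \<in> set (cat (map H is))" for v
    using that length_basis by (auto simp: cat_concat)
  have "sub V1 (map H is) \<or> sub V2 (map H is)"
    using assms(1) rotg_sound[OF f l] kill2_sound[OF g assms(2) N] kill3_sound[OF g assms(2) N]
    unfolding leaf_def by (auto simp del: rotg.simps sub.simps split: if_splits)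
  then show ?thesis using assms(3) by (auto simp: sub_iff found_def)
qed

lemma second_slice:
  assumes "0 < Z i r k" shows "\<exists>j. j \<noteq> i \<and> 0 < Z j r k"
  using line_one[of UNIV "\<lambda>i. Z i r k" i] goodD[OF g] assms by auto

lemma once_needs:
  assumes "istate cap cn E is" "first_once cn = Some (r, k)"
  shows "\<exists>j\<in>active - set is. has k (rowof r (H j))"
proof -
  have d: "distinct is" using assms(1) by (simp add: istate_def)
  have "length (filter (\<lambda>h. has k (rowof r h)) (map H is)) = 1"
    using assms first_once_Some[OF assms(2)] by (simp add: istate_def counts_ok_def status_N1)
  then have c: "card {i \<in> set is. 0 < Z i r k} = 1"
    using distinct_card[OF distinct_filter[OF d, of "\<lambda>i. has k (rowof r (H i))"]]
    by (simp add: filter_map comp_def has_supp[OF g])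
  then obtain i where i: "{i \<in> set is. 0 < Z i r k} = {i}" by (auto simp: card_1_singleton_iff)
  then obtain j where j: "j \<noteq> i" "0 < Z j r k" using second_slice[of i r k] by blast
  then have "j \<notin> set is" using i by blast
  then show ?thesis using j(2) has_supp[OF g, of k r j] by (auto simp: active_def)
qed

lemma admissible:
  assumes inv: "istate cap cn E is" and j: "j \<in> active - set is" and l: "l \<in> active - set is" "l \<noteq> j"
  shows "adm (H j) (cap - dimT (H j)) (H l)" "0 < dimT (H l)" "dimT (H l) \<le> cap - dimT (H j)"
proof -
  have d: "distinct (rev is @ [j, l])" using inv j l by (auto simp: istate_def)
  have "length (bases (rev is)) + dimT (H j) + dimT (H l) \<le> 6"
    using bases_le[OF d] by (simp add: dimT_def)
  moreover have "cap = 6 - length (bases (rev is))" using inv by (simp add: istate_def)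
  ultimately show 1: "dimT (H l) \<le> cap - dimT (H j)" by linarith
  show "0 < dimT (H l)" using basis_nonempty[of l] l(1) by (simp add: dimT_def)
  show "adm (H j) (cap - dimT (H j)) (H l)"
    using 1 chk_sound[OF g, of j l] l(2) by (simp add: adm_def le_le consT_def)
qed

lemma inv_step:
  assumes inv: "istate cap cn E is" and j: "j \<in> active - set is"
  shows "\<exists>E'. adds E (basis (H j)) = Some E' \<and> istate (cap - dimT (H j)) (upd (H j) cn) E' (j # is)"
proof -
  have d: "distinct (rev is @ [j])" using inv j by (auto simp: istate_def)
  have "indep 6 (bases (rev is) @ basis (H j))" using good_indep[OF g d] by simp
  with adds_sound[of E "bases (rev is)" "basis (H j)"] inv length_basis obtain E' where
    "adds E (basis (H j)) = Some E'" "estate E' (bases (rev is) @ basis (H j))" by (auto simp: istate_def)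
  then show ?thesis using inv j counts_ok_upd[of cn "map H is" "H j"] by (auto simp: istate_def dimT_def)
qed

text \<open>A search that returns \<open>True\<close> must have met the pattern, provided the chosen
  slices are active and all other active ones are candidates. For \<open>loop\<close>, an active
  slice is known to lie in \<open>C\<close>: if its head is one, \<open>step\<close> continues with
  it, otherwise the head may be dropped.\<close>

lemma search_sound:
  "dfs f cap cn E S L \<Longrightarrow> \<forall>is. S = map H is \<longrightarrow> istate cap cn E is \<longrightarrow> (\<forall>j\<in>active - set is. H j \<in> set L) \<longrightarrow> found"
  "dsp o' f cap cn E S L \<Longrightarrow> \<forall>is. S = map H is \<longrightarrow> istate cap cn E is \<longrightarrow> (\<forall>j\<in>active - set is. H j \<in> set L) \<longrightarrow>
     o' = first_once cn \<longrightarrow> found"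
  "loop f cap cn E S C R \<Longrightarrow> \<forall>is. S = map H is \<longrightarrow> istate cap cn E is \<longrightarrow> (\<forall>j\<in>active - set is. H j \<in> set (C @ R)) \<longrightarrow>
     (\<exists>j\<in>active - set is. H j \<in> set C) \<longrightarrow> found"
  "step oE f cap cn S h C R \<Longrightarrow> \<forall>is j E0. S = map H is \<longrightarrow> istate cap cn E0 is \<longrightarrow> oE = adds E0 (basis h) \<longrightarrow>
     j \<in> active - set is \<longrightarrow> H j = h \<longrightarrow> (\<forall>l\<in>active - set is. H l \<in> set (h # C @ R)) \<longrightarrow> found"
proof (induction f cap cn E S L and o' f cap cn E S L and f cap cn E S C R and oE f cap cn S h C R
    rule: dfs_dsp_loop_step.induct)
  case (1 cap cn E S L)
  then show ?case by simp
next
  case (2 f cap cn E S L)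
  then show ?case by simp
next
  case (3 a k f cap cn E S L)
  show ?case
  proof (intro allI impI)
    fix "is" assume p: "S = map H is" "istate cap cn E is" "\<forall>j\<in>active - set is. H j \<in> set L" "Some (a, k) = first_once cn"
    from once_needs[OF p(2), of a k] p(4) obtain j where j: "j \<in> active - set is" "has k (rowof a (H j))" by auto
    have 1: "\<forall>j\<in>active - set is. H j \<in> set (inC a k L @ outC a k L)" using p(3) by (auto simp: set_inC set_outC)
    have 2: "\<exists>j\<in>active - set is. H j \<in> set (inC a k L)" using p(3) j by (auto simp: set_inC)
    have "loop f cap cn E S (inC a k L) (outC a k L)" using 3(2) by simp
    from 3(1)[OF this] p(1,2) 1 2 show found by blast
  qed
next
  case (4 f cap cn E S L)
  from 4(2) have lf: "leaf S" and lp: "loop f cap cn E S L []" by (auto split: if_splits)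
  show ?case
  proof (intro allI impI)
    fix "is" assume p: "S = map H is" "istate cap cn E is" "\<forall>j\<in>active - set is. H j \<in> set L" "None = first_once cn"
    show found
    proof (cases "active = set is")
      case True
      have "distinct is" using p(2) by (simp add: istate_def)
      with True lf p(1) show ?thesis using leaf_sound by simp
    next
      case False
      then have "\<exists>j\<in>active - set is. H j \<in> set L" using p(2,3) by (auto simp: istate_def)
      moreover have "\<forall>j\<in>active - set is. H j \<in> set (L @ [])" using p(3) by simp
      ultimately show ?thesis using 4(1)[OF lf lp] p(1,2) by blast
    qed
  qed
next
  case (5 f cap cn E S R)
  then show ?case by simp
next
  case (6 f cap cn E S h C R)
  from 6(3) have st: "step (adds E (basisT h)) f cap cn S h C R" and lp: "loop f cap cn E S C R"
    by (auto split: if_splits)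
  show ?case
  proof (intro allI impI)
    fix "is" assume p: "S = map H is" "istate cap cn E is" "\<forall>j\<in>active - set is. H j \<in> set ((h # C) @ R)"
      "\<exists>j\<in>active - set is. H j \<in> set (h # C)"
    show found
    proof (cases "\<exists>j\<in>active - set is. H j = h")
      case True
      then obtain j where j: "j \<in> active - set is" "H j = h" by blast
      have "adds E (basisT h) = adds E (basis h)" by (simp add: basisT_def)
      moreover have "\<forall>l\<in>active - set is. H l \<in> set (h # C @ R)" using p(3) by simp
      ultimately show ?thesis using 6(1)[OF st] p(1,2) j by blast
    next
      case False
      then have "\<forall>j\<in>active - set is. H j \<in> set (C @ R)" "\<exists>j\<in>active - set is. H j \<in> set C"
        using p(3,4) by auto
      with 6(2)[OF st lp] p(1,2) show ?thesis by blast
    qed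
  qed
next
  case (7 f cap cn S h C R)
  show ?case
  proof (intro allI impI)
    fix "is" j E0 assume p: "istate cap cn E0 is" "None = adds E0 (basis h)" "j \<in> active - set is" "H j = h"
    from inv_step[OF p(1,3)] p(2,4) show found by auto
  qed
next
  case (8 E f cap cn S h C R)
  show ?case
  proof (intro allI impI)
    fix "is" j E0 assume p: "S = map H is" "istate cap cn E0 is" "Some E = adds E0 (basis h)" "j \<in> active - set is" "H j = h"
      "\<forall>l\<in>active - set is. H l \<in> set (h # C @ R)"
    obtain E' where E': "adds E0 (basis (H j)) = Some E'" "istate (cap - dimT (H j)) (upd (H j) cn) E' (j # is)"
      using inv_step[OF p(2,4)] by blast
    have EE: "E' = E" using E'(1) p(3,5) by simp
    have L: "\<forall>l\<in>active - set (j # is). H l \<in> set (fl h (sb cap (dimT h)) (C @ R))"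
    proof
      fix l assume l: "l \<in> active - set (j # is)"
      then have l': "l \<in> active - set is" "l \<noteq> j" by auto
      note A = admissible[OF p(2,4) l']
      have "H l \<noteq> h" using H_inj[of l j] l' p(4,5) by auto
      then have "H l \<in> set (C @ R)" using p(6) l' by auto
      moreover obtain c where "sb cap (dimT h) = Suc c" using A(2,3) p(5) by (cases "sb cap (dimT h)") (auto simp: sb_minus)
      ultimately show "H l \<in> set (fl h (sb cap (dimT h)) (C @ R))"
        using A(1) p(5) by (simp add: set_filt sb_minus)
    qed
    have i: "istate (sb cap (dimT h)) (upd h cn) E (j # is)" using E'(2) EE p(5) by (simp add: sb_minus)
    have S: "h # S = map H (j # is)" using p(1,5) by simp
    have d: "dfs f (sb cap (dimT h)) (upd h cn) E (h # S) (fl h (sb cap (dimT h)) (C @ R))" using 8(2) by simp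
    show found by (rule mp[OF mp[OF mp[OF 8(1)[OF d, THEN spec[of _ "j # is"]] S] i] L])
  qed
qed

lemma runroot_sound:
  assumes "runroot (H i) tb" "i \<in> active" "\<forall>j\<in>active. H j \<in> set tb"
  shows found
proof -
  have "reds [] = id" by (rule ext) simp
  then have e: "estate [] []" by (simp add: estate_def)
  have c: "counts_ok empty_counts []"
    unfolding counts_ok_def by (simp add: all_row all_col empty_counts_def status_of_def)
  have i0: "istate 6 empty_counts [] []" using e c by (simp add: istate_def)
  obtain E' where E': "adds [] (basis (H i)) = Some E'" "istate (6 - dimT (H i)) (upd (H i) empty_counts) E' [i]"
    using inv_step[OF i0, of i] assms(2) by auto
  have six: "sb six n = 6 - n" for n by (simp add: sb_minus six_def)
  have L: "\<forall>l\<in>active - set [i]. H l \<in> set (fl (H i) (sb six (dimT (H i))) tb)"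
  proof
    fix l assume l: "l \<in> active - set [i]"
    note A = admissible[OF i0, of i l]
    obtain c where "sb six (dimT (H i)) = Suc c" using A(2,3) assms(2) l by (cases "sb six (dimT (H i))") (auto simp: six)
    then show "H l \<in> set (fl (H i) (sb six (dimT (H i))) tb)"
      using A(1) assms(2,3) l by (simp add: set_filt six)
  qed
  show ?thesis
  proof (rule mp[OF mp[OF mp[OF search_sound(1)[OF assms(1)[unfolded runroot_def], THEN spec[of _ "[i]"]]]] L])
    show "[H i] = map H [i]" by simp
    show "istate (sb six (dimT (H i))) (upd (H i) empty_counts) (the_ech (adds [] (basisT (H i)))) [i]"
      using E' by (simp add: six basisT_def)
  qed
qed

end

section \<open>Symmetry in the rows and columns\<close>

fun count_col :: "col \<Rightarrow> slice \<Rightarrow> nat" where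
  "count_col k (Sl a b c d) = length (filter (has k) [a, b, c, d])"
text \<open>A column, like a row, cannot contain a single nonzero entry. For rows this is built into
  \<open>rsupp\<close>.\<close>

definition valid :: "slice \<Rightarrow> bool" where
  "valid h \<longleftrightarrow> count_col K0 h \<noteq> 1 \<and> count_col K1 h \<noteq> 1 \<and> count_col K2 h \<noteq> 1 \<and> h \<noteq> Sl Em Em Em Em"

fun sw01 :: "rsupp \<Rightarrow> rsupp" where
  "sw01 Mi0 = Mi1" | "sw01 Mi1 = Mi0" | "sw01 Mi2 = Mi2" | "sw01 Em = Em" | "sw01 Fu = Fu"
fun sw12 :: "rsupp \<Rightarrow> rsupp" where
  "sw12 Mi1 = Mi2" | "sw12 Mi2 = Mi1" | "sw12 Mi0 = Mi0" | "sw12 Em = Em" | "sw12 Fu = Fu"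
fun map_slice :: "(rsupp \<Rightarrow> rsupp) \<Rightarrow> slice \<Rightarrow> slice" where
  "map_slice f (Sl a b c d) = Sl (f a) (f b) (f c) (f d)"
fun row01 :: "slice \<Rightarrow> slice" where "row01 (Sl a b c d) = Sl b a c d"
fun row12 :: "slice \<Rightarrow> slice" where "row12 (Sl a b c d) = Sl a c b d"
fun row23 :: "slice \<Rightarrow> slice" where "row23 (Sl a b c d) = Sl a b d c"

definition gens :: "(slice \<Rightarrow> slice) set" where
  "gens = {row01, row12, row23, map_slice sw01, map_slice sw12}"

fun occ :: "rsupp \<Rightarrow> slice \<Rightarrow> nat" where
  "occ x (Sl a b c d) = length (filter (\<lambda>r. r = x) [a, b, c, d])"
fun rank :: "rsupp \<Rightarrow> nat" where
  "rank Fu = 0" | "rank Mi2 = 1" | "rank Mi1 = 2" | "rank Mi0 = 3" | "rank Em = 4"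

definition try_col01 where "try_col01 h = (if occ Mi1 h < occ Mi0 h then map_slice sw01 h else h)"
definition try_col12 where "try_col12 h = (if occ Mi2 h < occ Mi1 h then map_slice sw12 h else h)"
fun try01 where "try01 (Sl a b c d) = (if rank b < rank a then row01 (Sl a b c d) else Sl a b c d)"
fun try12 where "try12 (Sl a b c d) = (if rank c < rank b then row12 (Sl a b c d) else Sl a b c d)"
fun try23 where "try23 (Sl a b c d) = (if rank d < rank c then row23 (Sl a b c d) else Sl a b c d)"

text \<open>Sorting the columns by frequency and then the rows.\<close>
definition norm where
  "norm h = try01 (try12 (try01 (try23 (try12 (try01 (try_col12 (try_col01 (try_col12 h))))))))"

text \<open>Words in the generators, and not group elements, so that each letter can be mirrored by
  a relabelling of the whole table in \<open>reach_moved\<close>.\<close>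

definition reach :: "slice \<Rightarrow> slice \<Rightarrow> bool" where
  "reach h h' \<longleftrightarrow> (\<exists>W. set W \<subseteq> gens \<and> h' = fold (\<lambda>f x. f x) W h)"

lemma reach_refl: "reach h h" unfolding reach_def by (intro exI[of _ "[]"]) simp
lemma reach_step: "reach h h' \<Longrightarrow> f \<in> gens \<Longrightarrow> reach h (f h')"
  unfolding reach_def by (elim exE, rename_tac W, rule_tac x = "W @ [f]" in exI) auto
lemma reach_cond: "reach h h' \<Longrightarrow> f \<in> gens \<Longrightarrow> x = f h' \<or> x = h' \<Longrightarrow> reach h x"
  using reach_step by blast

lemma reach_try:
  assumes "reach h h'"
  shows "reach h (try_col01 h')" "reach h (try_col12 h')" "reach h (try01 h')" "reach h (try12 h')" "reach h (try23 h')"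
proof -
  show "reach h (try_col01 h')"
    by (rule reach_cond[OF assms, of "map_slice sw01"]) (simp_all add: gens_def try_col01_def)
  show "reach h (try_col12 h')"
    by (rule reach_cond[OF assms, of "map_slice sw12"]) (simp_all add: gens_def try_col12_def)
  show "reach h (try01 h')"
    by (rule reach_cond[OF assms, of row01]) (simp add: gens_def, cases h', simp)
  show "reach h (try12 h')"
    by (rule reach_cond[OF assms, of row12]) (simp add: gens_def, cases h', simp)
  show "reach h (try23 h')"
    by (rule reach_cond[OF assms, of row23]) (simp add: gens_def, cases h', simp)
qed

lemma reach_norm: "reach h (norm h)"
  unfolding norm_def by (intro reach_try reach_refl)

text \<open>Ties between column frequencies are harmless: exchanging two equally frequent missing
  columns leads to the same rows up to order, and sorting the rows absorbs the difference. The check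
  runs over all slices.\<close>

lemma norm_gens: "f \<in> gens \<Longrightarrow> norm (f h) = norm h"
proof -
  have "list_all (\<lambda>h. norm (row01 h) = norm h \<and> norm (row12 h) = norm h \<and> norm (row23 h) = norm h \<and>
     norm (map_slice sw01 h) = norm h \<and> norm (map_slice sw12 h) = norm h) slices_all" by code_simp
  then show "f \<in> gens \<Longrightarrow> norm (f h) = norm h"
    using slices_all[of h] by (auto simp: list_all_iff gens_def)
qed

definition normT :: "slice \<Rightarrow> slice" where "normT = norm"

fun rem :: "slice \<Rightarrow> slice list \<Rightarrow> slice list" where
  "rem r [] = []" | "rem r (h # t) = consif (normT h \<noteq> r) h (rem r t)"

text \<open>Once root \<open>r\<close> is settled, all slices equivalent to it are deleted, so later
  searches use a smaller table. The table being empty at the end proves that the roots represent all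
  classes.\<close>

fun runall :: "slice list \<Rightarrow> slice list \<Rightarrow> bool" where
  "runall [] tb = (tb = [])"
| "runall (r # rs) tb = (if runroot r tb then runall rs (rem r tb) else False)"

lemma set_rem: "set (rem r tb) = {h \<in> set tb. norm h \<noteq> r}"
proof (induction tb)
  case (Cons h tb) then show ?case by (cases "norm h \<noteq> r") (auto simp: normT_def)
qed simp

text \<open>All slices undergo the same relabelling of rows and columns, and the slice index is left
  alone; so the set of active slices does not change.\<close>

definition moved :: "('i \<Rightarrow> row \<Rightarrow> col \<Rightarrow> real) \<Rightarrow> ('i \<Rightarrow> row \<Rightarrow> col \<Rightarrow> real) \<Rightarrow> bool" where
  "moved Z Z' \<longleftrightarrow> (\<exists>\<rho> \<kappa>. bij \<rho> \<and> bij \<kappa> \<and> Z' = (\<lambda>i r k. Z i (\<rho> r) (\<kappa> k)))"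

lemma moved_refl: "moved Z Z"
  unfolding moved_def by (intro exI[of _ id]) simp

lemma moved_trans: "moved Z Z' \<Longrightarrow> moved Z' Z'' \<Longrightarrow> moved Z Z''"
proof -
  assume "moved Z Z'" "moved Z' Z''"
  then obtain \<rho> \<kappa> \<rho>' \<kappa>' where b: "bij \<rho>" "bij \<kappa>" "bij \<rho>'" "bij \<kappa>'" and Z': "Z' = (\<lambda>i r k. Z i (\<rho> r) (\<kappa> k))"
    and Z'': "Z'' = (\<lambda>i r k. Z' i (\<rho>' r) (\<kappa>' k))" unfolding moved_def by blast
  have "Z'' = (\<lambda>i r k. Z i ((\<rho> \<circ> \<rho>') r) ((\<kappa> \<circ> \<kappa>') k))" by (simp add: Z' Z'')
  then show ?thesis unfolding moved_def using bij_comp[OF b(3,1)] bij_comp[OF b(4,2)] by blast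
qed

lemma good_moved:
  assumes g: "good Z" and b: "bij \<rho>" "bij \<kappa>"
  shows "good (\<lambda>i r k. Z i (\<rho> r) (\<kappa> k))"
  unfolding good_def
proof (intro conjI allI impI)
  have sr: "(\<Sum>r\<in>UNIV. f (\<rho> r)) = (\<Sum>r\<in>UNIV. f r)" for f :: "row \<Rightarrow> real"
    by (rule sum.reindex_bij_betw[OF b(1)])
  have sk: "(\<Sum>k\<in>UNIV. f (\<kappa> k)) = (\<Sum>k\<in>UNIV. f k)" for f :: "col \<Rightarrow> real"
    by (rule sum.reindex_bij_betw[OF b(2)])
  fix i r k
  show "0 \<le> Z i (\<rho> r) (\<kappa> k)" "Z i (\<rho> r) (\<kappa> k) < 1" using goodD[OF g] by auto
  show "(\<Sum>k\<in>UNIV. Z i (\<rho> r) (\<kappa> k)) \<in> \<int>" using sk[of "Z i (\<rho> r)"] goodD(3)[OF g] by simp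
  show "(\<Sum>r\<in>UNIV. Z i (\<rho> r) (\<kappa> k)) \<in> \<int>" using sr[of "\<lambda>r. Z i r (\<kappa> k)"] goodD(4)[OF g] by simp
  show "(\<Sum>i\<in>UNIV. Z i (\<rho> r) (\<kappa> k)) \<in> \<int>" using goodD(5)[OF g] by simp
next
  fix U :: "'a \<Rightarrow> row \<Rightarrow> col \<Rightarrow> real" and i r k
  assume U: "\<forall>i r k. Z i (\<rho> r) (\<kappa> k) = 0 \<longrightarrow> U i r k = 0" "\<forall>i r. (\<Sum>k\<in>UNIV. U i r k) = 0"
    "\<forall>i k. (\<Sum>r\<in>UNIV. U i r k) = 0" "\<forall>r k. (\<Sum>i\<in>UNIV. U i r k) = 0"
  let ?r = "inv_into UNIV \<rho>" and ?k = "inv_into UNIV \<kappa>"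
  have ri: "\<rho> (?r r) = r" "?r (\<rho> r) = r" for r using b(1) by (simp_all add: bij_is_surj surj_f_inv_f bij_is_inj)
  have ki: "\<kappa> (?k k) = k" "?k (\<kappa> k) = k" for k using b(2) by (simp_all add: bij_is_surj surj_f_inv_f bij_is_inj)
  have "U i (?r (\<rho> r)) (?k (\<kappa> k)) = 0"
  proof (rule good_kernel[OF g, of "\<lambda>i r k. U i (?r r) (?k k)"])
    show "U i (?r r) (?k k) = 0" if "Z i r k = 0" for i r k using U(1) that ri ki by metis
    show "(\<Sum>k\<in>UNIV. U i (?r r) (?k k)) = 0" for i r
      using sum.reindex_bij_betw[OF bij_imp_bij_inv[OF b(2)], of "\<lambda>k. U i (?r r) k"] U(2) by simp
    show "(\<Sum>r\<in>UNIV. U i (?r r) (?k k)) = 0" for i k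
      using sum.reindex_bij_betw[OF bij_imp_bij_inv[OF b(1)], of "\<lambda>r. U i r (?k k)"] U(3) by simp
    show "(\<Sum>i\<in>UNIV. U i (?r r) (?k k)) = 0" for r k using U(4) by simp
  qed
  then show "U i r k = 0" by (simp add: ri ki)
next
  fix i j :: 'a and a a' :: row and x y :: col and \<epsilon> :: real
  assume e: "i \<noteq> j" "a \<noteq> a'" "x \<noteq> y" "0 < \<epsilon>" "\<epsilon> \<le> Z i (\<rho> a) (\<kappa> y)" "\<epsilon> \<le> Z i (\<rho> a') (\<kappa> x)"
    "\<epsilon> \<le> Z j (\<rho> a) (\<kappa> x)" "\<epsilon> \<le> Z j (\<rho> a') (\<kappa> y)"
  have "\<rho> a \<noteq> \<rho> a'" "\<kappa> x \<noteq> \<kappa> y" using e(2,3) b by (auto dest: bij_is_inj injD)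
  from good_cube[OF g e(1) this e(4-8)]
  show "Z i (\<rho> a) (\<kappa> x) + \<epsilon> < 1" "Z i (\<rho> a') (\<kappa> y) + \<epsilon> < 1" "Z j (\<rho> a) (\<kappa> y) + \<epsilon> < 1"
    "Z j (\<rho> a') (\<kappa> x) + \<epsilon> < 1" by auto
qed

lemma active_moved:
  assumes g: "good Z" and b: "bij \<rho>" "bij \<kappa>" shows "active (\<lambda>i r k. Z i (\<rho> r) (\<kappa> k)) = active Z"
proof -
  have "(\<exists>r k. 0 < Z i (\<rho> r) (\<kappa> k)) \<longleftrightarrow> (\<exists>r k. 0 < Z i r k)" for i
  proof
    assume "\<exists>r k. 0 < Z i r k"
    then obtain r k where "0 < Z i r k" by (elim exE)
    moreover obtain r' where "r = \<rho> r'" using bij_is_surj[OF b(1)] by (rule surjE)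
    moreover obtain k' where "k = \<kappa> k'" using bij_is_surj[OF b(2)] by (rule surjE)
    ultimately show "\<exists>r k. 0 < Z i (\<rho> r) (\<kappa> k)" by (intro exI[of _ r'] exI[of _ k']) simp
  next
    assume "\<exists>r k. 0 < Z i (\<rho> r) (\<kappa> k)"
    then obtain r k where "0 < Z i (\<rho> r) (\<kappa> k)" by (elim exE)
    then show "\<exists>r k. 0 < Z i r k" by (intro exI[of _ "\<rho> r"] exI[of _ "\<kappa> k"])
  qed
  then show ?thesis unfolding active_def[OF g] active_def[OF good_moved[OF g b]] by (rule Collect_cong)
qed

lemma support_swap:
  "support y x z = sw01 (support x y z)" "support x z y = sw12 (support x y z)"
  by (cases x; cases y; cases z; simp)+

lemma gens_moved:
  assumes "f \<in> gens"
  obtains \<rho> \<kappa> where "bij \<rho>" "bij \<kappa>" "\<And>X. supp (\<lambda>r k. X (\<rho> r) (\<kappa> k)) = f (supp X)"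
proof -
  have B: "bij p" if "p \<circ> p = id" for p :: "'b \<Rightarrow> 'b" using that by (rule o_bij) (rule that)
  let ?r01 = "\<lambda>r. case r of R0 \<Rightarrow> R1 | R1 \<Rightarrow> R0 | R2 \<Rightarrow> R2 | R3 \<Rightarrow> R3"
  let ?r12 = "\<lambda>r. case r of R0 \<Rightarrow> R0 | R1 \<Rightarrow> R2 | R2 \<Rightarrow> R1 | R3 \<Rightarrow> R3"
  let ?r23 = "\<lambda>r. case r of R0 \<Rightarrow> R0 | R1 \<Rightarrow> R1 | R2 \<Rightarrow> R3 | R3 \<Rightarrow> R2"
  let ?k01 = "\<lambda>k. case k of K0 \<Rightarrow> K1 | K1 \<Rightarrow> K0 | K2 \<Rightarrow> K2"
  let ?k12 = "\<lambda>k. case k of K0 \<Rightarrow> K0 | K1 \<Rightarrow> K2 | K2 \<Rightarrow> K1"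
  have b: "bij ?r01" "bij ?r12" "bij ?r23" "bij ?k01" "bij ?k12" "bij (id :: row \<Rightarrow> row)" "bij (id :: col \<Rightarrow> col)"
    by (rule B, rule ext, simp split: row.splits col.splits)+
  consider "f = row01" | "f = row12" | "f = row23" | "f = map_slice sw01" | "f = map_slice sw12"
    using assms by (auto simp: gens_def)
  then show thesis
  proof cases
    case 1 show ?thesis by (rule that[OF b(1,7)]) (simp add: 1 supp_def)
  next
    case 2 show ?thesis by (rule that[OF b(2,7)]) (simp add: 2 supp_def)
  next
    case 3 show ?thesis by (rule that[OF b(3,7)]) (simp add: 3 supp_def)
  next
    case 4 show ?thesis by (rule that[OF b(6,4)]) (simp add: 4 supp_def support_swap(1)[symmetric])
  next
    case 5 show ?thesis by (rule that[OF b(6,5)]) (simp add: 5 supp_def support_swap(2)[symmetric])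
  qed
qed

lemma reach_moved:
  assumes "good Z" "set W \<subseteq> gens"
  shows "\<exists>Z'. moved Z Z' \<and> good Z' \<and> active Z' = active Z \<and>
    (\<forall>i. supp (Z' i) = fold (\<lambda>f x. f x) W (supp (Z i)) \<and> norm (supp (Z' i)) = norm (supp (Z i)))"
  using assms
proof (induction W arbitrary: Z)
  case Nil then show ?case using moved_refl by (intro exI[of _ Z]) simp
next
  case (Cons f W)
  obtain \<rho> \<kappa> where m: "bij \<rho>" "bij \<kappa>" "\<And>X. supp (\<lambda>r k. X (\<rho> r) (\<kappa> k)) = f (supp X)"
    using gens_moved[of f] Cons.prems(2) by auto
  let ?Z = "\<lambda>i r k. Z i (\<rho> r) (\<kappa> k)"
  have 1: "moved Z ?Z" using m(1,2) unfolding moved_def by blast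
  have s: "supp (?Z i) = f (supp (Z i))" for i by (rule m(3))
  obtain Z' where Z': "moved ?Z Z'" "good Z'" "active Z' = active ?Z"
    "\<forall>i. supp (Z' i) = fold (\<lambda>f x. f x) W (supp (?Z i)) \<and> norm (supp (Z' i)) = norm (supp (?Z i))"
    using Cons.IH[OF good_moved[OF Cons.prems(1) m(1,2)]] Cons.prems(2) by auto
  have n: "norm (f h) = norm h" for h using norm_gens[of f h] Cons.prems(2) by simp
  have "supp (Z' i) = fold (\<lambda>f x. f x) W (f (supp (Z i)))" "norm (supp (Z' i)) = norm (supp (Z i))" for i
    using Z'(4) n by (metis s)+
  then show ?case
    using moved_trans[OF 1 Z'(1)] Z'(2,3) active_moved[OF Cons.prems(1) m(1,2)] by (intro exI[of _ Z']) simp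
qed

lemma valid_supp:
  assumes g: "good Z" and i: "i \<in> active Z" shows "valid (supp (Z i))"
proof -
  let ?h = "supp (Z i)"
  have "\<exists>r'. r' \<noteq> r \<and> 0 < Z i r' k" if "0 < Z i r k" for r k
    using line_one[of UNIV "\<lambda>r. Z i r k" r] goodD[OF g] that by auto
  then have *: "\<exists>r'. r' \<noteq> r \<and> has k (rowof r' ?h)" if "has k (rowof r ?h)" for r k
    using that by (simp add: has_supp[OF g])
  obtain a b c d where h: "?h = Sl a b c d" by (cases ?h)
  have "count_col k ?h \<noteq> 1" for k
  proof -
    have "has k a \<Longrightarrow> has k b \<or> has k c \<or> has k d" "has k b \<Longrightarrow> has k a \<or> has k c \<or> has k d"
      "has k c \<Longrightarrow> has k a \<or> has k b \<or> has k d" "has k d \<Longrightarrow> has k a \<or> has k b \<or> has k c"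
      using *[of k R0] *[of k R1] *[of k R2] *[of k R3] unfolding h
      by (auto, (metis row.exhaust rowof.simps)+)
    then show ?thesis by (auto simp: h)
  qed
  moreover obtain r k where "0 < Z i r k" using i by (auto simp: active_def[OF g])
  then have "has k (rowof r ?h)" by (simp add: has_supp[OF g])
  then have "?h \<noteq> Sl Em Em Em Em" by (cases r; cases k) auto
  ultimately show ?thesis by (simp add: valid_def)
qed

text \<open>\<open>A\<close> contains the normal forms not yet excluded. If some active slice has
  normal form \<open>r\<close>, the table is relabelled until this slice equals \<open>r\<close>,
  and \<open>runroot\<close> applies; otherwise \<open>r\<close> is removed from
  \<open>A\<close>.\<close>

lemma runall_sound:
  assumes "runall rs tb" "set tb = {h. valid h \<and> norm h \<in> A}" "good Z" "active Z \<noteq> {}"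
    "\<forall>j\<in>active Z. norm (supp (Z j)) \<in> A"
  shows "\<exists>Z'. moved Z Z' \<and> good Z' \<and> found Z'"
  using assms
proof (induction rs tb arbitrary: A rule: runall.induct)
  case (1 tb)
  then obtain j where "j \<in> active Z" by blast
  then have "supp (Z j) \<in> set tb" using 1 valid_supp[OF 1(3)] by auto
  with 1(1) show ?case by simp
next
  case (2 r rs tb)
  from 2(2) have r: "runroot r tb" "runall rs (rem r tb)" by (auto split: if_splits)
  show ?case
  proof (cases "\<exists>j\<in>active Z. norm (supp (Z j)) = r")
    case True
    then obtain j where j: "j \<in> active Z" "norm (supp (Z j)) = r" by blast
    obtain W where W: "set W \<subseteq> gens" "r = fold (\<lambda>f x. f x) W (supp (Z j))"
      using reach_norm[of "supp (Z j)"] j(2) unfolding reach_def by blast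
    obtain Z' where Z': "moved Z Z'" "good Z'" "active Z' = active Z" "\<forall>i. supp (Z' i) = fold (\<lambda>f x. f x) W (supp (Z i))"
      "\<forall>i. norm (supp (Z' i)) = norm (supp (Z i))" using reach_moved[OF 2(4) W(1)] by blast
    have "supp (Z' j) = r" using Z'(4) W(2) by simp
    moreover have "\<forall>l\<in>active Z'. supp (Z' l) \<in> set tb"
      using 2(3,6) Z'(3,5) valid_supp[OF Z'(2)] by auto
    ultimately have "found Z'" using runroot_sound[OF Z'(2), of j tb] r(1) j(1) Z'(3) by simp
    with Z' show ?thesis by blast
  next
    case False
    have "set (rem r tb) = {h. valid h \<and> norm h \<in> A - {r}}" using 2(3) by (auto simp: set_rem)
    moreover have "\<forall>j\<in>active Z. norm (supp (Z j)) \<in> A - {r}" using 2(6) False by auto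
    ultimately show ?thesis using 2(1)[OF r(1,2) _ 2(4,5)] by blast
  qed
qed

section \<open>Evaluation of the search\<close>

text \<open>Normal forms in order of decreasing dimension, from 6 down to 1. The 4-cycle and the
  6-cycle come last, when only one-dimensional slices are left in the table.\<close>

definition roots :: "slice list" where
  "roots = [Sl Fu Fu Fu Fu, Sl Fu Fu Fu Mi2, Sl Fu Fu Fu Em, Sl Fu Fu Mi2 Mi2, Sl Fu Fu Mi2 Mi1,
  Sl Mi2 Mi2 Mi2 Mi2, Sl Fu Fu Mi2 Em, Sl Fu Mi2 Mi2 Mi1, Sl Fu Mi2 Mi1 Mi0, Sl Mi2 Mi2 Mi2 Em, Sl Fu Fu Em Em,
  Sl Fu Mi2 Mi1 Em, Sl Mi2 Mi2 Mi1 Mi1, Sl Mi2 Mi2 Mi1 Mi0, Sl Mi2 Mi2 Em Em, Sl Mi2 Mi1 Mi0 Em]"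

definition tab :: "slice list" where "tab = filter valid slices_all"

lemma prod_app: "(case (a, b) of (x, y) \<Rightarrow> f x y) = f a b" by simp
lemma let_app: "Let x f = f x" by simp
lemma filter_if: "filter P [] = []" "filter P (x # xs) = (if P x then x # filter P xs else filter P xs)" by simp_all
lemma if_and: "(P \<and> Q) = (if P then Q else False)" by simp

lemmas eval_logic = if_True if_False simp_thms not_True_eq_False not_False_eq_True prod_app let_app option.case
lemmas eval_data = rsupp.distinct slice.inject row.distinct col.distinct list.inject list.distinct prod.inject option.distinct option.inject
  nat.inject nat.distinct
lemmas eval_list = append.simps nth_Cons_0 nth_Cons_Suc list.map concat.simps rotate1.simps list.pred_inject filter_if
lemmas eval_num = arith_simps rel_simps num.inject num.distinct Num.inc.simps Num.BitM.simps
  sub_num_simps diff_numeral_simps diff_numeral_special add_numeral_special mult_1_left mult_1_right mult_zero_left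
  mult_zero_right mult_minus1 mult_minus1_right minus_minus diff_0 diff_0_right neg_equal_iff_equal minus_zero add_0 add_0_right
  numeral_One neg_0_equal_iff_equal neg_equal_0_iff_equal zero_neq_one one_neq_zero

lemma tables: "list_all (\<lambda>h. (((basisT h = basis h \<and> consT h = cons h) \<and> normT h = norm h) \<and> dimT h = size_of (basis h))) tab"
  by (simp add: list_all_iff basisT_def consT_def normT_def dimT_def)

lemma tab_eval: "tab = [Sl Em Em Mi0 Mi0, Sl Em Em Mi1 Mi1, Sl Em Em Mi2 Mi2, Sl Em Em Fu Fu, Sl Em Mi0 Em Mi0, Sl Em Mi0 Mi0 Em,
   Sl Em Mi0 Mi0 Mi0, Sl Em Mi0 Mi1 Mi2, Sl Em Mi0 Mi1 Fu, Sl Em Mi0 Mi2 Mi1, Sl Em Mi0 Mi2 Fu, Sl Em Mi0 Fu Mi1,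
   Sl Em Mi0 Fu Mi2, Sl Em Mi0 Fu Fu, Sl Em Mi1 Em Mi1, Sl Em Mi1 Mi0 Mi2, Sl Em Mi1 Mi0 Fu, Sl Em Mi1 Mi1 Em,
   Sl Em Mi1 Mi1 Mi1, Sl Em Mi1 Mi2 Mi0, Sl Em Mi1 Mi2 Fu, Sl Em Mi1 Fu Mi0, Sl Em Mi1 Fu Mi2, Sl Em Mi1 Fu Fu,
   Sl Em Mi2 Em Mi2, Sl Em Mi2 Mi0 Mi1, Sl Em Mi2 Mi0 Fu, Sl Em Mi2 Mi1 Mi0, Sl Em Mi2 Mi1 Fu, Sl Em Mi2 Mi2 Em,
   Sl Em Mi2 Mi2 Mi2, Sl Em Mi2 Fu Mi0, Sl Em Mi2 Fu Mi1, Sl Em Mi2 Fu Fu, Sl Em Fu Em Fu, Sl Em Fu Mi0 Mi1,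
   Sl Em Fu Mi0 Mi2, Sl Em Fu Mi0 Fu, Sl Em Fu Mi1 Mi0, Sl Em Fu Mi1 Mi2, Sl Em Fu Mi1 Fu, Sl Em Fu Mi2 Mi0,
   Sl Em Fu Mi2 Mi1, Sl Em Fu Mi2 Fu, Sl Em Fu Fu Em, Sl Em Fu Fu Mi0, Sl Em Fu Fu Mi1, Sl Em Fu Fu Mi2,
   Sl Em Fu Fu Fu, Sl Mi0 Em Em Mi0, Sl Mi0 Em Mi0 Em, Sl Mi0 Em Mi0 Mi0, Sl Mi0 Em Mi1 Mi2, Sl Mi0 Em Mi1 Fu,
   Sl Mi0 Em Mi2 Mi1, Sl Mi0 Em Mi2 Fu, Sl Mi0 Em Fu Mi1, Sl Mi0 Em Fu Mi2, Sl Mi0 Em Fu Fu, Sl Mi0 Mi0 Em Em,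
   Sl Mi0 Mi0 Em Mi0, Sl Mi0 Mi0 Mi0 Em, Sl Mi0 Mi0 Mi0 Mi0, Sl Mi0 Mi0 Mi1 Mi1, Sl Mi0 Mi0 Mi1 Mi2, Sl Mi0 Mi0 Mi1 Fu,
   Sl Mi0 Mi0 Mi2 Mi1, Sl Mi0 Mi0 Mi2 Mi2, Sl Mi0 Mi0 Mi2 Fu, Sl Mi0 Mi0 Fu Mi1, Sl Mi0 Mi0 Fu Mi2, Sl Mi0 Mi0 Fu Fu,
   Sl Mi0 Mi1 Em Mi2, Sl Mi0 Mi1 Em Fu, Sl Mi0 Mi1 Mi0 Mi1, Sl Mi0 Mi1 Mi0 Mi2, Sl Mi0 Mi1 Mi0 Fu, Sl Mi0 Mi1 Mi1 Mi0,
   Sl Mi0 Mi1 Mi1 Mi2, Sl Mi0 Mi1 Mi1 Fu, Sl Mi0 Mi1 Mi2 Em, Sl Mi0 Mi1 Mi2 Mi0, Sl Mi0 Mi1 Mi2 Mi1,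
   Sl Mi0 Mi1 Mi2 Mi2, Sl Mi0 Mi1 Mi2 Fu, Sl Mi0 Mi1 Fu Em, Sl Mi0 Mi1 Fu Mi0, Sl Mi0 Mi1 Fu Mi1, Sl Mi0 Mi1 Fu Mi2,
   Sl Mi0 Mi1 Fu Fu, Sl Mi0 Mi2 Em Mi1, Sl Mi0 Mi2 Em Fu, Sl Mi0 Mi2 Mi0 Mi1, Sl Mi0 Mi2 Mi0 Mi2, Sl Mi0 Mi2 Mi0 Fu,
   Sl Mi0 Mi2 Mi1 Em, Sl Mi0 Mi2 Mi1 Mi0, Sl Mi0 Mi2 Mi1 Mi1, Sl Mi0 Mi2 Mi1 Mi2, Sl Mi0 Mi2 Mi1 Fu,
   Sl Mi0 Mi2 Mi2 Mi0, Sl Mi0 Mi2 Mi2 Mi1, Sl Mi0 Mi2 Mi2 Fu, Sl Mi0 Mi2 Fu Em, Sl Mi0 Mi2 Fu Mi0, Sl Mi0 Mi2 Fu Mi1,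
   Sl Mi0 Mi2 Fu Mi2, Sl Mi0 Mi2 Fu Fu, Sl Mi0 Fu Em Mi1, Sl Mi0 Fu Em Mi2, Sl Mi0 Fu Em Fu, Sl Mi0 Fu Mi0 Mi1,
   Sl Mi0 Fu Mi0 Mi2, Sl Mi0 Fu Mi0 Fu, Sl Mi0 Fu Mi1 Em, Sl Mi0 Fu Mi1 Mi0, Sl Mi0 Fu Mi1 Mi1, Sl Mi0 Fu Mi1 Mi2,
   Sl Mi0 Fu Mi1 Fu, Sl Mi0 Fu Mi2 Em, Sl Mi0 Fu Mi2 Mi0, Sl Mi0 Fu Mi2 Mi1, Sl Mi0 Fu Mi2 Mi2, Sl Mi0 Fu Mi2 Fu,
   Sl Mi0 Fu Fu Em, Sl Mi0 Fu Fu Mi0, Sl Mi0 Fu Fu Mi1, Sl Mi0 Fu Fu Mi2, Sl Mi0 Fu Fu Fu, Sl Mi1 Em Em Mi1,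
   Sl Mi1 Em Mi0 Mi2, Sl Mi1 Em Mi0 Fu, Sl Mi1 Em Mi1 Em, Sl Mi1 Em Mi1 Mi1, Sl Mi1 Em Mi2 Mi0, Sl Mi1 Em Mi2 Fu,
   Sl Mi1 Em Fu Mi0, Sl Mi1 Em Fu Mi2, Sl Mi1 Em Fu Fu, Sl Mi1 Mi0 Em Mi2, Sl Mi1 Mi0 Em Fu, Sl Mi1 Mi0 Mi0 Mi1,
   Sl Mi1 Mi0 Mi0 Mi2, Sl Mi1 Mi0 Mi0 Fu, Sl Mi1 Mi0 Mi1 Mi0, Sl Mi1 Mi0 Mi1 Mi2, Sl Mi1 Mi0 Mi1 Fu, Sl Mi1 Mi0 Mi2 Em,
   Sl Mi1 Mi0 Mi2 Mi0, Sl Mi1 Mi0 Mi2 Mi1, Sl Mi1 Mi0 Mi2 Mi2, Sl Mi1 Mi0 Mi2 Fu, Sl Mi1 Mi0 Fu Em, Sl Mi1 Mi0 Fu Mi0,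
   Sl Mi1 Mi0 Fu Mi1, Sl Mi1 Mi0 Fu Mi2, Sl Mi1 Mi0 Fu Fu, Sl Mi1 Mi1 Em Em, Sl Mi1 Mi1 Em Mi1, Sl Mi1 Mi1 Mi0 Mi0,
   Sl Mi1 Mi1 Mi0 Mi2, Sl Mi1 Mi1 Mi0 Fu, Sl Mi1 Mi1 Mi1 Em, Sl Mi1 Mi1 Mi1 Mi1, Sl Mi1 Mi1 Mi2 Mi0,
   Sl Mi1 Mi1 Mi2 Mi2, Sl Mi1 Mi1 Mi2 Fu, Sl Mi1 Mi1 Fu Mi0, Sl Mi1 Mi1 Fu Mi2, Sl Mi1 Mi1 Fu Fu, Sl Mi1 Mi2 Em Mi0,
   Sl Mi1 Mi2 Em Fu, Sl Mi1 Mi2 Mi0 Em, Sl Mi1 Mi2 Mi0 Mi0, Sl Mi1 Mi2 Mi0 Mi1, Sl Mi1 Mi2 Mi0 Mi2, Sl Mi1 Mi2 Mi0 Fu,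
   Sl Mi1 Mi2 Mi1 Mi0, Sl Mi1 Mi2 Mi1 Mi2, Sl Mi1 Mi2 Mi1 Fu, Sl Mi1 Mi2 Mi2 Mi0, Sl Mi1 Mi2 Mi2 Mi1,
   Sl Mi1 Mi2 Mi2 Fu, Sl Mi1 Mi2 Fu Em, Sl Mi1 Mi2 Fu Mi0, Sl Mi1 Mi2 Fu Mi1, Sl Mi1 Mi2 Fu Mi2, Sl Mi1 Mi2 Fu Fu,
   Sl Mi1 Fu Em Mi0, Sl Mi1 Fu Em Mi2, Sl Mi1 Fu Em Fu, Sl Mi1 Fu Mi0 Em, Sl Mi1 Fu Mi0 Mi0, Sl Mi1 Fu Mi0 Mi1,
   Sl Mi1 Fu Mi0 Mi2, Sl Mi1 Fu Mi0 Fu, Sl Mi1 Fu Mi1 Mi0, Sl Mi1 Fu Mi1 Mi2, Sl Mi1 Fu Mi1 Fu, Sl Mi1 Fu Mi2 Em,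
   Sl Mi1 Fu Mi2 Mi0, Sl Mi1 Fu Mi2 Mi1, Sl Mi1 Fu Mi2 Mi2, Sl Mi1 Fu Mi2 Fu, Sl Mi1 Fu Fu Em, Sl Mi1 Fu Fu Mi0,
   Sl Mi1 Fu Fu Mi1, Sl Mi1 Fu Fu Mi2, Sl Mi1 Fu Fu Fu, Sl Mi2 Em Em Mi2, Sl Mi2 Em Mi0 Mi1, Sl Mi2 Em Mi0 Fu,
   Sl Mi2 Em Mi1 Mi0, Sl Mi2 Em Mi1 Fu, Sl Mi2 Em Mi2 Em, Sl Mi2 Em Mi2 Mi2, Sl Mi2 Em Fu Mi0, Sl Mi2 Em Fu Mi1,
   Sl Mi2 Em Fu Fu, Sl Mi2 Mi0 Em Mi1, Sl Mi2 Mi0 Em Fu, Sl Mi2 Mi0 Mi0 Mi1, Sl Mi2 Mi0 Mi0 Mi2, Sl Mi2 Mi0 Mi0 Fu,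
   Sl Mi2 Mi0 Mi1 Em, Sl Mi2 Mi0 Mi1 Mi0, Sl Mi2 Mi0 Mi1 Mi1, Sl Mi2 Mi0 Mi1 Mi2, Sl Mi2 Mi0 Mi1 Fu,
   Sl Mi2 Mi0 Mi2 Mi0, Sl Mi2 Mi0 Mi2 Mi1, Sl Mi2 Mi0 Mi2 Fu, Sl Mi2 Mi0 Fu Em, Sl Mi2 Mi0 Fu Mi0, Sl Mi2 Mi0 Fu Mi1,
   Sl Mi2 Mi0 Fu Mi2, Sl Mi2 Mi0 Fu Fu, Sl Mi2 Mi1 Em Mi0, Sl Mi2 Mi1 Em Fu, Sl Mi2 Mi1 Mi0 Em, Sl Mi2 Mi1 Mi0 Mi0,
   Sl Mi2 Mi1 Mi0 Mi1, Sl Mi2 Mi1 Mi0 Mi2, Sl Mi2 Mi1 Mi0 Fu, Sl Mi2 Mi1 Mi1 Mi0, Sl Mi2 Mi1 Mi1 Mi2,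
   Sl Mi2 Mi1 Mi1 Fu, Sl Mi2 Mi1 Mi2 Mi0, Sl Mi2 Mi1 Mi2 Mi1, Sl Mi2 Mi1 Mi2 Fu, Sl Mi2 Mi1 Fu Em, Sl Mi2 Mi1 Fu Mi0,
   Sl Mi2 Mi1 Fu Mi1, Sl Mi2 Mi1 Fu Mi2, Sl Mi2 Mi1 Fu Fu, Sl Mi2 Mi2 Em Em, Sl Mi2 Mi2 Em Mi2, Sl Mi2 Mi2 Mi0 Mi0,
   Sl Mi2 Mi2 Mi0 Mi1, Sl Mi2 Mi2 Mi0 Fu, Sl Mi2 Mi2 Mi1 Mi0, Sl Mi2 Mi2 Mi1 Mi1, Sl Mi2 Mi2 Mi1 Fu, Sl Mi2 Mi2 Mi2 Em,
   Sl Mi2 Mi2 Mi2 Mi2, Sl Mi2 Mi2 Fu Mi0, Sl Mi2 Mi2 Fu Mi1, Sl Mi2 Mi2 Fu Fu, Sl Mi2 Fu Em Mi0, Sl Mi2 Fu Em Mi1,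
   Sl Mi2 Fu Em Fu, Sl Mi2 Fu Mi0 Em, Sl Mi2 Fu Mi0 Mi0, Sl Mi2 Fu Mi0 Mi1, Sl Mi2 Fu Mi0 Mi2, Sl Mi2 Fu Mi0 Fu,
   Sl Mi2 Fu Mi1 Em, Sl Mi2 Fu Mi1 Mi0, Sl Mi2 Fu Mi1 Mi1, Sl Mi2 Fu Mi1 Mi2, Sl Mi2 Fu Mi1 Fu, Sl Mi2 Fu Mi2 Mi0,
   Sl Mi2 Fu Mi2 Mi1, Sl Mi2 Fu Mi2 Fu, Sl Mi2 Fu Fu Em, Sl Mi2 Fu Fu Mi0, Sl Mi2 Fu Fu Mi1, Sl Mi2 Fu Fu Mi2,
   Sl Mi2 Fu Fu Fu, Sl Fu Em Em Fu, Sl Fu Em Mi0 Mi1, Sl Fu Em Mi0 Mi2, Sl Fu Em Mi0 Fu, Sl Fu Em Mi1 Mi0,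
   Sl Fu Em Mi1 Mi2, Sl Fu Em Mi1 Fu, Sl Fu Em Mi2 Mi0, Sl Fu Em Mi2 Mi1, Sl Fu Em Mi2 Fu, Sl Fu Em Fu Em,
   Sl Fu Em Fu Mi0, Sl Fu Em Fu Mi1, Sl Fu Em Fu Mi2, Sl Fu Em Fu Fu, Sl Fu Mi0 Em Mi1, Sl Fu Mi0 Em Mi2,
   Sl Fu Mi0 Em Fu, Sl Fu Mi0 Mi0 Mi1, Sl Fu Mi0 Mi0 Mi2, Sl Fu Mi0 Mi0 Fu, Sl Fu Mi0 Mi1 Em, Sl Fu Mi0 Mi1 Mi0,
   Sl Fu Mi0 Mi1 Mi1, Sl Fu Mi0 Mi1 Mi2, Sl Fu Mi0 Mi1 Fu, Sl Fu Mi0 Mi2 Em, Sl Fu Mi0 Mi2 Mi0, Sl Fu Mi0 Mi2 Mi1,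
   Sl Fu Mi0 Mi2 Mi2, Sl Fu Mi0 Mi2 Fu, Sl Fu Mi0 Fu Em, Sl Fu Mi0 Fu Mi0, Sl Fu Mi0 Fu Mi1, Sl Fu Mi0 Fu Mi2,
   Sl Fu Mi0 Fu Fu, Sl Fu Mi1 Em Mi0, Sl Fu Mi1 Em Mi2, Sl Fu Mi1 Em Fu, Sl Fu Mi1 Mi0 Em, Sl Fu Mi1 Mi0 Mi0,
   Sl Fu Mi1 Mi0 Mi1, Sl Fu Mi1 Mi0 Mi2, Sl Fu Mi1 Mi0 Fu, Sl Fu Mi1 Mi1 Mi0, Sl Fu Mi1 Mi1 Mi2, Sl Fu Mi1 Mi1 Fu,
   Sl Fu Mi1 Mi2 Em, Sl Fu Mi1 Mi2 Mi0, Sl Fu Mi1 Mi2 Mi1, Sl Fu Mi1 Mi2 Mi2, Sl Fu Mi1 Mi2 Fu, Sl Fu Mi1 Fu Em,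
   Sl Fu Mi1 Fu Mi0, Sl Fu Mi1 Fu Mi1, Sl Fu Mi1 Fu Mi2, Sl Fu Mi1 Fu Fu, Sl Fu Mi2 Em Mi0, Sl Fu Mi2 Em Mi1,
   Sl Fu Mi2 Em Fu, Sl Fu Mi2 Mi0 Em, Sl Fu Mi2 Mi0 Mi0, Sl Fu Mi2 Mi0 Mi1, Sl Fu Mi2 Mi0 Mi2, Sl Fu Mi2 Mi0 Fu,
   Sl Fu Mi2 Mi1 Em, Sl Fu Mi2 Mi1 Mi0, Sl Fu Mi2 Mi1 Mi1, Sl Fu Mi2 Mi1 Mi2, Sl Fu Mi2 Mi1 Fu, Sl Fu Mi2 Mi2 Mi0,
   Sl Fu Mi2 Mi2 Mi1, Sl Fu Mi2 Mi2 Fu, Sl Fu Mi2 Fu Em, Sl Fu Mi2 Fu Mi0, Sl Fu Mi2 Fu Mi1, Sl Fu Mi2 Fu Mi2,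
   Sl Fu Mi2 Fu Fu, Sl Fu Fu Em Em, Sl Fu Fu Em Mi0, Sl Fu Fu Em Mi1, Sl Fu Fu Em Mi2, Sl Fu Fu Em Fu, Sl Fu Fu Mi0 Em,
   Sl Fu Fu Mi0 Mi0, Sl Fu Fu Mi0 Mi1, Sl Fu Fu Mi0 Mi2, Sl Fu Fu Mi0 Fu, Sl Fu Fu Mi1 Em, Sl Fu Fu Mi1 Mi0,
   Sl Fu Fu Mi1 Mi1, Sl Fu Fu Mi1 Mi2, Sl Fu Fu Mi1 Fu, Sl Fu Fu Mi2 Em, Sl Fu Fu Mi2 Mi0, Sl Fu Fu Mi2 Mi1,
   Sl Fu Fu Mi2 Mi2, Sl Fu Fu Mi2 Fu, Sl Fu Fu Fu Em, Sl Fu Fu Fu Mi0, Sl Fu Fu Fu Mi1, Sl Fu Fu Fu Mi2,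
   Sl Fu Fu Fu Fu]"
  by code_simp

lemma drop_2: "drop 2 (x # y # z) = z" by (simp add: numeral_2_eq_2)
schematic_goal cubes_eval: "cubes = ?c"
  by (simp only: cubes_def list.map prod_app concat.simps append.simps)
lemmas basis_eval = basis_def pick.simps pvs.simps pv.simps vec8.simps red_unit_def lincomb.simps drop_2 size_of.simps
lemmas cons_eval = cons_def cubes_eval live.simps esc_def has.simps rowof.simps
lemmas norm_eval = norm_def try_col01_def try_col12_def try01.simps try12.simps try23.simps row01.simps row12.simps row23.simps map_slice.simps sw01.simps sw12.simps
   occ.simps rank.simps one_less_numeral_iff zero_less_numeral zero_less_one not_one_less_zero not_numeral_less_zero not_numeral_less_one numeral_less_iff less_irrefl rel_simps Suc_less_eq zero_less_Suc not_less0 list.size add_0 add_Suc_right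


\<comment> \<open>Only the right-hand sides are computed, since \<open>basisT\<close>,
  \<open>consT\<close>, \<open>normT\<close> and \<open>dimT\<close> stay folded. The result is a
  conjunction of equations, one group per slice, that serves as the lookup table of the
  search.\<close>
schematic_goal tables_eval: "list_all (\<lambda>h. (((basisT h = basis h \<and> consT h = cons h) \<and> normT h = norm h) \<and> dimT h = size_of (basis h))) tab = ?P"
  by (simp only: tab_eval basis_eval cons_eval norm_eval eval_num
   eval_logic eval_data eval_list cong: if_weak_cong option.case_cong_weak)

lemmas tables_rules = tables[unfolded tables_eval]

lemma runall_roots: "runall roots tab"
  by (simp only: tab_eval roots_def runall.simps runroot_def rem.simps tables_rules six_def empty_counts_def the_ech.simps
    dfs.simps dsp.simps loop.simps step.simps cat.simps leaf_def le.simps sb.simps consif.simps adm_def filt.simps fl.simps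
    inC.simps outC.simps has.simps rowof.simps esc_def chk1.simps chk.simps inc.simps upr.simps upd.simps once.simps
    once_row.simps first_once.simps lincomb.simps red.simps red_full_def reds.simps adds.simps unit_index.simps
    nonzero_index.simps piv_def rotg.simps rgood.simps prim_def orelse.simps divl.simps ocons.simps quo.simps
    kill2_def kill3_def exl.simps stuck.simps feas.simps esc_line_def anyline.simps picks.simps less_cells.simps
    same_value.simps if_and V1_def V2_def sub.simps isin.simps cubes_eval
    eval_logic eval_data eval_list eval_num cong: if_weak_cong option.case_cong_weak)

section \<open>The half-integral table and its recognition from the support\<close>

datatype idx = I0 | I1 | I2 | I3 | I4 | I5

lemma UNIV_idx: "UNIV = {I0, I1, I2, I3, I4, I5}" using idx.exhaust by auto

instance idx :: finite by standard (simp add: UNIV_idx)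

lemma sum_idx: "(\<Sum>i\<in>UNIV. f i) = f I0 + f I1 + f I2 + f I3 + f I4 + (f I5 :: 'a :: comm_monoid_add)"
  by (simp add: UNIV_idx add.assoc)

fun pattern :: "idx \<Rightarrow> slice" where
  "pattern I0 = Sl Mi2 Em Em Mi2" | "pattern I1 = Sl Em Mi2 Mi2 Em" | "pattern I2 = Sl Mi1 Mi1 Em Em"
| "pattern I3 = Sl Em Em Mi1 Mi1" | "pattern I4 = Sl Mi0 Em Mi0 Em" | "pattern I5 = Sl Em Mi0 Em Mi0"

definition halves :: "idx \<Rightarrow> row \<Rightarrow> col \<Rightarrow> real" where
  "halves i r k = (if has k (rowof r (pattern i)) then 1/2 else 0)"

lemma halves_sums:
  "(\<Sum>k\<in>UNIV. halves i r k) = (if rowof r (pattern i) = Em then 0 else 1)"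
  "(\<Sum>r\<in>UNIV. halves i r k) = (if list_ex (\<lambda>r. has k (rowof r (pattern i))) [R0, R1, R2, R3] then 1 else 0)"
  "(\<Sum>i\<in>UNIV. halves i r k) = 1"
proof -
  show "(\<Sum>k\<in>UNIV. halves i r k) = (if rowof r (pattern i) = Em then 0 else 1)"
    by (cases i; cases r; simp add: halves_def sum_col)
  show "(\<Sum>r\<in>UNIV. halves i r k) = (if list_ex (\<lambda>r. has k (rowof r (pattern i))) [R0, R1, R2, R3] then 1 else 0)"
    by (cases i; cases k; simp add: halves_def sum_row)
  show "(\<Sum>i\<in>UNIV. halves i r k) = 1"
    by (cases r; cases k; simp add: halves_def sum_idx)
qed

text \<open>Every line has at most two cells in the support, so neighbouring cells carry opposite
  values and all entries are plus or minus \<open>U I0 R0 K0\<close>.\<close>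

lemma halves_kernel:
  fixes U :: "idx \<Rightarrow> row \<Rightarrow> col \<Rightarrow> real"
  assumes "\<And>i r k. halves i r k = 0 \<Longrightarrow> U i r k = 0" "\<And>i r. (\<Sum>k\<in>UNIV. U i r k) = 0"
    "\<And>i k. (\<Sum>r\<in>UNIV. U i r k) = 0" "\<And>r k. (\<Sum>i\<in>UNIV. U i r k) = 0"
  shows "U i r k = 0"
proof -
  have z: "U i r k = 0" if "\<not> has k (rowof r (pattern i))" for i r k
    using assms(1)[of i r k] that by (simp add: halves_def)
  note R = assms(2)[unfolded sum_col] and C = assms(3)[unfolded sum_row] and S = assms(4)[unfolded sum_idx]
  have t: "U I0 R0 K1 = - U I0 R0 K0" "U I0 R3 K0 = - U I0 R0 K0" "U I0 R3 K1 = - U I0 R0 K1" "U I2 R0 K0 = - U I0 R0 K0"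
    "U I4 R0 K1 = - U I0 R0 K1" "U I3 R3 K0 = - U I0 R3 K0" "U I5 R3 K1 = - U I0 R3 K1" "U I2 R0 K2 = - U I2 R0 K0"
    "U I2 R1 K0 = - U I2 R0 K0" "U I2 R1 K2 = - U I2 R0 K2" "U I3 R3 K2 = - U I3 R3 K0" "U I3 R2 K0 = - U I3 R3 K0"
    "U I3 R2 K2 = - U I3 R3 K2" "U I4 R0 K2 = - U I4 R0 K1" "U I4 R2 K1 = - U I4 R0 K1" "U I4 R2 K2 = - U I4 R0 K2"
    "U I5 R3 K2 = - U I5 R3 K1" "U I5 R1 K1 = - U I5 R3 K1" "U I5 R1 K2 = - U I5 R3 K2" "U I1 R1 K0 = - U I2 R1 K0"
    "U I1 R1 K1 = - U I5 R1 K1" "U I1 R2 K0 = - U I3 R2 K0" "U I1 R2 K1 = - U I4 R2 K1"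
    using R[of I0 R0] C[of I0 K0] C[of I0 K1] S[of R0 K0] S[of R0 K1] S[of R3 K0] S[of R3 K1] R[of I2 R0]
      C[of I2 K0] C[of I2 K2] R[of I3 R3] C[of I3 K0] C[of I3 K2] R[of I4 R0] C[of I4 K1] C[of I4 K2]
      R[of I5 R3] C[of I5 K1] C[of I5 K2] S[of R1 K0] S[of R1 K1] S[of R2 K0] S[of R2 K1]
    by (simp_all add: z eq_neg_iff_add_eq_0 add.commute)
  \<comment> \<open>The two cells of this row are reached with equal signs, so its zero sum says
    that twice the entry vanishes.\<close>
  have a: "U I0 R0 K0 = 0" using R[of I1 R1] by (simp add: z t)
  show ?thesis by (cases i; cases r; cases k; simp add: z t a)
qed

text \<open>On a line where \<open>h\<close> sums to 1, the entries of \<open>f\<close> are at most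
  twice those of \<open>h\<close>, strictly at some cell. The integral sum of \<open>f\<close> thus
  lies strictly between 0 and 2.\<close>

lemma line_half:
  fixes f :: "'a :: finite \<Rightarrow> real"
  assumes "(\<Sum>x\<in>UNIV. f x) \<in> \<int>" "\<And>x. 0 \<le> f x" "\<And>x. f x < 1"
    and h: "\<And>x. h x = (if 0 < f x then 1/2 else 0)" "(\<Sum>x\<in>UNIV. h x) \<in> {0, 1}"
  shows "(\<Sum>x\<in>UNIV. f x) = (\<Sum>x\<in>UNIV. h x)"
proof -
  have nn: "0 \<le> h x" "f x \<le> 2 * h x" for x using assms(2,3)[of x] h(1)[of x] by (auto simp: not_less)
  show ?thesis
  proof (cases "(\<Sum>x\<in>UNIV. h x) = 0")
    case True
    then have "h x = 0" for x using sum_nonneg_eq_0_iff[of UNIV h] nn(1) by simp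
    then have "f x = 0" for x using nn(2)[of x] assms(2)[of x] by simp
    then show ?thesis using True by simp
  next
    case False
    then have 1: "(\<Sum>x\<in>UNIV. h x) = 1" using h(2) by simp
    obtain y where y: "h y \<noteq> 0" using False by (metis sum.neutral)
    then have fy: "0 < f y" using h(1)[of y] by (metis)
    have "f y < 2 * h y" using h(1)[of y] fy assms(3)[of y] by simp
    then have "(\<Sum>x\<in>UNIV. f x) < (\<Sum>x\<in>UNIV. 2 * h x)"
      using nn(2) by (intro sum_strict_mono_ex1) auto
    then have "(\<Sum>x\<in>UNIV. f x) < 2" using 1 by (simp flip: sum_distrib_left)
    moreover have "0 < (\<Sum>x\<in>UNIV. f x)" using sum_pos2[of UNIV y f] fy assms(2) by simp
    ultimately show ?thesis using assms(1) 1 by (auto elim!: Ints_cases)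
  qed
qed

lemma good_vlach:
  fixes Z :: "idx \<Rightarrow> row \<Rightarrow> col \<Rightarrow> real"
  assumes g: "good Z" and ne: "Z i0 r0 k0 \<noteq> 0"
  shows "\<exists>\<pi> \<rho> \<kappa>. bij \<pi> \<and> bij \<rho> \<and> bij \<kappa> \<and> (\<forall>i r k. Z (\<pi> i) (\<rho> r) (\<kappa> k) = halves i r k)"
proof -
  have "0 < Z i0 r0 k0" using ne goodD(1)[OF g, of i0 r0 k0] by linarith
  then have "active Z \<noteq> {}" by (auto simp: active_def[OF g])
  moreover have "set tab = {h. valid h \<and> norm h \<in> UNIV}" using slices_all by (auto simp: tab_def)
  ultimately obtain Z' where m: "moved Z Z'" "good Z'" "found Z'"
    using runall_sound[OF runall_roots _ g] by blast
  \<comment> \<open>The row permutations taking \<open>V1\<close> and \<open>V2\<close> to the row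
    order of \<open>pattern\<close>; \<open>?g1\<close> and \<open>?g2\<close> are their effects on
    a slice.\<close>
  let ?s1 = "case_row R0 R2 R3 R1" and ?s2 = "case_row R0 R3 R2 R1"
  let ?g1 = "\<lambda>h. case h of Sl a b c d \<Rightarrow> Sl a c d b" and ?g2 = "\<lambda>h. case h of Sl a b c d \<Rightarrow> Sl a d c b"
  have ex: "\<exists>\<rho> g. bij \<rho> \<and> (\<forall>h r. rowof (\<rho> r) h = rowof r (g h)) \<and> (\<forall>i. \<exists>j. g (supp (Z' j)) = pattern i)"
  proof (cases "set V1 \<subseteq> (\<lambda>i. supp (Z' i)) ` active Z'")
    case True
    have "bij ?s1" by (rule o_bij[of "case_row R0 R3 R1 R2"]; rule ext; simp split: row.splits)
    moreover have "rowof (?s1 r) h = rowof r (?g1 h)" for h r by (cases r; cases h) simp_all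
    moreover have "\<exists>h\<in>set V1. ?g1 h = pattern i" for i by (cases i) (simp_all add: V1_def)
    then have "\<exists>j. ?g1 (supp (Z' j)) = pattern i" for i using True by (metis (no_types, lifting) imageE subsetD)
    ultimately show ?thesis by blast
  next
    case False
    then have V2: "set V2 \<subseteq> (\<lambda>i. supp (Z' i)) ` active Z'" using m(3) found_def[OF m(2)] by blast
    have "bij ?s2" by (rule o_bij[of "case_row R0 R3 R2 R1"]; rule ext; simp split: row.splits)
    moreover have "rowof (?s2 r) h = rowof r (?g2 h)" for h r by (cases r; cases h) simp_all
    moreover have "\<exists>h\<in>set V2. ?g2 h = pattern i" for i by (cases i) (simp_all add: V2_def)
    then have "\<exists>j. ?g2 (supp (Z' j)) = pattern i" for i using V2 by (metis (no_types, lifting) imageE subsetD)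
    ultimately show ?thesis by blast
  qed
  then obtain \<rho>' f where f: "bij \<rho>'" "\<And>h r. rowof (\<rho>' r) h = rowof r (f h)" "\<forall>i. \<exists>j. f (supp (Z' j)) = pattern i" by blast
  then obtain \<pi> where \<pi>: "\<And>i. f (supp (Z' (\<pi> i))) = pattern i" by metis
  \<comment> \<open>Six distinct patterns occupy six slices, so no slice is left over.\<close>
  have "pattern i = pattern j \<Longrightarrow> i = j" for i j by (cases i; cases j) simp_all
  then have "inj \<pi>" using \<pi> by (metis injI)
  then have b: "bij \<pi>" by (simp add: bij_def finite_UNIV_inj_surj)
  let ?Y = "\<lambda>i r k. Z' (\<pi> i) (\<rho>' r) k"
  have pos: "halves i r k = (if 0 < ?Y i r k then 1/2 else 0)" for i r k
    using has_supp[OF m(2), of k "\<rho>' r" "\<pi> i"] by (simp add: halves_def f(2) \<pi>)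
  have rows: "(\<Sum>r\<in>UNIV. F (\<rho>' r)) = (\<Sum>r\<in>UNIV. F r)" for F :: "row \<Rightarrow> real" by (rule sum.reindex_bij_betw[OF f(1)])
  have idxs: "(\<Sum>i\<in>UNIV. F (\<pi> i)) = (\<Sum>i\<in>UNIV. F i)" for F :: "idx \<Rightarrow> real" by (rule sum.reindex_bij_betw[OF b])
  note gd = goodD[OF m(2)]
  have Y1: "(\<Sum>k\<in>UNIV. ?Y i r k) = (\<Sum>k\<in>UNIV. halves i r k)" for i r
    by (rule line_half[OF gd(3,1,2) pos]) (simp add: halves_sums)
  have Y2: "(\<Sum>r\<in>UNIV. ?Y i r k) = (\<Sum>r\<in>UNIV. halves i r k)" for i k
    by (rule line_half[OF _ gd(1,2) pos]) (simp_all add: rows[of "\<lambda>r. Z' (\<pi> i) r k"] gd(4) halves_sums)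
  have Y3: "(\<Sum>i\<in>UNIV. ?Y i r k) = (\<Sum>i\<in>UNIV. halves i r k)" for r k
    by (rule line_half[OF _ gd(1,2) pos]) (simp_all add: idxs[of "\<lambda>i. Z' i (\<rho>' r) k"] gd(5) halves_sums)
  \<comment> \<open>Both tables have the same support and the same line sums, so their difference is
    a relation on the support.\<close>
  have "?Y i r k - halves i r k = 0" for i r k
  proof (rule halves_kernel[of "\<lambda>i r k. ?Y i r k - halves i r k"])
    show "?Y i r k - halves i r k = 0" if "halves i r k = 0" for i r k
      using pos[of i r k] gd(1)[of "\<pi> i" "\<rho>' r" k] that by (simp split: if_splits)
    show "(\<Sum>k\<in>UNIV. ?Y i r k - halves i r k) = 0" for i r using Y1[of i r] by (simp add: sum_subtractf)
    show "(\<Sum>r\<in>UNIV. ?Y i r k - halves i r k) = 0" for i k using Y2[of i k] by (simp add: sum_subtractf)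
    show "(\<Sum>i\<in>UNIV. ?Y i r k - halves i r k) = 0" for r k using Y3[of r k] by (simp add: sum_subtractf)
  qed
  then have Y: "?Y i r k = halves i r k" for i r k by (metis eq_iff_diff_eq_0)
  obtain \<rho> \<kappa> where rk: "bij \<rho>" "bij \<kappa>" "Z' = (\<lambda>i r k. Z i (\<rho> r) (\<kappa> k))" using m(1) unfolding moved_def by blast
  show ?thesis
    by (intro exI[of _ \<pi>] exI[of _ "\<rho> \<circ> \<rho>'"] exI[of _ \<kappa>] conjI b rk(2) bij_comp[OF f(1) rk(1)])
      (use Y in \<open>simp add: rk(3)\<close>)
qed

section \<open>Passage between the datatypes and the numeral index types\<close>

lemma exhaust_6: "(x :: 6) = 1 \<or> x = 2 \<or> x = 3 \<or> x = 4 \<or> x = 5 \<or> x = 6"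
proof (induct x)
  case (of_int z)
  then have "z = 0 \<or> z = 1 \<or> z = 2 \<or> z = 3 \<or> z = 4 \<or> z = 5" by fastforce
  then show ?case by auto
qed

lemma vector_4: "(vector [a, b, c, d] :: 'a :: zero ^ 4) $ 1 = a" "(vector [a, b, c, d] :: 'a :: zero ^ 4) $ 2 = b"
  "(vector [a, b, c, d] :: 'a :: zero ^ 4) $ 3 = c" "(vector [a, b, c, d] :: 'a :: zero ^ 4) $ 4 = d"
  unfolding vector_def by simp_all

lemma vector_6: "(vector [a, b, c, d, e, f] :: 'a :: zero ^ 6) $ 1 = a" "(vector [a, b, c, d, e, f] :: 'a :: zero ^ 6) $ 2 = b"
  "(vector [a, b, c, d, e, f] :: 'a :: zero ^ 6) $ 3 = c" "(vector [a, b, c, d, e, f] :: 'a :: zero ^ 6) $ 4 = d"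
  "(vector [a, b, c, d, e, f] :: 'a :: zero ^ 6) $ 5 = e" "(vector [a, b, c, d, e, f] :: 'a :: zero ^ 6) $ 6 = f"
  unfolding vector_def by simp_all

fun col_index :: "col \<Rightarrow> 3" where "col_index K0 = 1" | "col_index K1 = 2" | "col_index K2 = 3"
fun row_index :: "row \<Rightarrow> 4" where "row_index R0 = 1" | "row_index R1 = 2" | "row_index R2 = 3" | "row_index R3 = 4"
fun idx_index :: "idx \<Rightarrow> 6" where
  "idx_index I0 = 1" | "idx_index I1 = 2" | "idx_index I2 = 3" | "idx_index I3 = 4" | "idx_index I4 = 5" | "idx_index I5 = 6"

lemma bij_col_index: "bij col_index"
proof -
  have s: "surj col_index" unfolding surj_def using exhaust_3 col_index.simps by metis
  have "card (UNIV :: col set) = 3" by (simp add: UNIV_col)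
  then have "inj col_index" using s by (intro eq_card_imp_inj_on) simp_all
  with s show ?thesis by (simp add: bij_def)
qed

lemma bij_row_index: "bij row_index"
proof -
  have s: "surj row_index" unfolding surj_def using exhaust_4 row_index.simps by metis
  have "card (UNIV :: row set) = 4" by (simp add: UNIV_row)
  then have "inj row_index" using s by (intro eq_card_imp_inj_on) simp_all
  with s show ?thesis by (simp add: bij_def)
qed

lemma bij_idx_index: "bij idx_index"
proof -
  have s: "surj idx_index" unfolding surj_def using exhaust_6 idx_index.simps by metis
  have "card (UNIV :: idx set) = 6" by (simp add: UNIV_idx)
  then have "inj idx_index" using s by (intro eq_card_imp_inj_on) simp_all
  with s show ?thesis by (simp add: bij_def)
qed

definition entry :: "real ^ cell \<Rightarrow> idx \<Rightarrow> row \<Rightarrow> col \<Rightarrow> real" where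
  "entry z i r k = z $ (idx_index i, row_index r, col_index k)"

definition table :: "(idx \<Rightarrow> row \<Rightarrow> col \<Rightarrow> real) \<Rightarrow> real ^ cell" where
  "table X = (\<chi> c. X (inv idx_index (fst c)) (inv row_index (fst (snd c))) (inv col_index (snd (snd c))))"

lemma entry_table: "entry (table X) i r k = X i r k"
  using bij_idx_index bij_row_index bij_col_index by (simp add: entry_def table_def inv_f_f bij_is_inj)

lemma ex_index: "\<exists>i. x = idx_index i" "\<exists>r. y = row_index r" "\<exists>k. w = col_index k"
  using bij_idx_index bij_row_index bij_col_index by (metis bij_pointE)+

lemma cell_cases: obtains i r k where "c = (idx_index i, row_index r, col_index k)"
  using ex_index by (cases c) blast

lemma entry_eqI: "(\<And>i r k. entry z i r k = entry y i r k) \<Longrightarrow> z = y"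
  unfolding vec_eq_iff by (metis cell_cases entry_def)

lemma sum_index:
  fixes F :: "6 \<Rightarrow> real" and G :: "4 \<Rightarrow> real" and H :: "3 \<Rightarrow> real"
  shows "(\<Sum>x\<in>UNIV. F x) = (\<Sum>i\<in>UNIV. F (idx_index i))" "(\<Sum>x\<in>UNIV. G x) = (\<Sum>r\<in>UNIV. G (row_index r))"
    "(\<Sum>x\<in>UNIV. H x) = (\<Sum>k\<in>UNIV. H (col_index k))"
  by (rule sum.reindex_bij_betw[symmetric], fact bij_idx_index bij_row_index bij_col_index)+

lemma line_sums_index:
  "line_sums z $ Inl (row_index r, col_index k) = (\<Sum>i\<in>UNIV. entry z i r k)"
  "line_sums z $ Inr (Inl (idx_index i, col_index k)) = (\<Sum>r\<in>UNIV. entry z i r k)"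
  "line_sums z $ Inr (Inr (idx_index i, row_index r)) = (\<Sum>k\<in>UNIV. entry z i r k)"
  by (simp_all add: line_sums_def entry_def sum_index)

lemma line_cases:
  obtains (jk) r k where "l = Inl (row_index r, col_index k)" | (ik) i k where "l = Inr (Inl (idx_index i, col_index k))"
    | (ij) i r where "l = Inr (Inr (idx_index i, row_index r))"
proof (cases l)
  case (Inl p) then show ?thesis using jk ex_index by (cases p) blast
next
  case (Inr q) then show ?thesis
  proof (cases q)
    case (Inl p) then show ?thesis using ik \<open>l = Inr q\<close> ex_index by (cases p) blast
  next
    case (Inr p) then show ?thesis using ij \<open>l = Inr q\<close> ex_index by (cases p) blast
  qed
qed

lemma line_vec_eqI:
  assumes "\<And>r k. u $ Inl (row_index r, col_index k) = v $ Inl (row_index r, col_index k)"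
    "\<And>i k. u $ Inr (Inl (idx_index i, col_index k)) = v $ Inr (Inl (idx_index i, col_index k))"
    "\<And>i r. u $ Inr (Inr (idx_index i, row_index r)) = v $ Inr (Inr (idx_index i, row_index r))"
  shows "u = (v :: real ^ line)"
  unfolding vec_eq_iff
proof
  fix l show "u $ l = v $ l" by (cases l rule: line_cases) (simp_all add: assms)
qed

lemma line_sums_linear:
  "line_sums (z + y) = line_sums z + line_sums y" "line_sums (z - y) = line_sums z - line_sums y"
  "line_sums (t *\<^sub>R z) = t *\<^sub>R line_sums z" "line_sums 0 = 0"
  using linear_line_sums by (simp_all add: linear_add linear_diff linear_scale linear_0)

lemma entry_linear: "entry (z + y) i r k = entry z i r k + entry y i r k" "entry (z - y) i r k = entry z i r k - entry y i r k"
  "entry (t *\<^sub>R z) i r k = t * entry z i r k" "entry 0 i r k = 0"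
  by (simp_all add: entry_def)

lemma zstar_entry: "entry zstar i r k = halves i r k"
  by (cases i; cases r; cases k; simp add: entry_def zstar_def zstar_slices_def vector_6 vector_4 halves_def)

text \<open>Natural numbers, to be compared with the lengths of filtered lists in
  \<open>completes\<close>.\<close>

definition ik_value :: "idx \<Rightarrow> col \<Rightarrow> nat" where
  "ik_value i k = (if list_ex (\<lambda>r. has k (rowof r (pattern i))) [R0, R1, R2, R3] then 1 else 0)"
definition ij_value :: "idx \<Rightarrow> row \<Rightarrow> nat" where
  "ij_value i r = (if rowof r (pattern i) = Em then 0 else 1)"

lemma vlach_index:
  "vlach $ Inl (row_index r, col_index k) = 1"
  "vlach $ Inr (Inl (idx_index i, col_index k)) = ik_value i k"
  "vlach $ Inr (Inr (idx_index i, row_index r)) = ij_value i r"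
proof -
  show "vlach $ Inl (row_index r, col_index k) = 1"
    by (cases r; cases k; simp add: vlach_def vlach_jk_def vector_4)
  show "vlach $ Inr (Inl (idx_index i, col_index k)) = ik_value i k"
    by (cases i; cases k; simp add: vlach_def vlach_ik_def vector_6 ik_value_def)
  show "vlach $ Inr (Inr (idx_index i, row_index r)) = ij_value i r"
    by (cases i; cases r; simp add: vlach_def vlach_ij_def vector_6 vector_4 ij_value_def)
qed

lemma line_sums_zstar: "line_sums zstar = vlach"
  by (rule line_vec_eqI) (simp_all add: line_sums_index vlach_index zstar_entry halves_sums ik_value_def ij_value_def)

section \<open>Cone and monoids in terms of tables\<close>

definition nat_table :: "(cell \<Rightarrow> nat) \<Rightarrow> real ^ cell" where "nat_table n = (\<chi> c. real (n c))"

lemma column_A643: "column c A643 = line_sums (axis c 1)"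
  by (metis A643_mult matrix_vector_mult_basis)

lemma sum_columns: "(\<Sum>c\<in>UNIV. x c *\<^sub>R column c A643) = line_sums (\<chi> c. x c)"
proof -
  have "(\<chi> c. x c) = (\<Sum>c\<in>UNIV. x c *\<^sub>R axis c (1::real))"
    by (simp add: vec_eq_iff axis_def if_distrib cong: if_cong)
  then show ?thesis by (simp add: linear_sum[OF linear_line_sums] line_sums_linear column_A643)
qed

lemma cone_A643: "cone_of A643 = {line_sums z | z. \<forall>c. 0 \<le> z $ c}"
  unfolding cone_of_def sum_columns
proof (intro equalityI subsetI)
  fix v assume "v \<in> {line_sums (\<chi> c. x c) | x. \<forall>c. 0 \<le> x c}"
  then obtain x where x: "v = line_sums (\<chi> c. x c)" "\<forall>c. 0 \<le> x c" by blast
  show "v \<in> {line_sums z | z. \<forall>c. 0 \<le> z $ c}"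
    by (rule CollectI, rule exI[of _ "\<chi> c. x c"]) (simp add: x)
next
  fix v assume "v \<in> {line_sums z | z. \<forall>c. 0 \<le> z $ c}"
  then obtain z where z: "v = line_sums z" "\<forall>c. 0 \<le> z $ c" by blast
  show "v \<in> {line_sums (\<chi> c. x c) | x. \<forall>c. 0 \<le> x c}"
    by (rule CollectI, rule exI[of _ "\<lambda>c. z $ c"]) (simp add: z vec_lambda_eta)
qed

lemma entry_axis: "entry (axis (idx_index i, row_index r, col_index k) 1) i' r' k' = (if i' = i \<and> r' = r \<and> k' = k then 1 else 0)"
  using bij_idx_index bij_row_index bij_col_index by (auto simp: entry_def axis_def bij_def inj_eq)

text \<open>A \<open>(j, k)\<close>-line sum and an \<open>(i, j)\<close>-line sum together identify
  the cell. Distinctness matters because \<open>monoid_of\<close> sums over a set of vectors, in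
  which equal columns would merge.\<close>

lemma column_inj: "column c A643 = column d A643 \<Longrightarrow> c = d"
proof -
  assume e: "column c A643 = column d A643"
  obtain i r k where c: "c = (idx_index i, row_index r, col_index k)" by (rule cell_cases)
  obtain i' r' k' where d: "d = (idx_index i', row_index r', col_index k')" by (rule cell_cases)
  have E: "line_sums (axis c 1) $ l = line_sums (axis d 1) $ l" for l using e by (simp add: column_A643)
  have "r = r' \<and> k = k'"
  proof (rule ccontr)
    assume "\<not> ?thesis"
    then have "entry (axis d 1) a r k = 0" for a by (auto simp: d entry_axis)
    then show False using E[of "Inl (row_index r, col_index k)"] by (simp add: line_sums_index c entry_axis)
  qed
  moreover have "i = i'"
  proof (rule ccontr)
    assume "\<not> ?thesis"
    then have "entry (axis d 1) i r b = 0" for b by (simp add: d entry_axis)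
    then show False using E[of "Inr (Inr (idx_index i, row_index r))"] by (simp add: line_sums_index c entry_axis)
  qed
  ultimately show "c = d" by (simp add: c d)
qed

lemma monoid_columns: "monoid_of ((\<lambda>c. column c A643) ` S) = {line_sums (nat_table n) | n. \<forall>c. c \<notin> S \<longrightarrow> n c = 0}"
proof -
  let ?col = "\<lambda>c. column c A643"
  have inj: "inj_on ?col S" using column_inj by (rule inj_onI)
  have *: "(\<Sum>g\<in>?col ` S. real (n g) *\<^sub>R g) = line_sums (nat_table (\<lambda>c. if c \<in> S then n (?col c) else 0))" for n
  proof -
    have "(\<Sum>g\<in>?col ` S. real (n g) *\<^sub>R g) = (\<Sum>c\<in>S. real (n (?col c)) *\<^sub>R ?col c)"
      by (simp add: sum.reindex[OF inj])
    also have "\<dots> = (\<Sum>c\<in>UNIV. real (if c \<in> S then n (?col c) else 0) *\<^sub>R ?col c)"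
      by (rule sum.mono_neutral_cong_left) auto
    finally show ?thesis by (simp add: sum_columns nat_table_def)
  qed
  show ?thesis
  proof (intro equalityI subsetI)
    fix v assume "v \<in> monoid_of (?col ` S)"
    then show "v \<in> {line_sums (nat_table n) | n. \<forall>c. c \<notin> S \<longrightarrow> n c = 0}" unfolding monoid_of_def * by auto
  next
    fix v assume "v \<in> {line_sums (nat_table n) | n. \<forall>c. c \<notin> S \<longrightarrow> n c = 0}"
    then obtain n where n: "v = line_sums (nat_table n)" "\<forall>c. c \<notin> S \<longrightarrow> n c = 0" by blast
    have inv: "inv ?col (?col c) = c" for c by (rule inv_f_f) (rule injI, rule column_inj)
    have "(\<lambda>c. if c \<in> S then (\<lambda>g. n (inv ?col g)) (?col c) else 0) = n" using n(2) by (auto simp: inv)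
    then have "v = (\<Sum>g\<in>?col ` S. real (n (inv ?col g)) *\<^sub>R g)" using *[of "\<lambda>g. n (inv ?col g)"] n(1) by simp
    then show "v \<in> monoid_of (?col ` S)" unfolding monoid_of_def
      by (intro CollectI exI[of _ "\<lambda>g. n (inv ?col g)"] conjI TrueI)
  qed
qed

lemma columns_A643: "columns A643 = (\<lambda>c. column c A643) ` UNIV" by (auto simp: columns_def)
lemma G643_image: "G643 = (\<lambda>c. column c A643) ` {c. 0 < zstar $ c}" by (auto simp: G643_def)

lemma monoid_A643: "monoid_of (columns A643) = {line_sums (nat_table n) | n. True}"
  unfolding columns_A643 monoid_columns by simp
lemma monoid_G643: "monoid_of G643 = {line_sums (nat_table n) | n. \<forall>c. \<not> 0 < zstar $ c \<longrightarrow> n c = 0}"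
  unfolding G643_image monoid_columns by simp

lemma nat_table_add: "nat_table (\<lambda>c. m c + n c) = nat_table m + nat_table n" by (simp add: nat_table_def vec_eq_iff)
lemma nat_table_single: "nat_table (\<lambda>d. if d = c then 1 else 0) = axis c 1"
  by (simp add: nat_table_def vec_eq_iff axis_def)

lemma monoid_add: "u \<in> monoid_of (columns A643) \<Longrightarrow> v \<in> monoid_of (columns A643) \<Longrightarrow> u + v \<in> monoid_of (columns A643)"
  unfolding monoid_A643 by (smt (verit, best) line_sums_linear(1) mem_Collect_eq nat_table_add)
lemma monoid_column: "column c A643 \<in> monoid_of (columns A643)"
  unfolding monoid_A643 using nat_table_single column_A643 by (metis (mono_tags, lifting) mem_Collect_eq)
lemma monoid_G643_subset: "monoid_of G643 \<subseteq> monoid_of (columns A643)"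
  unfolding monoid_A643 monoid_G643 by blast
lemma monoid_G643_add: "0 < zstar $ c \<Longrightarrow> s \<in> monoid_of G643 \<Longrightarrow> s + column c A643 \<in> monoid_of G643"
proof -
  assume c: "0 < zstar $ c" and "s \<in> monoid_of G643"
  then obtain n where n: "s = line_sums (nat_table n)" "\<forall>c. \<not> 0 < zstar $ c \<longrightarrow> n c = 0" unfolding monoid_G643 by blast
  have "s + column c A643 = line_sums (nat_table (\<lambda>d. n d + (if d = c then 1 else 0)))"
    by (simp add: nat_table_add nat_table_single line_sums_linear column_A643 n(1))
  then show ?thesis unfolding monoid_G643 using n(2) c by (intro CollectI exI[of _ "\<lambda>d. n d + (if d = c then 1 else 0)"]) auto
qed

section \<open>The action of the index permutations\<close>

definition cell_map :: "(6 \<Rightarrow> 6) \<times> (4 \<Rightarrow> 4) \<times> (3 \<Rightarrow> 3) \<Rightarrow> cell \<Rightarrow> cell" where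
  "cell_map = (\<lambda>(\<rho>, \<tau>, \<kappa>). map_prod \<rho> (map_prod \<tau> \<kappa>))"

lemma finite_inj_bij: "inj f \<Longrightarrow> bij f" for f :: "'a :: finite \<Rightarrow> 'a"
  by (simp add: bij_def finite_UNIV_inj_surj)

lemma bij_cell_map: "\<sigma> \<in> index_perms \<Longrightarrow> bij (cell_map \<sigma>)"
  unfolding index_perms_def cell_map_def
  by (auto dest!: permutes_inj intro!: finite_inj_bij prod.inj_map)

lemma bij_perm_line: "\<sigma> \<in> index_perms \<Longrightarrow> bij (perm_line \<sigma>)"
  unfolding index_perms_def perm_line_def
  by (auto dest!: permutes_inj intro!: finite_inj_bij prod.inj_map sum.inj_map)

lemma act_perm_line: "\<sigma> \<in> index_perms \<Longrightarrow> act \<sigma> v $ perm_line \<sigma> l = v $ l"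
  using bij_perm_line by (simp add: act_def inv_f_f bij_is_inj)

lemma act_inj: "\<sigma> \<in> index_perms \<Longrightarrow> act \<sigma> u = act \<sigma> v \<Longrightarrow> u = v"
  by (metis act_perm_line vec_eq_iff)

lemma act_add: "act \<sigma> (u + v) = act \<sigma> u + act \<sigma> v"
  by (simp add: act_def vec_eq_iff)

text \<open>Reindexing a sum by a permutation does not change it. The table is pulled back on the
  left, which keeps inverses out of the sums; \<open>act_table\<close> is the form with the
  inverse.\<close>

lemma act_line_sums:
  assumes "\<sigma> \<in> index_perms"
  shows "act \<sigma> (line_sums (\<chi> c. y $ cell_map \<sigma> c)) = line_sums y"
  unfolding vec_eq_iff
proof
  fix l
  obtain \<rho> \<tau> \<kappa> where s: "\<sigma> = (\<rho>, \<tau>, \<kappa>)" by (cases \<sigma>)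
  have b: "bij \<rho>" "bij \<tau>" "bij \<kappa>" using assms unfolding s index_perms_def by (auto dest: permutes_bij)
  obtain l' where l: "l = perm_line \<sigma> l'" using bij_perm_line[OF assms] by (metis bij_pointE)
  have "line_sums (\<chi> c. y $ cell_map \<sigma> c) $ l' = line_sums y $ perm_line \<sigma> l'"
    by (cases l' rule: sum.exhaust; (rename_tac q, case_tac q)?)
      (auto simp: s line_sums_def perm_line_def cell_map_def
        sum.reindex_bij_betw[OF b(1), of "\<lambda>i. y $ (i, _, _)"] sum.reindex_bij_betw[OF b(2), of "\<lambda>j. y $ (_, j, _)"]
        sum.reindex_bij_betw[OF b(3), of "\<lambda>k. y $ (_, _, k)"] split: sum.splits)
  then show "act \<sigma> (line_sums (\<chi> c. y $ cell_map \<sigma> c)) $ l = line_sums y $ l"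
    by (simp add: l act_perm_line[OF assms])
qed

lemma act_table:
  assumes "\<sigma> \<in> index_perms"
  shows "act \<sigma> (line_sums z) = line_sums (\<chi> c. z $ inv (cell_map \<sigma>) c)"
proof -
  have "z = (\<chi> c. (\<chi> c. z $ inv (cell_map \<sigma>) c) $ cell_map \<sigma> c)"
    using bij_cell_map[OF assms] by (simp add: vec_eq_iff inv_f_f bij_is_inj)
  then show ?thesis using act_line_sums[OF assms] by metis
qed

lemma act_column:
  assumes "\<sigma> \<in> index_perms" shows "act \<sigma> (column c A643) = column (cell_map \<sigma> c) A643"
proof -
  have "(\<chi> d. axis (cell_map \<sigma> c) (1 :: real) $ cell_map \<sigma> d) = axis c 1"
    using bij_cell_map[OF assms] by (auto simp: vec_eq_iff axis_def bij_def inj_eq)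
  then show ?thesis using act_line_sums[OF assms, of "axis (cell_map \<sigma> c) 1"] by (simp add: column_A643)
qed

lemma act_monoid:
  assumes "\<sigma> \<in> index_perms"
  shows "act \<sigma> v \<in> monoid_of (columns A643) \<longleftrightarrow> v \<in> monoid_of (columns A643)"
proof
  assume "act \<sigma> v \<in> monoid_of (columns A643)"
  then obtain m where m: "act \<sigma> v = line_sums (nat_table m)" unfolding monoid_A643 by blast
  have "act \<sigma> (line_sums (nat_table (\<lambda>c. m (cell_map \<sigma> c)))) = act \<sigma> v"
    using act_line_sums[OF assms, of "nat_table m"] by (simp add: m nat_table_def)
  then show "v \<in> monoid_of (columns A643)" unfolding monoid_A643 using act_inj[OF assms] by blast
next
  assume "v \<in> monoid_of (columns A643)"
  then obtain m where "v = line_sums (nat_table m)" unfolding monoid_A643 by blast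
  then have "act \<sigma> v = line_sums (nat_table (\<lambda>c. m (inv (cell_map \<sigma>) c)))"
    by (simp add: act_table[OF assms] nat_table_def)
  then show "act \<sigma> v \<in> monoid_of (columns A643)" unfolding monoid_A643 by blast
qed

lemma monoid_Ints: "v \<in> monoid_of (columns A643) \<Longrightarrow> v $ l \<in> \<int>"
proof -
  assume "v \<in> monoid_of (columns A643)"
  then obtain n where v: "v = line_sums (nat_table n)" unfolding monoid_A643 by blast
  show ?thesis unfolding v
    by (cases l rule: line_cases) (simp_all only: line_sums_index entry_def nat_table_def vec_lambda_beta, (rule Ints_sum; simp)+)
qed

section \<open>Permuted translates of \<open>vlach\<close> are holes, and their summands are
  unique\<close>

lemma halves_eq_0: "halves i r k = 0 \<longleftrightarrow> ik_value i k = 0 \<or> ij_value i r = 0"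
  by (cases i; cases r; cases k; simp add: halves_def ik_value_def ij_value_def)

lemma zstar_cases: "zstar $ c = 0 \<or> zstar $ c = 1/2"
proof -
  obtain i r k where c: "c = (idx_index i, row_index r, col_index k)" by (rule cell_cases)
  show ?thesis using zstar_entry[of i r k] by (simp add: c entry_def halves_def)
qed

text \<open>The zero line sums of \<^const>\<open>vlach\<close> confine every solution to the cells where \<^const>\<open>zstar\<close> is positive.\<close>

lemma unique_solution:
  assumes nn: "\<forall>c. 0 \<le> z $ c" and e: "line_sums z = vlach + line_sums (nat_table n)"
    and n: "\<forall>c. \<not> 0 < zstar $ c \<longrightarrow> n c = 0"
  shows "z = zstar + nat_table n"
proof -
  let ?N = "entry (nat_table n)"
  have N: "?N i r k = 0" if "halves i r k = 0" for i r k
    using n that zstar_entry[of i r k] by (simp add: entry_def nat_table_def)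
  have "line_sums z = line_sums zstar + line_sums (nat_table n)" using e by (simp add: line_sums_zstar)
  then have E: "line_sums z $ l = line_sums zstar $ l + line_sums (nat_table n) $ l" for l by simp
  have l1: "(\<Sum>i\<in>UNIV. entry z i r k) = (\<Sum>i\<in>UNIV. halves i r k) + (\<Sum>i\<in>UNIV. ?N i r k)" for r k
    using E[of "Inl (row_index r, col_index k)"] by (simp add: line_sums_index zstar_entry)
  have l2: "(\<Sum>r\<in>UNIV. entry z i r k) = (\<Sum>r\<in>UNIV. halves i r k) + (\<Sum>r\<in>UNIV. ?N i r k)" for i k
    using E[of "Inr (Inl (idx_index i, col_index k))"] by (simp add: line_sums_index zstar_entry)
  have l3: "(\<Sum>k\<in>UNIV. entry z i r k) = (\<Sum>k\<in>UNIV. halves i r k) + (\<Sum>k\<in>UNIV. ?N i r k)" for i r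
    using E[of "Inr (Inr (idx_index i, row_index r))"] by (simp add: line_sums_index zstar_entry)
  have nn': "0 \<le> entry z i r k" for i r k using nn by (simp add: entry_def)
  have Z: "entry z i r k = 0" if "halves i r k = 0" for i r k
    using that unfolding halves_eq_0
  proof
    assume "ik_value i k = 0"
    then have "halves i r k = 0" for r by (simp add: halves_eq_0)
    then have "(\<Sum>r\<in>UNIV. entry z i r k) = 0" by (simp add: l2 N)
    then show ?thesis using nn' by (simp add: sum_nonneg_eq_0_iff)
  next
    assume "ij_value i r = 0"
    then have "halves i r k = 0" for k by (simp add: halves_eq_0)
    then have "(\<Sum>k\<in>UNIV. entry z i r k) = 0" by (simp add: l3 N)
    then show ?thesis using nn' by (simp add: sum_nonneg_eq_0_iff)
  qed
  have "entry z i r k - (halves i r k + ?N i r k) = 0" for i r k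
    by (rule halves_kernel[of "\<lambda>i r k. entry z i r k - (halves i r k + ?N i r k)"])
      (simp_all add: Z N sum_subtractf sum.distrib l1 l2 l3)
  then show ?thesis by (intro entry_eqI) (simp add: entry_linear zstar_entry algebra_simps)
qed

lemma half_nat: "real a = 1/2 + real b \<Longrightarrow> False"
proof -
  assume "real a = 1/2 + real b"
  then have "real (2 * a) = real (1 + 2 * b)" by simp
  then have "2 * a = 1 + 2 * b" by (simp only: of_nat_eq_iff)
  then show False by presburger
qed

lemma vlach_hole:
  assumes "\<sigma> \<in> index_perms" "s \<in> monoid_of G643"
  shows "act \<sigma> (vlach + s) \<in> holes A643"
proof -
  obtain n where n: "s = line_sums (nat_table n)" "\<forall>c. \<not> 0 < zstar $ c \<longrightarrow> n c = 0"
    using assms(2) unfolding monoid_G643 by blast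
  have vs: "vlach + s = line_sums (zstar + nat_table n)" by (simp add: line_sums_linear line_sums_zstar n)
  have z0: "0 \<le> zstar $ c" for c using zstar_cases[of c] by auto
  have "act \<sigma> (vlach + s) = line_sums (\<chi> c. (zstar + nat_table n) $ inv (cell_map \<sigma>) c)"
    by (simp only: vs act_table[OF assms(1)])
  moreover have "\<forall>c. 0 \<le> (\<chi> c. (zstar + nat_table n) $ inv (cell_map \<sigma>) c) $ c" using z0 by (simp add: nat_table_def)
  ultimately have cone: "act \<sigma> (vlach + s) \<in> cone_of A643" unfolding cone_A643 by blast
  have "vlach $ l \<in> \<int>" for l by (cases l rule: line_cases) (simp_all add: vlach_index)
  then have "act \<sigma> (vlach + s) $ l \<in> \<int>" for l
    using monoid_Ints[of s] monoid_G643_subset assms(2) by (auto simp: act_def)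
  moreover have "vlach + s \<notin> monoid_of (columns A643)"
  proof
    assume "vlach + s \<in> monoid_of (columns A643)"
    then obtain m where m: "vlach + s = line_sums (nat_table m)" unfolding monoid_A643 by blast
    have "nat_table m = zstar + nat_table n"
      by (rule unique_solution) (use m n in \<open>auto simp: nat_table_def\<close>)
    \<comment> \<open>Any cell of the support would do: there the only solution is 1/2 plus an
      integer.\<close>
    then have "entry (nat_table m) I0 R0 K0 = entry zstar I0 R0 K0 + entry (nat_table n) I0 R0 K0"
      by (simp add: entry_linear)
    then have "real (m (1, 1, 1)) = 1/2 + real (n (1, 1, 1))"
      unfolding zstar_entry by (simp add: halves_def entry_def nat_table_def)
    then show False by (rule half_nat)
  qed
  ultimately show ?thesis using cone act_monoid[OF assms(1)] by (auto simp: holes_def)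
qed

text \<open>Both representations describe the same table by \<open>unique_solution\<close>. Its
  cells with fractional part 1/2 are those of the permuted \<open>zstar\<close>, so the two permuted
  copies of \<open>zstar\<close> coincide, and with them their line sums.\<close>

lemma unique_summands:
  assumes p: "\<sigma> \<in> index_perms" "\<sigma>' \<in> index_perms" and s: "s \<in> monoid_of G643" "s' \<in> monoid_of G643"
    and e: "act \<sigma> (vlach + s) = act \<sigma>' (vlach + s')"
  shows "act \<sigma> vlach = act \<sigma>' vlach"
proof -
  obtain n where n: "s = line_sums (nat_table n)" using s(1) unfolding monoid_G643 by blast
  obtain n' where n': "s' = line_sums (nat_table n')" "\<forall>c. \<not> 0 < zstar $ c \<longrightarrow> n' c = 0"
    using s(2) unfolding monoid_G643 by blast
  let ?y = "\<chi> c. (zstar + nat_table n) $ inv (cell_map \<sigma>) c"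
  have z0: "0 \<le> zstar $ c" for c using zstar_cases[of c] by auto
  have "act \<sigma>' (line_sums (\<chi> c. ?y $ cell_map \<sigma>' c)) = act \<sigma> (vlach + s)"
    unfolding act_line_sums[OF p(2)] act_table[OF p(1), symmetric] by (simp add: line_sums_linear line_sums_zstar n)
  then have "line_sums (\<chi> c. ?y $ cell_map \<sigma>' c) = vlach + line_sums (nat_table n')"
    unfolding e n'(1) by (rule act_inj[OF p(2)])
  then have "(\<chi> c. ?y $ cell_map \<sigma>' c) = zstar + nat_table n'"
    by (rule unique_solution[rotated]) (use n'(2) z0 in \<open>auto simp: nat_table_def\<close>)
  then have y: "(\<chi> c. ?y $ cell_map \<sigma>' c) $ c = (zstar + nat_table n') $ c" for c by (rule arg_cong)
  have "zstar $ inv (cell_map \<sigma>) (cell_map \<sigma>' c) = zstar $ c" for c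
  proof -
    let ?d = "inv (cell_map \<sigma>) (cell_map \<sigma>' c)"
    have *: "zstar $ ?d + real (n ?d) = zstar $ c + real (n' c)"
      using y[of c] by (simp only: vec_lambda_beta vector_add_component nat_table_def)
    from zstar_cases[of c] show ?thesis
    proof
      assume c: "zstar $ c = 0"
      from zstar_cases[of ?d] show ?thesis
      proof
        assume "zstar $ ?d = 1/2"
        then show ?thesis using half_nat[of "n' c" "n ?d"] * c by (metis add_0)
      qed (simp only: c)
    next
      assume c: "zstar $ c = 1/2"
      from zstar_cases[of ?d] show ?thesis
      proof
        assume "zstar $ ?d = 0"
        then show ?thesis using half_nat[of "n ?d" "n' c"] * c by (metis add_0)
      qed (simp only: c)
    qed
  qed
  then have "zstar = (\<chi> c. (\<chi> d. zstar $ inv (cell_map \<sigma>) d) $ cell_map \<sigma>' c)" by (simp add: vec_eq_iff)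
  then have "act \<sigma>' (line_sums zstar) = line_sums (\<chi> d. zstar $ inv (cell_map \<sigma>) d)"
    using act_line_sums[OF p(2), of "\<chi> d. zstar $ inv (cell_map \<sigma>) d"] by simp
  then show ?thesis by (simp add: line_sums_zstar[symmetric] act_table[OF p(1)])
qed

section \<open>Adding a column outside \<open>G643\<close> to \<open>vlach\<close>\<close>

lemma sum_count_list:
  fixes f :: "'a :: finite \<Rightarrow> 'b"
  assumes "inj f"
  shows "(\<Sum>i\<in>UNIV. real (count_list ys (f i))) = real (length (filter (\<lambda>y. y \<in> range f) ys))"
proof (induction ys)
  case (Cons y ys)
  have "(\<Sum>i\<in>UNIV. if y = f i then 1 else 0 :: real) = (if y \<in> range f then 1 else 0)"
  proof (cases "y \<in> range f")
    case True
    then obtain j where j: "y = f j" by blast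
    have "(f j = f i) = (j = i)" for i using assms by (auto dest: injD)
    then show ?thesis by (simp add: j)
  next
    case False
    then have "y \<noteq> f i" for i by blast
    then show ?thesis using False by simp
  qed
  moreover have "real (count_list (y # ys) (f i)) = (if y = f i then 1 else 0) + real (count_list ys (f i))" for i by simp
  ultimately show ?case using Cons by (simp add: sum.distrib)
qed simp

definition jk_lines :: "(row \<times> col) list" where
  "jk_lines = [(R0, K0), (R0, K1), (R0, K2), (R1, K0), (R1, K1), (R1, K2), (R2, K0), (R2, K1), (R2, K2), (R3, K0), (R3, K1), (R3, K2)]"

definition completes :: "idx \<times> row \<times> col \<Rightarrow> (idx \<times> row \<times> col) list \<Rightarrow> bool" where
  "completes c ys \<longleftrightarrow>
     list_all (\<lambda>(r, k). length (filter (\<lambda>y. snd y = (r, k)) ys) = 1 + (if snd c = (r, k) then 1 else 0)) jk_lines \<and>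
     list_all (\<lambda>i. list_all (\<lambda>k. length (filter (\<lambda>y. fst y = i \<and> snd (snd y) = k) ys) =
       ik_value i k + (if fst c = i \<and> snd (snd c) = k then 1 else 0)) [K0, K1, K2]) [I0, I1, I2, I3, I4, I5] \<and>
     list_all (\<lambda>i. list_all (\<lambda>r. length (filter (\<lambda>y. fst y = i \<and> fst (snd y) = r) ys) =
       ij_value i r + (if fst c = i \<and> fst (snd c) = r then 1 else 0)) [R0, R1, R2, R3]) [I0, I1, I2, I3, I4, I5]"

text \<open>For each cell off the support of \<^const>\<open>zstar\<close>, an integer table with line sums \<^const>\<open>vlach\<close> plus
  the column of that cell: its twelve entries 1 along \<^const>\<open>jk_lines\<close>, then one more in the line of the cell.\<close>

definition completions :: "((idx \<times> row \<times> col) \<times> idx list) list" where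
  "completions = [((I0, R0, K2), [I0, I0, I2, I2, I1, I5, I1, I4, I3, I3, I5, I0, I4]), ((I0, R1, K0), [I0, I4, I2, I1, I0, I5, I3,
I1, I4, I0, I5, I3, I2]), ((I0, R1, K1), [I2, I0, I4, I0, I1, I2, I1, I4, I3, I3, I0, I5, I5]), ((I0, R1, K2), [I2,
I0, I4, I0, I1, I2, I1, I4, I3, I3, I5, I0, I5]), ((I0, R2, K0), [I0, I4, I2, I2, I1, I5, I1, I0, I4, I0, I5, I3,
I3]), ((I0, R2, K1), [I2, I0, I4, I1, I5, I2, I0, I1, I3, I3, I0, I5, I4]), ((I0, R2, K2), [I0, I4, I2, I2, I1, I5,
I1, I0, I3, I3, I5, I0, I4]), ((I0, R3, K2), [I2, I4, I0, I1, I5, I2, I3, I1, I4, I0, I0, I3, I5]), ((I1, R0, K0),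
[I0, I1, I4, I1, I5, I2, I1, I4, I3, I3, I0, I5, I2]), ((I1, R0, K1), [I1, I0, I2, I2, I1, I5, I3, I1, I4, I0, I5,
I3, I4]), ((I1, R0, K2), [I0, I1, I2, I2, I5, I1, I1, I4, I3, I3, I0, I5, I4]), ((I1, R1, K2), [I2, I0, I4, I1, I1,
I2, I3, I4, I1, I0, I5, I3, I5]), ((I1, R2, K2), [I0, I4, I2, I2, I5, I1, I1, I1, I3, I3, I0, I5, I4]), ((I1, R3,
K0), [I2, I0, I4, I1, I5, I2, I1, I4, I3, I0, I1, I5, I3]), ((I1, R3, K1), [I0, I4, I2, I2, I1, I5, I3, I1, I4, I1,
I0, I3, I5]), ((I1, R3, K2), [I0, I4, I2, I2, I5, I1, I3, I1, I4, I1, I0, I3, I5]), ((I2, R0, K1), [I2, I0, I2, I1,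
I2, I5, I3, I1, I4, I0, I5, I3, I4]), ((I2, R1, K1), [I0, I2, I4, I2, I1, I2, I1, I4, I3, I3, I0, I5, I5]), ((I2,
R2, K0), [I2, I0, I4, I2, I1, I5, I1, I4, I2, I0, I5, I3, I3]), ((I2, R2, K1), [I0, I2, I4, I1, I5, I2, I2, I1, I3,
I3, I0, I5, I4]), ((I2, R2, K2), [I0, I4, I2, I1, I5, I2, I2, I1, I3, I3, I0, I5, I4]), ((I2, R3, K0), [I2, I0, I4,
I2, I1, I5, I1, I4, I3, I0, I5, I2, I3]), ((I2, R3, K1), [I0, I2, I4, I2, I1, I5, I1, I4, I3, I3, I0, I2, I5]),
((I2, R3, K2), [I0, I4, I2, I1, I5, I2, I3, I1, I4, I2, I0, I3, I5]), ((I3, R0, K0), [I0, I4, I3, I1, I5, I2, I3,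
I1, I4, I3, I0, I5, I2]), ((I3, R0, K1), [I2, I0, I3, I1, I5, I2, I3, I1, I4, I0, I3, I5, I4]), ((I3, R0, K2), [I3,
I0, I2, I2, I1, I5, I1, I4, I3, I0, I5, I3, I4]), ((I3, R1, K0), [I0, I4, I2, I1, I5, I3, I3, I1, I4, I3, I0, I5,
I2]), ((I3, R1, K1), [I0, I4, I2, I2, I1, I3, I1, I3, I4, I3, I0, I5, I5]), ((I3, R1, K2), [I2, I0, I4, I3, I1, I2,
I1, I4, I3, I0, I5, I3, I5]), ((I3, R2, K1), [I2, I0, I4, I1, I5, I2, I3, I1, I3, I0, I3, I5, I4]), ((I3, R3, K1),
[I0, I4, I2, I2, I1, I5, I1, I3, I4, I3, I0, I3, I5]), ((I4, R0, K0), [I0, I4, I4, I1, I5, I2, I4, I1, I3, I3, I0,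
I5, I2]), ((I4, R1, K0), [I0, I4, I2, I1, I5, I4, I4, I1, I3, I3, I0, I5, I2]), ((I4, R1, K1), [I0, I4, I2, I2, I1,
I4, I1, I4, I3, I3, I0, I5, I5]), ((I4, R1, K2), [I2, I0, I4, I1, I4, I2, I3, I1, I4, I0, I5, I3, I5]), ((I4, R2,
K0), [I4, I0, I2, I2, I1, I5, I1, I4, I4, I0, I5, I3, I3]), ((I4, R3, K0), [I2, I0, I4, I1, I5, I2, I4, I1, I3, I0,
I4, I5, I3]), ((I4, R3, K1), [I0, I4, I2, I2, I1, I5, I1, I4, I3, I3, I0, I4, I5]), ((I4, R3, K2), [I2, I0, I4, I1,
I5, I2, I3, I1, I4, I0, I4, I3, I5]), ((I5, R0, K0), [I0, I4, I5, I1, I5, I2, I3, I1, I4, I5, I0, I3, I2]), ((I5,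
R0, K1), [I2, I0, I5, I1, I5, I2, I3, I1, I4, I0, I5, I3, I4]), ((I5, R0, K2), [I0, I5, I2, I2, I1, I5, I1, I4, I3,
I3, I0, I5, I4]), ((I5, R1, K0), [I0, I4, I2, I1, I5, I5, I3, I1, I4, I5, I0, I3, I2]), ((I5, R2, K0), [I0, I4, I2,
I2, I1, I5, I1, I5, I4, I5, I0, I3, I3]), ((I5, R2, K1), [I2, I0, I4, I1, I5, I2, I3, I1, I5, I0, I5, I3, I4]),
((I5, R2, K2), [I0, I4, I2, I2, I1, I5, I1, I5, I3, I3, I0, I5, I4]), ((I5, R3, K0), [I2, I0, I4, I5, I1, I2, I1,
I4, I3, I0, I5, I5, I3])]"

lemma completions_complete: "list_all (\<lambda>(c, xs). completes c (zip xs (jk_lines @ [snd c]))) completions"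
  by code_simp

lemma completions_exist:
  assumes "halves i r k = 0" shows "\<exists>ys. completes (i, r, k) ys"
proof -
  have "list_all (\<lambda>i. list_all (\<lambda>(r, k). has k (rowof r (pattern i)) \<or> (i, r, k) \<in> set (map fst completions)) jk_lines)
      [I0, I1, I2, I3, I4, I5]" by code_simp
  then have *: "\<forall>i\<in>{I0, I1, I2, I3, I4, I5}. \<forall>(r, k)\<in>set jk_lines. has k (rowof r (pattern i)) \<or> (i, r, k) \<in> fst ` set completions"
    by (simp only: list_all_iff list.set set_map)
  have "i \<in> {I0, I1, I2, I3, I4, I5}" by (cases i) simp_all
  moreover have "(r, k) \<in> set jk_lines" by (cases r; cases k; simp add: jk_lines_def)
  moreover have "\<not> has k (rowof r (pattern i))" using assms by (auto simp: halves_def)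
  ultimately have "(i, r, k) \<in> fst ` set completions" using * by blast
  then obtain xs where "((i, r, k), xs) \<in> set completions" by auto
  then show ?thesis using completions_complete unfolding list_all_iff by blast
qed

lemma vlach_column:
  assumes "\<not> 0 < zstar $ c"
  shows "vlach + column c A643 \<in> monoid_of (columns A643)"
proof -
  obtain i r k where c: "c = (idx_index i, row_index r, col_index k)" by (rule cell_cases)
  have "halves i r k = 0" using assms zstar_entry[of i r k] by (simp add: c entry_def halves_def split: if_splits)
  then obtain ys where ys: "completes (i, r, k) ys" using completions_exist by blast
  define n where "n = (\<lambda>d. count_list ys (inv idx_index (fst d), inv row_index (fst (snd d)), inv col_index (snd (snd d))))"
  have N: "entry (nat_table n) i' r' k' = real (count_list ys (i', r', k'))" for i' r' k'
    using bij_idx_index bij_row_index bij_col_index by (simp add: entry_def nat_table_def n_def inv_f_f bij_is_inj)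
  have jk: "(a, b) \<in> set jk_lines" for a b by (cases a; cases b; simp add: jk_lines_def)
  have y1: "length (filter (\<lambda>y. snd y = (a, b)) ys) = 1 + (if (r, k) = (a, b) then 1 else 0)" for a b
    using ys jk[of a b] unfolding completes_def list_all_iff by fastforce
  have y2: "length (filter (\<lambda>y. fst y = a \<and> snd (snd y) = b) ys) = ik_value a b + (if i = a \<and> k = b then 1 else 0)" for a b
    using ys unfolding completes_def by (cases a; cases b) simp_all
  have y3: "length (filter (\<lambda>y. fst y = a \<and> fst (snd y) = b) ys) = ij_value a b + (if i = a \<and> r = b then 1 else 0)" for a b
    using ys unfolding completes_def by (cases a; cases b) simp_all
  have r1: "(y \<in> range (\<lambda>i. (i, a, b))) = (snd y = (a, b))" for y :: "idx \<times> row \<times> col" and a b by (cases y) auto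
  have r2: "(y \<in> range (\<lambda>r. (a, r, b))) = (fst y = a \<and> snd (snd y) = b)" for y :: "idx \<times> row \<times> col" and a b by (cases y) auto
  have r3: "(y \<in> range (\<lambda>k. (a, b, k))) = (fst y = a \<and> fst (snd y) = b)" for y :: "idx \<times> row \<times> col" and a b by (cases y) auto
  have "vlach + column c A643 = line_sums (nat_table n)"
  proof (rule line_vec_eqI)
    show "(vlach + column c A643) $ Inl (row_index a, col_index b) = line_sums (nat_table n) $ Inl (row_index a, col_index b)" for a b
      using sum_count_list[of "\<lambda>i. (i, a, b)" ys] y1[of a b] unfolding r1
      by (cases "a = r \<and> b = k") (auto simp: inj_def N line_sums_index vlach_index column_A643 c entry_axis)
    show "(vlach + column c A643) $ Inr (Inl (idx_index a, col_index b)) = line_sums (nat_table n) $ Inr (Inl (idx_index a, col_index b))" for a b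
      using sum_count_list[of "\<lambda>r. (a, r, b)" ys] y2[of a b] unfolding r2
      by (cases "a = i \<and> b = k") (auto simp: inj_def N line_sums_index vlach_index column_A643 c entry_axis)
    show "(vlach + column c A643) $ Inr (Inr (idx_index a, row_index b)) = line_sums (nat_table n) $ Inr (Inr (idx_index a, row_index b))" for a b
      using sum_count_list[of "\<lambda>k. (a, b, k)" ys] y3[of a b] unfolding r3
      by (cases "a = i \<and> b = r") (auto simp: inj_def N line_sums_index vlach_index column_A643 c entry_axis)
  qed
  then show ?thesis unfolding monoid_A643 by blast
qed

section \<open>Every hole is a permuted translate of \<open>vlach\<close>\<close>

lemma sum_two: "i \<noteq> j \<Longrightarrow> (\<Sum>l\<in>UNIV. (if l = i then 1 else if l = j then - 1 else 0) :: real) = 0" for i j :: "'a :: finite"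
proof -
  assume "i \<noteq> j"
  then have "(if l = i then 1 else if l = j then - 1 else 0 :: real) = (if l = i then 1 else 0) - (if l = j then 1 else 0)" for l
    by simp
  then show ?thesis by (simp add: sum_subtractf)
qed

lemma line_sums_0I:
  assumes "\<And>i r. (\<Sum>k\<in>UNIV. X i r k) = 0" "\<And>i k. (\<Sum>r\<in>UNIV. X i r k) = 0" "\<And>r k. (\<Sum>i\<in>UNIV. X i r k) = 0"
  shows "line_sums (table X) = 0"
  by (rule line_vec_eqI) (simp_all add: line_sums_index entry_table assms)

text \<open>The kernel clause follows from \<open>min\<close>, by moving along a hypothetical
  relation until an entry vanishes; the cube clause follows from applying \<open>less1\<close> to
  the table after the move.\<close>

lemma good_entry:
  assumes nn: "\<forall>c. 0 \<le> z $ c" and e: "line_sums z = h" and int: "\<forall>l. h $ l \<in> \<int>"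
    and less1: "\<And>y c. \<forall>c. 0 \<le> y $ c \<Longrightarrow> line_sums y = h \<Longrightarrow> y $ c < 1"
    and min: "\<And>y. \<forall>c. 0 \<le> y $ c \<Longrightarrow> line_sums y = h \<Longrightarrow> card {c. z $ c \<noteq> 0} \<le> card {c. y $ c \<noteq> 0}"
  shows "good (entry z)"
  unfolding good_def
proof (intro conjI allI impI)
  fix i r k
  show "0 \<le> entry z i r k" "entry z i r k < 1" using nn less1[OF nn e] by (simp_all add: entry_def)
  show "(\<Sum>k\<in>UNIV. entry z i r k) \<in> \<int>" "(\<Sum>r\<in>UNIV. entry z i r k) \<in> \<int>" "(\<Sum>i\<in>UNIV. entry z i r k) \<in> \<int>"
    unfolding line_sums_index[symmetric] e using int by blast+
next
  fix U :: "idx \<Rightarrow> row \<Rightarrow> col \<Rightarrow> real" and i r k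
  assume U0: "\<forall>i r k. entry z i r k = 0 \<longrightarrow> U i r k = 0" and U1: "\<forall>i r. (\<Sum>k\<in>UNIV. U i r k) = 0"
    and U2: "\<forall>i k. (\<Sum>r\<in>UNIV. U i r k) = 0" and U3: "\<forall>r k. (\<Sum>i\<in>UNIV. U i r k) = 0"
  show "U i r k = 0"
  proof (rule ccontr)
    assume ne: "U i r k \<noteq> 0"
    let ?u = "table U"
    have lu: "line_sums ?u = 0" by (rule line_sums_0I) (use U1 U2 U3 in blast)+
    have u0: "?u $ c = 0" if "z $ c = 0" for c
    proof -
      obtain a b d where c: "c = (idx_index a, row_index b, col_index d)" by (rule cell_cases)
      show ?thesis using that U0 entry_table[of U a b d] by (simp add: c entry_def)
    qed
    \<comment> \<open>A row with zero sum and a nonzero entry has a negative entry, which bounds the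
      step along \<open>?u\<close>.\<close>
    have "\<exists>k. U i r k < 0"
    proof (rule ccontr)
      assume "\<not> ?thesis"
      then have "\<forall>k\<in>UNIV. U i r k = 0" using U1 by (subst sum_nonneg_eq_0_iff[symmetric]) (auto simp: not_less)
      then show False using ne by blast
    qed
    then obtain k' where "U i r k' < 0" by blast
    then have neg: "?u $ (idx_index i, row_index r, col_index k') < 0" using entry_table[of U i r k'] by (simp add: entry_def)
    define N where "N = {c. ?u $ c < 0}"
    have N: "finite N" "N \<noteq> {}" using neg by (auto simp: N_def)
    \<comment> \<open>The largest step along \<open>?u\<close> that keeps all entries nonnegative;
      it makes the entry at a minimizing cell \<open>c0\<close> zero.\<close>
    define t where "t = Min ((\<lambda>c. z $ c / - ?u $ c) ` N)"
    have "t \<in> (\<lambda>c. z $ c / - ?u $ c) ` N" unfolding t_def by (rule Min_in) (use N in auto)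
    then obtain c0 where c0': "t = z $ c0 / - ?u $ c0" "c0 \<in> N" by (rule imageE)
    note c0 = c0'(2,1)
    have t0: "0 \<le> t" unfolding c0(2) by (rule divide_nonneg_pos) (use nn[THEN spec, of c0] c0(1) in \<open>simp_all add: N_def\<close>)
    have tN: "t \<le> z $ c / - ?u $ c" if "c \<in> N" for c using that N(1) by (simp add: t_def)
    define y where "y = z + t *\<^sub>R ?u"
    have "0 \<le> y $ c" for c
    proof (cases "c \<in> N")
      case True
      then have "0 < - ?u $ c" by (simp add: N_def)
      then have "t * - ?u $ c \<le> z $ c" using tN[OF True] by (simp only: pos_le_divide_eq)
      then show ?thesis by (simp add: y_def)
    next
      case False
      then have "0 \<le> t * ?u $ c" using t0 by (simp add: N_def not_less)
      then show ?thesis using nn[THEN spec, of c] by (simp add: y_def)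
    qed
    moreover have "line_sums y = h" by (simp add: y_def line_sums_linear lu e)
    ultimately have le: "card {c. z $ c \<noteq> 0} \<le> card {c. y $ c \<noteq> 0}" by (intro min allI)
    have un: "?u $ c0 < 0" using c0(1) by (simp add: N_def)
    then have "t * ?u $ c0 = - z $ c0" unfolding c0(2) by simp
    then have "y $ c0 = 0" by (simp add: y_def)
    moreover have "z $ c0 \<noteq> 0" using un u0[of c0] by auto
    moreover have "y $ c = 0" if "z $ c = 0" for c using that u0 by (simp add: y_def)
    ultimately have "{c. y $ c \<noteq> 0} \<subset> {c. z $ c \<noteq> 0}" by blast
    then have "card {c. y $ c \<noteq> 0} < card {c. z $ c \<noteq> 0}" by (rule psubset_card_mono[rotated]) simp
    with le show False by simp
  qed
next
  fix i j :: idx and a b :: row and x y :: col and \<epsilon> :: real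
  assume ne: "i \<noteq> j" "a \<noteq> b" "x \<noteq> y" and eps: "0 < \<epsilon>" "\<epsilon> \<le> entry z i a y" "\<epsilon> \<le> entry z i b x"
    "\<epsilon> \<le> entry z j a x" "\<epsilon> \<le> entry z j b y"
  \<comment> \<open>The cube move as a product of three vectors with one entry 1, one entry -1 and
    zeros elsewhere. Summing over an index turns the corresponding factor into zero.\<close>
  define D where "D = (\<lambda>l r k. (if l = i then 1 else if l = j then - 1 else 0) *
    ((if r = a then 1 else if r = b then - 1 else 0) * (if k = x then 1 else if k = y then - 1 else 0 :: real)))"
  have "(\<Sum>k\<in>UNIV. D l r k) = 0" for l r
    unfolding D_def by (simp only: sum_distrib_left[symmetric] sum_two[OF ne(3)] mult_zero_right)
  moreover have "(\<Sum>r\<in>UNIV. D l r k) = 0" for l k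
    unfolding D_def by (simp only: sum_distrib_left[symmetric] sum_distrib_right[symmetric] sum_two[OF ne(2)] mult_zero_left mult_zero_right)
  moreover have "(\<Sum>l\<in>UNIV. D l r k) = 0" for r k
    unfolding D_def by (simp only: sum_distrib_right[symmetric] sum_two[OF ne(1)] mult_zero_left)
  ultimately have "line_sums (table D) = 0" by (rule line_sums_0I)
  then have ls: "line_sums (z + \<epsilon> *\<^sub>R table D) = h" by (simp add: line_sums_linear e)
  have en: "entry (z + \<epsilon> *\<^sub>R table D) l r k = entry z l r k + \<epsilon> * D l r k" for l r k
    by (simp add: entry_linear entry_table)
  have nonneg: "0 \<le> entry z l r k + \<epsilon> * D l r k" for l r k
  proof -
    have "0 \<le> entry z l r k" using nn by (simp add: entry_def)
    then show ?thesis using eps ne unfolding D_def by auto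
  qed
  have pos: "\<forall>c. 0 \<le> (z + \<epsilon> *\<^sub>R table D) $ c"
  proof
    fix c
    obtain l r k where c: "c = (idx_index l, row_index r, col_index k)" by (rule cell_cases)
    have "0 \<le> entry (z + \<epsilon> *\<^sub>R table D) l r k" unfolding en by (rule nonneg)
    then show "0 \<le> (z + \<epsilon> *\<^sub>R table D) $ c" unfolding c entry_def .
  qed
  have "entry (z + \<epsilon> *\<^sub>R table D) l r k < 1" for l r k unfolding entry_def by (rule less1[OF pos ls])
  then have lt: "entry z l r k + \<epsilon> * D l r k < 1" for l r k unfolding en .
  show "entry z i a x + \<epsilon> < 1" "entry z i b y + \<epsilon> < 1" "entry z j a y + \<epsilon> < 1" "entry z j b x + \<epsilon> < 1"
    using lt[of i a x] lt[of i b y] lt[of j a y] lt[of j b x] ne ne[symmetric] by (simp_all add: D_def)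
qed

lemma hole_small_entries:
  assumes h: "h \<in> holes A643" and less1: "\<And>y c. \<forall>c. 0 \<le> y $ c \<Longrightarrow> line_sums y = h \<Longrightarrow> y $ c < 1"
  shows "\<exists>\<sigma>\<in>index_perms. h = act \<sigma> vlach"
proof -
  obtain z0 where z0: "(\<forall>c. 0 \<le> z0 $ c) \<and> line_sums z0 = h" using h unfolding holes_def cone_A643 by blast
  obtain z where z: "(\<forall>c. 0 \<le> z $ c) \<and> line_sums z = h"
    "\<And>y. (\<forall>c. 0 \<le> y $ c) \<and> line_sums y = h \<Longrightarrow> card {c. z $ c \<noteq> 0} \<le> card {c. y $ c \<noteq> 0}"
    using ex_has_least_nat[of "\<lambda>z. (\<forall>c. 0 \<le> z $ c) \<and> line_sums z = h" z0 "\<lambda>z. card {c. z $ c \<noteq> 0}"] z0 by blast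
  have g: "good (entry z)" using good_entry[of z h] z less1 h by (auto simp: holes_def)
  have "h \<noteq> 0"
  proof
    assume "h = 0"
    then have "h = line_sums (nat_table (\<lambda>_. 0))" by (simp add: nat_table_def zero_vec_def[symmetric] line_sums_linear)
    then show False using h unfolding holes_def monoid_A643 by blast
  qed
  then obtain i0 r0 k0 where "entry z i0 r0 k0 \<noteq> 0"
    using z(1) line_sums_linear(4) entry_eqI[of z 0] by (auto simp: entry_linear)
  from good_vlach[OF g this] obtain \<pi> \<rho> \<kappa> where b: "bij \<pi>" "bij \<rho>" "bij \<kappa>"
    and e: "\<And>i r k. entry z (\<pi> i) (\<rho> r) (\<kappa> k) = halves i r k" by blast
  define \<sigma> where "\<sigma> = (idx_index \<circ> \<pi> \<circ> inv idx_index, row_index \<circ> \<rho> \<circ> inv row_index, col_index \<circ> \<kappa> \<circ> inv col_index)"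
  have s: "\<sigma> \<in> index_perms"
    unfolding \<sigma>_def index_perms_def using b bij_idx_index bij_row_index bij_col_index
    by (auto intro!: bij_imp_permutes bij_comp bij_imp_bij_inv)
  have "zstar = (\<chi> c. z $ cell_map \<sigma> c)"
  proof (rule entry_eqI)
    show "entry zstar i r k = entry (\<chi> c. z $ cell_map \<sigma> c) i r k" for i r k
      using e[of i r k] bij_idx_index bij_row_index bij_col_index
      by (simp add: zstar_entry) (simp add: entry_def cell_map_def \<sigma>_def inv_f_f bij_is_inj)
  qed
  then have "act \<sigma> vlach = h" using act_line_sums[OF s, of z] z(1) by (simp add: line_sums_zstar[symmetric])
  with s show ?thesis by blast
qed

text \<open>Each column contributes 1, so \<open>total\<close> is a natural number on holes and
  drops by one when a column is subtracted. It is the induction measure of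
  \<open>hole_form\<close>.\<close>

definition total :: "real ^ line \<Rightarrow> real" where "total h = (\<Sum>p\<in>UNIV. h $ Inl p)"

lemma total_column: "total (column c A643) = 1"
proof -
  obtain i j k where c: "c = (i, j, k)" by (cases c)
  have "(column c A643) $ Inl p = (if p = (j, k) then 1 else 0)" for p
    by (cases p) (auto simp: column_A643 line_sums_def axis_def c)
  then show ?thesis by (simp add: total_def)
qed

lemma hole_form:
  assumes "h \<in> holes A643" "total h = real m"
  shows "\<exists>\<sigma>\<in>index_perms. \<exists>s\<in>monoid_of G643. h = act \<sigma> (vlach + s)"
  using assms
proof (induction m arbitrary: h rule: less_induct)
  case (less m)
  have zero: "0 \<in> monoid_of G643"
    unfolding monoid_G643 by (rule CollectI, rule exI[of _ "\<lambda>_. 0"]) (simp add: nat_table_def zero_vec_def[symmetric] line_sums_linear)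
  show ?case
  proof (cases "\<exists>y c. (\<forall>c. 0 \<le> y $ c) \<and> line_sums y = h \<and> 1 \<le> y $ c")
    case False
    then obtain \<sigma> where "\<sigma> \<in> index_perms" "h = act \<sigma> vlach" using hole_small_entries[OF less.prems(1)] by (metis not_less)
    then show ?thesis using zero by force
  next
    case True
    then obtain y c where y: "\<forall>c. 0 \<le> y $ c" "line_sums y = h" "1 \<le> y $ c" by blast
    let ?h = "h - column c A643"
    have "?h = line_sums (y - axis c 1)" by (simp add: line_sums_linear y column_A643)
    moreover have nn: "\<forall>d. 0 \<le> (y - axis c 1) $ d" using y by (auto simp: axis_def)
    ultimately have cone: "?h \<in> cone_of A643" unfolding cone_A643 by blast
    have "?h + column c A643 = h" by simp
    then have "?h \<notin> monoid_of (columns A643)"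
      using monoid_add[OF _ monoid_column[of c], of ?h] less.prems(1) by (auto simp: holes_def)
    moreover have "\<forall>l. ?h $ l \<in> \<int>" using monoid_Ints[OF monoid_column[of c]] less.prems(1) by (auto simp: holes_def)
    ultimately have hole: "?h \<in> holes A643" using cone by (simp add: holes_def)
    have tot: "total ?h = real m - 1" using total_column[of c] less.prems(2) by (simp add: total_def sum_subtractf)
    have "0 \<le> total ?h" unfolding total_def \<open>?h = line_sums (y - axis c 1)\<close>
      using nn by (intro sum_nonneg) (auto simp: line_sums_def intro!: sum_nonneg)
    then have "m - 1 < m" "total ?h = real (m - 1)" using tot by auto
    from less.IH[OF this(1) hole this(2)] obtain \<sigma> s where s: "\<sigma> \<in> index_perms" "s \<in> monoid_of G643" "?h = act \<sigma> (vlach + s)" by blast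
    \<comment> \<open>The cell \<open>c\<close> before the permutation is applied; its column either
      joins \<open>s\<close> or is tested against the unpermuted \<open>vlach\<close>.\<close>
    obtain d where d: "c = cell_map \<sigma> d" using bij_cell_map[OF s(1)] by (metis bij_pointE)
    have "h = act \<sigma> (vlach + s) + column c A643" using s(3) by (simp add: algebra_simps)
    also have "\<dots> = act \<sigma> (vlach + (s + column d A643))"
      by (simp add: act_add act_column[OF s(1)] d add.assoc)
    finally have hd: "h = act \<sigma> (vlach + (s + column d A643))" .
    show ?thesis
    proof (cases "0 < zstar $ d")
      case True
      then show ?thesis using monoid_G643_add[OF True s(2)] s(1) hd by blast
    next
      case False
      have "(vlach + column d A643) + s \<in> monoid_of (columns A643)"
        using monoid_add[OF vlach_column[OF False]] s(2) monoid_G643_subset by blast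
      then have "vlach + (s + column d A643) \<in> monoid_of (columns A643)" by (simp add: ac_simps)
      then have "h \<in> monoid_of (columns A643)" using act_monoid[OF s(1)] hd by simp
      then show ?thesis using less.prems(1) by (simp add: holes_def)
    qed
  qed
qed

lemma hole_total: "h \<in> holes A643 \<Longrightarrow> \<exists>m. total h = real m"
proof -
  assume h: "h \<in> holes A643"
  then obtain z where z: "h = line_sums z" "\<forall>c. 0 \<le> z $ c" unfolding holes_def cone_A643 by blast
  have "total h \<in> \<int>" unfolding total_def using h by (intro Ints_sum) (auto simp: holes_def)
  moreover have "0 \<le> total h" unfolding total_def z(1)
    using z(2) by (intro sum_nonneg) (auto simp: line_sums_def intro!: sum_nonneg)
  ultimately show ?thesis by (metis Ints_cases of_int_0_le_iff of_nat_nat)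
qed

section \<open>The size of \<open>G643\<close> and the description of all holes\<close>

definition pattern_cells :: "(idx \<times> row \<times> col) list" where
  "pattern_cells = filter (\<lambda>(i, r, k). has k (rowof r (pattern i)))
     (List.product [I0, I1, I2, I3, I4, I5] (List.product [R0, R1, R2, R3] [K0, K1, K2]))"

lemma card_G643: "card G643 = 24"
proof -
  let ?f = "\<lambda>(i, r, k). (idx_index i, row_index r, col_index k)"
  have 1: "(i, r, k) \<in> set pattern_cells \<longleftrightarrow> has k (rowof r (pattern i))" for i r k
  proof -
    have "i \<in> set [I0, I1, I2, I3, I4, I5]" by (cases i) simp_all
    moreover have "r \<in> set [R0, R1, R2, R3]" by (cases r) simp_all
    moreover have "k \<in> set [K0, K1, K2]" by (cases k) simp_all
    ultimately show ?thesis 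
      by (simp only: pattern_cells_def set_filter set_product mem_Collect_eq mem_Sigma_iff prod.case simp_thms)
  qed
  have 2: "0 < zstar $ (idx_index i, row_index r, col_index k) \<longleftrightarrow> has k (rowof r (pattern i))" for i r k
    using zstar_entry[of i r k] by (simp add: entry_def halves_def)
  have "{c. 0 < zstar $ c} = ?f ` set pattern_cells"
  proof (intro equalityI subsetI)
    fix c assume c: "c \<in> {c. 0 < zstar $ c}"
    obtain i r k where e: "c = (idx_index i, row_index r, col_index k)" by (rule cell_cases)
    then have "(i, r, k) \<in> set pattern_cells" using c 1 2 by simp
    then show "c \<in> ?f ` set pattern_cells" by (rule rev_image_eqI) (simp add: e)
  next
    fix c assume "c \<in> ?f ` set pattern_cells"
    then obtain p where p: "p \<in> set pattern_cells" "c = ?f p" by (elim imageE)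
    obtain i r k where p3: "p = (i, r, k)" by (rule prod_cases3)
    have "has k (rowof r (pattern i))" using p(1) unfolding p3 1 .
    then have "0 < zstar $ (idx_index i, row_index r, col_index k)" unfolding 2 .
    then show "c \<in> {c. 0 < zstar $ c}" by (simp add: p(2) p3)
  qed
  moreover have "inj ?f"
    using bij_idx_index bij_row_index bij_col_index by (intro injI) (clarsimp simp: bij_def inj_eq)
  then have "card (?f ` set pattern_cells) = card (set pattern_cells)"
    by (rule card_image[OF inj_on_subset]) (rule subset_UNIV)
  moreover have "distinct pattern_cells \<and> length pattern_cells = 24" by code_simp
  ultimately have "card {c. 0 < zstar $ c} = 24" using distinct_card[of pattern_cells] by simp
  moreover have "inj_on (\<lambda>c. column c A643) {c. 0 < zstar $ c}" using column_inj by (intro inj_onI)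
  ultimately show ?thesis unfolding G643_image by (simp add: card_image)
qed

theorem corollary4:
  "vlach \<in> holes A643 \<and>
   {z :: real ^ cell. (\<forall>c. 0 \<le> z $ c) \<and> A643 *v z = vlach} = {zstar} \<and>
   card G643 = 24 \<and>
   holes A643 = {act \<sigma> (vlach + s) | \<sigma> s. \<sigma> \<in> index_perms \<and> s \<in> monoid_of G643} \<and>
   (\<forall>h \<in> holes A643. \<exists>!p. \<exists>\<sigma> \<in> index_perms. \<exists>s \<in> monoid_of G643.
      h = act \<sigma> (vlach + s) \<and> p = (act \<sigma> vlach, act \<sigma> s))"
proof (intro conjI ballI)
  have zero: "nat_table (\<lambda>_. 0) = 0" by (simp add: nat_table_def zero_vec_def)
  have z0: "0 \<in> monoid_of G643"
    unfolding monoid_G643 by (rule CollectI, rule exI[of _ "\<lambda>_. 0"]) (simp add: zero line_sums_linear)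
  have id: "(id, id, id) \<in> index_perms" by (simp add: index_perms_def permutes_id)
  have "perm_line (id, id, id) = id" by (simp add: perm_line_def map_prod.id sum.map_id0)
  then have "act (id, id, id) vlach = vlach" by (simp add: act_def)
  then show "vlach \<in> holes A643" using vlach_hole[OF id z0] by simp
  have "z = zstar" if "\<forall>c. 0 \<le> z $ c" "A643 *v z = vlach" for z
    using unique_solution[of z "\<lambda>_. 0"] that by (simp add: zero A643_mult line_sums_linear)
  moreover have "0 \<le> zstar $ c" for c using zstar_cases[of c] by auto
  ultimately show "{z :: real ^ cell. (\<forall>c. 0 \<le> z $ c) \<and> A643 *v z = vlach} = {zstar}"
    by (auto simp: A643_mult line_sums_zstar)
  show "card G643 = 24" by (rule card_G643)
  have form: "\<exists>\<sigma>\<in>index_perms. \<exists>s\<in>monoid_of G643. h = act \<sigma> (vlach + s)" if "h \<in> holes A643" for h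
    using hole_form that hole_total by blast
  then show "holes A643 = {act \<sigma> (vlach + s) | \<sigma> s. \<sigma> \<in> index_perms \<and> s \<in> monoid_of G643}"
    using vlach_hole by blast
  fix h assume "h \<in> holes A643"
  then obtain \<sigma> s where s: "\<sigma> \<in> index_perms" "s \<in> monoid_of G643" "h = act \<sigma> (vlach + s)" using form by blast
  show "\<exists>!p. \<exists>\<sigma>\<in>index_perms. \<exists>s\<in>monoid_of G643. h = act \<sigma> (vlach + s) \<and> p = (act \<sigma> vlach, act \<sigma> s)"
  proof (rule ex1I[of _ "(act \<sigma> vlach, act \<sigma> s)"])
    show "\<exists>\<sigma>'\<in>index_perms. \<exists>s'\<in>monoid_of G643. h = act \<sigma>' (vlach + s') \<and> (act \<sigma> vlach, act \<sigma> s) = (act \<sigma>' vlach, act \<sigma>' s')"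
      using s by blast
    fix p assume "\<exists>\<sigma>\<in>index_perms. \<exists>s\<in>monoid_of G643. h = act \<sigma> (vlach + s) \<and> p = (act \<sigma> vlach, act \<sigma> s)"
    then obtain \<sigma>' s' where s': "\<sigma>' \<in> index_perms" "s' \<in> monoid_of G643" "h = act \<sigma>' (vlach + s')" "p = (act \<sigma>' vlach, act \<sigma>' s')"
      by blast
    have "act \<sigma>' vlach = act \<sigma> vlach" by (rule unique_summands) (use s s' in auto)
    moreover from this have "act \<sigma>' s' = act \<sigma> s" using s(3) s'(3) by (simp add: act_add)
    ultimately show "p = (act \<sigma> vlach, act \<sigma> s)" using s'(4) by simp
  qed
qed

end
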